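(* Let $S\in\mathcal{CPMM}$ with Markov partition $\mathcal P$ be recurrent and linearizable. Assume that $T$ is a recurrent centralized perturbation of $S$ on $\mathcal P'\subset\mathcal P$. If there are only finitely many elements $k\in\mathcal P'$ that are $S$-covered by elements of $\mathcal P\setminus\mathcal P'$ (i.e. for which there is $i\in\mathcal P\setminus\mathcal P'$ with $S(i)\supset k$), then $T$ is linearizable.
   Context: A continuous map on a closed interval is piecewise monotone if the interval splits into finitely many subintervals on each of which the map is monotone. A Markov partition for a continuous map $T:[0,1]\to[0,1]$ is a finite or countably infinite collection $\mathcal P$ of closed nondegenerate subintervals of $[0,1]$ such that: (1) distinct elements of $\mathcal P$ have disjoint interiors and $[0,1]\setminus\bigcup\mathcal P$ is at most countable; (2) $T|_i$ is monotone for each $i\in\mathcal P$ (classical), or piecewise monotone for each $i\in\mathcal P$ (slack); (3) for all $i,j\in\mathcal P$ and every maximal interval $i'\subset i$ of monotonicity of $T$, if $T(i')\cap j^\circ\ne\emptyset$ then $T(i')\supset j$. $\mathcal{CPMM}$ is the set of continuous maps $T:[0,1]\to[0,1]$ that are topologically mixing (for all nonempty open $U,V$ there is $n$ with $T^m(U)\cap V\neq\emptyset$ for all $m\ge n$), admit a countably infinite Markov partition, and have finite topological entropy $h_{top}(T)<\infty$. Transition matrix of $T$ with respect to $\mathcal P$: $M=(m_{ij})_{i,j\in\mathcal P}$, where $m_{ij}=0$ if $T(i)\not\supset j$, and otherwise $m_{ij}$ is the maximal number of intervals $i_1,\dots,i_\kappa\subset i$ with pairwise disjoint interiors such that each $T|_{i_\ell}$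 is monotone and $T(i_\ell)\supset j$ (this number is finite). It is irreducible and aperiodic. For an irreducible nonnegative matrix $M$ with powers $M^n=(m_{ij}(n))$, let $R$ be the common radius of convergence of the series $\sum_{n\ge0}m_{ij}(n)z^n$ (the Perron value is $\lambda_M=1/R<\infty$). Let $f_{ij}(1)=m_{ij}$, $f_{ij}(n+1)=\sum_{\alpha\ne j}m_{i\alpha}f_{\alpha j}(n)$ and $F_{ij}(z)=\sum_{n\ge1}f_{ij}(n)z^n$. $M$ is recurrent if $F_{ii}(R)=1$ and transient if $F_{ii}(R)<1$ (independently of $i$). A map in $\mathcal{CPMM}$ is called recurrent if its transition matrix is recurrent; this does not depend on the choice of the Markov partition. Perturbation on $\mathcal P'$: let $S\in\mathcal{CPMM}$ with Markov partition $\mathcal P$ and let $\mathcal P'\subset\mathcal P$ (possibly infinite) be such that $S|_j$ is monotone for each $j\in\mathcal P'$. $T\in\mathcal{CPMM}$ is a (window) perturbation of $S$ on $\mathcal P'$ if $T=S$ on $[0,1]\setminus\bigcup_{j\in\mathcal P'}j^\circ$ and for each $j\in\mathcal P'$ there are $k_j\in\mathbb N$ (the order, depending on $j$) and a nontrivial partition $(j_i)_{i=1}^{2k_j+1}$ of $j$ into nondegenerate subintervals such that $T(j_i)=S(j)$ and $T|_{j_i}$ is monotone for each $i$. It is centralized if there is an interval $[a,b]$ with $a,b\in(0,1)\setminus\bigcup_{i\in\mathcal P}i^\circ$ and $\bigcup\mathcal P'\subset[a,b]$. The empty perturbation $T=S$ ($\mathcal P'=\emptyset$) also counts as centralized. A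 continuous interval map has constant slope $s$ if its derivative has absolute value $s$ at all but countably many points. A map $T$ is linearizable if it is topologically conjugate to an interval map $[0,1]\to[0,1]$ of constant slope $e^{h_{top}(T)}$. *)

theory Defs
  imports "HOL-Analysis.Analysis"
begin

text \<open>Interval maps are functions on all reals; every notion below depends only on the values
  on the closed unit interval. Monotone means weakly increasing or weakly decreasing.\<close>

definition monotone_map_on :: "real set \<Rightarrow> (real \<Rightarrow> real) \<Rightarrow> bool" where
  "monotone_map_on J T \<longleftrightarrow> mono_on J T \<or> antimono_on J T"

definition piecewise_monotone_on :: "real set \<Rightarrow> (real \<Rightarrow> real) \<Rightarrow> bool" where
  "piecewise_monotone_on I T \<longleftrightarrow> (\<exists>D. D division_of I \<and> (\<forall>J\<in>D. monotone_map_on J T))"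

definition maximal_monotone_interval :: "(real \<Rightarrow> real) \<Rightarrow> real set \<Rightarrow> real set \<Rightarrow> bool" where
  "maximal_monotone_interval T i i' \<longleftrightarrow>
     is_interval i' \<and> i' \<subseteq> i \<and> monotone_map_on i' T \<and>
     (\<forall>J. is_interval J \<and> i' \<subseteq> J \<and> J \<subseteq> i \<and> monotone_map_on J T \<longrightarrow> J = i')"

text \<open>This is the slack version of a Markov partition; the classical version (monotone on each
  element) is a special case.\<close>

definition markov_partition :: "(real \<Rightarrow> real) \<Rightarrow> real set set \<Rightarrow> bool" where
  "markov_partition T P \<longleftrightarrow>
     countable P \<and>
     (\<forall>i\<in>P. \<exists>a b. 0 \<le> a \<and> a < b \<and> b \<le> 1 \<and> i = {a..b}) \<and>
     (\<forall>i\<in>P. \<forall>j\<in>P. i \<noteq> j \<longrightarrow> interior i \<inter> interior j = {}) \<and>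
     countable ({0..1} - \<Union>P) \<and>
     (\<forall>i\<in>P. piecewise_monotone_on i T) \<and>
     (\<forall>i\<in>P. \<forall>j\<in>P. \<forall>i'. maximal_monotone_interval T i i' \<and> T ` i' \<inter> interior j \<noteq> {}
        \<longrightarrow> j \<subseteq> T ` i')"

definition topologically_mixing :: "(real \<Rightarrow> real) \<Rightarrow> bool" where
  "topologically_mixing T \<longleftrightarrow>
     (\<forall>U V. openin (top_of_set {0..1}) U \<and> openin (top_of_set {0..1}) V \<and> U \<noteq> {} \<and> V \<noteq> {}
        \<longrightarrow> (\<exists>n. \<forall>m\<ge>n. (T ^^ m) ` U \<inter> V \<noteq> {}))"

text \<open>Topological entropy on the compact unit interval, in Bowen's form: the exponential growth
  rate of the maximal cardinality of separated sets.\<close>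

definition separated_set :: "(real \<Rightarrow> real) \<Rightarrow> nat \<Rightarrow> real \<Rightarrow> real set \<Rightarrow> bool" where
  "separated_set T n \<epsilon> E \<longleftrightarrow>
     finite E \<and> E \<subseteq> {0..1} \<and>
     (\<forall>x\<in>E. \<forall>y\<in>E. x \<noteq> y \<longrightarrow> (\<exists>k<n. dist ((T ^^ k) x) ((T ^^ k) y) > \<epsilon>))"

definition h_top :: "(real \<Rightarrow> real) \<Rightarrow> ereal" where
  "h_top T =
     (SUP \<epsilon>\<in>{0<..}. limsup (\<lambda>n. SUP E\<in>{E. separated_set T n \<epsilon> E}.
        ereal (ln (real (card E)) / real n)))"

definition cpmm :: "(real \<Rightarrow> real) set" where
  "cpmm = {T. continuous_on {0..1} T \<and> T ` {0..1} \<subseteq> {0..1} \<and>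
     topologically_mixing T \<and> (\<exists>P. markov_partition T P \<and> infinite P) \<and> h_top T < \<infinity>}"

definition constant_slope :: "(real \<Rightarrow> real) \<Rightarrow> real \<Rightarrow> bool" where
  "constant_slope g s \<longleftrightarrow>
     (\<exists>C. countable C \<and>
        (\<forall>x\<in>{0..1} - C. \<exists>D. (g has_real_derivative D) (at x within {0..1}) \<and> \<bar>D\<bar> = s))"

definition topologically_conjugate :: "(real \<Rightarrow> real) \<Rightarrow> (real \<Rightarrow> real) \<Rightarrow> bool" where
  "topologically_conjugate T g \<longleftrightarrow>
     (\<exists>\<phi> \<psi>. homeomorphism {0..1} {0..1} \<phi> \<psi> \<and> (\<forall>x\<in>{0..1}. \<phi> (T x) = g (\<phi> x)))"

definition linearizable :: "(real \<Rightarrow> real) \<Rightarrow> bool" where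
  "linearizable T \<longleftrightarrow>
     (\<exists>g. continuous_on {0..1} g \<and> g ` {0..1} \<subseteq> {0..1} \<and>
        constant_slope g (exp (real_of_ereal (h_top T))) \<and> topologically_conjugate T g)"

text \<open>A matrix over the index set \<open>A\<close> is a function of two arguments, relevant only on
  \<open>A\<close>. Values in the extended nonnegative reals make all the infinite sums meaningful.\<close>

primrec mat_pow :: "'a set \<Rightarrow> ('a \<Rightarrow> 'a \<Rightarrow> ennreal) \<Rightarrow> nat \<Rightarrow> 'a \<Rightarrow> 'a \<Rightarrow> ennreal" where
  "mat_pow A M 0 i j = (if i = j then 1 else 0)"
| "mat_pow A M (Suc n) i j = (\<Sum>\<^sub>\<infinity>\<alpha>\<in>A. M i \<alpha> * mat_pow A M n \<alpha> j)"

fun first_entrance :: "'a set \<Rightarrow> ('a \<Rightarrow> 'a \<Rightarrow> ennreal) \<Rightarrow> nat \<Rightarrow> 'a \<Rightarrow> 'a \<Rightarrow> ennreal" where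
  "first_entrance A M 0 i j = 0"
| "first_entrance A M (Suc 0) i j = M i j"
| "first_entrance A M (Suc (Suc n)) i j =
     (\<Sum>\<^sub>\<infinity>\<alpha>\<in>A - {j}. M i \<alpha> * first_entrance A M (Suc n) \<alpha> j)"

definition first_entrance_series ::
    "'a set \<Rightarrow> ('a \<Rightarrow> 'a \<Rightarrow> ennreal) \<Rightarrow> 'a \<Rightarrow> 'a \<Rightarrow> ennreal \<Rightarrow> ennreal" where
  "first_entrance_series A M i j z = (\<Sum>\<^sub>\<infinity>n\<in>{1..}. first_entrance A M n i j * z ^ n)"

text \<open>For an irreducible matrix whose powers have finite entries, which is the case for transition
  matrices of maps in \<open>cpmm\<close>, this radius does not depend on the pair of indices.\<close>

definition power_radius :: "'a set \<Rightarrow> ('a \<Rightarrow> 'a \<Rightarrow> ennreal) \<Rightarrow> 'a \<Rightarrow> 'a \<Rightarrow> ereal" where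
  "power_radius A M i j = conv_radius (\<lambda>n. enn2real (mat_pow A M n i j))"

text \<open>For an irreducible matrix the condition does not depend on the index.\<close>

definition recurrent_matrix :: "'a set \<Rightarrow> ('a \<Rightarrow> 'a \<Rightarrow> ennreal) \<Rightarrow> bool" where
  "recurrent_matrix A M \<longleftrightarrow>
     (\<exists>i\<in>A. first_entrance_series A M i i (e2ennreal (power_radius A M i i)) = 1)"

text \<open>The maximum is over a finite set because a Markov partition has piecewise monotone branches.
  Covering a nondegenerate interval forces the intervals of a family to be nondegenerate, so a
  family with disjoint interiors can be taken as a set.\<close>

definition transition_number :: "(real \<Rightarrow> real) \<Rightarrow> real set \<Rightarrow> real set \<Rightarrow> nat" where
  "transition_number T i j =
     (if j \<subseteq> T ` i
      then Max {card \<J> | \<J>. finite \<J> \<and>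
             (\<forall>J\<in>\<J>. is_interval J \<and> J \<subseteq> i \<and> monotone_map_on J T \<and> j \<subseteq> T ` J) \<and>
             (\<forall>J\<in>\<J>. \<forall>K\<in>\<J>. J \<noteq> K \<longrightarrow> interior J \<inter> interior K = {})}
      else 0)"

definition transition_matrix :: "(real \<Rightarrow> real) \<Rightarrow> real set \<Rightarrow> real set \<Rightarrow> ennreal" where
  "transition_matrix T i j = of_nat (transition_number T i j)"

text \<open>Recurrence does not depend on the Markov partition for maps in \<open>cpmm\<close>.\<close>

definition recurrent_map :: "(real \<Rightarrow> real) \<Rightarrow> bool" where
  "recurrent_map T \<longleftrightarrow> (\<exists>P. markov_partition T P \<and> recurrent_matrix P (transition_matrix T))"

text \<open>A partition of an interval into closed nondegenerate subintervals overlapping only in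
  endpoints; it is nontrivial as the order \<open>k\<close> is positive.\<close>

definition window_perturbation ::
    "(real \<Rightarrow> real) \<Rightarrow> real set set \<Rightarrow> real set set \<Rightarrow> (real \<Rightarrow> real) \<Rightarrow> bool" where
  "window_perturbation S P P' T \<longleftrightarrow>
     S \<in> cpmm \<and> markov_partition S P \<and> P' \<subseteq> P \<and> (\<forall>j\<in>P'. monotone_map_on j S) \<and>
     T \<in> cpmm \<and>
     (\<forall>x\<in>{0..1} - (\<Union>j\<in>P'. interior j). T x = S x) \<and>
     (\<forall>j\<in>P'. \<exists>k\<ge>1. \<exists>D. D division_of j \<and> card D = 2 * k + 1 \<and>
        (\<forall>J\<in>D. interior J \<noteq> {} \<and> T ` J = S ` j \<and> monotone_map_on J T))"

definition centralized :: "real set set \<Rightarrow> real set set \<Rightarrow> bool" where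
  "centralized P P' \<longleftrightarrow>
     P' = {} \<or>
     (\<exists>a b. a \<in> {0<..<1} - (\<Union>i\<in>P. interior i) \<and> b \<in> {0<..<1} - (\<Union>i\<in>P. interior i) \<and>
        \<Union>P' \<subseteq> {a..b})"

end

theory Submission
  imports Defs
begin

text \<open>For a point \<open>y\<close> in the interior of an element \<open>j\<close> of a Markov partition, all preimages of
  \<open>y\<close> lie in interiors of elements, and the entry \<open>(i, j)\<close> of the \<open>n\<close>-th power of the
  transition matrix is the number of points of \<open>i\<close> that \<open>T ^^ n\<close> sends to \<open>y\<close>. Up to a shift of
  \<open>n\<close> these counts do not depend on the partition, so the recurrence of \<open>T\<close> can be read off
  the matrix \<open>M\<close> of \<open>T\<close> on \<open>P\<close>, for which \<open>u i = F i j (R)\<close> then solves \<open>R * M u = u\<close>. It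
  remains to show that \<open>u\<close> is summable: pulling back atoms of mass \<open>u i\<close> gives measures whose
  distribution functions conjugate \<open>T\<close> to a map of constant slope \<open>1 / R\<close>, and the entropy is
  \<open>ln (1 / R)\<close> by horseshoes from below and by the Lipschitz property from above.

  Lengths of elements after linearizing \<open>S\<close> give a summable \<open>v\<close> with
  \<open>M v \<le> exp (h_top S) * v\<close> off \<open>P'\<close>, and \<open>exp (h_top S) \<le> 1 / R\<close> since separated orbits are
  counted by preimages of generic points. Entrance series are minimal solutions and \<open>P'\<close> is
  entered through finitely many elements, hence \<open>u \<le> C * v\<close> off \<open>P'\<close>. On \<open>P'\<close> the sum of
  \<open>u\<close> is finite because some iterate of a single element covers \<open>\<Union>P'\<close>.\<close>

section \<open>Branches of boundary-preserving maps\<close>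

text \<open>The Markov condition of a slack partition speaks of maximal monotone intervals, which
  are awkward to iterate, and a perturbation is not given with \<open>P\<close> as a Markov
  partition. Both difficulties vanish with a weaker pair of properties: boundary points go to
  boundary points, and the map is injective near each point whose image is not a boundary point.
  These pass to iterates and to perturbations and still give full branches, so counting fibres
  describes all powers of the matrix. Recurrence of \<open>T\<close> is what makes the entrance
  series an exact eigenvector and not merely a supersolution: the direct step into \<open>j\<close>
  enters with weight \<open>F j j (R) = 1\<close>. The obstacle is summability on \<open>P'\<close>,
  which may be infinite and where the rows of \<open>T\<close> may exceed those of \<open>S\<close>
  by unbounded factors. Mixing covers any compact subset of the open unit interval by one iterate of
  an element, and centralization places \<open>\<Union>P'\<close> in such a subset; then a single
  row of a single power of the eigenvector equation bounds the sum over \<open>P'\<close>.\<close>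

definition boundary_set :: "real set set \<Rightarrow> real set" where
  "boundary_set P = {0..1} - (\<Union>i\<in>P. interior i)"

text \<open>If two values agree, there is an interior extremum between the two points, possibly
  because the function is constant there; near an interior extremum a continuous function is not
  injective.\<close>

lemma locally_injective_imp_inj_on:
  fixes f :: "real \<Rightarrow> real"
  assumes cont: "continuous_on {p..q} f"
    and loc: "\<And>x. p < x \<Longrightarrow> x < q \<Longrightarrow> \<exists>e>0. inj_on f ({p..q} \<inter> ball x e)"
  shows "inj_on f {p..q}"
proof -
  have no_extremum: False
    if m: "s < m" "m < t" "p \<le> s" "t \<le> q"
      and ext: "(\<forall>z\<in>{s..t}. f z \<le> f m) \<or> (\<forall>z\<in>{s..t}. f m \<le> f z)" for s t m
  proof -
    obtain e where e: "e > 0" "inj_on f ({p..q} \<inter> ball m e)"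
      using loc[of m] m by auto
    define d where "d = min (e/2) (min (m - s) (t - m))"
    have d: "d > 0" "d < e" "s \<le> m - d" "m + d \<le> t"
      using e m by (auto simp: d_def min_def)
    have "{m-d..m+d} \<subseteq> {p..q} \<inter> ball m e"
      using d m by (auto simp: dist_real_def)
    then have "inj_on f {m-d..m+d}" "continuous_on {m-d..m+d} f"
      using d m by (auto intro!: inj_on_subset[OF e(2)] continuous_on_subset[OF cont])
    then have "(f (m-d) < f m \<and> f m < f (m+d)) \<or> (f (m+d) < f m \<and> f m < f (m-d))"
      using d(1) by (intro continuous_inj_imp_mono) auto
    moreover have "m - d \<in> {s..t}" "m + d \<in> {s..t}" using d m by auto
    ultimately show False using ext by (meson linorder_not_le)
  qed
  have key: False if st: "p \<le> s" "s < t" "t \<le> q" "f s = f t" for s t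
  proof -
    have c: "continuous_on {s..t} f" by (rule continuous_on_subset[OF cont]) (use st in auto)
    obtain m where m: "m \<in> {s..t}" "\<forall>z\<in>{s..t}. f z \<le> f m"
      using continuous_attains_sup[OF _ _ c] st by auto
    obtain l where l: "l \<in> {s..t}" "\<forall>z\<in>{s..t}. f l \<le> f z"
      using continuous_attains_inf[OF _ _ c] st by auto
    show False
    proof (cases "m = s \<or> m = t")
      case False
      then show ?thesis using no_extremum[of s m t] m st by auto
    next
      case True
      show ?thesis
      proof (cases "l = s \<or> l = t")
        case False
        then show ?thesis using no_extremum[of s l t] l st by auto
      next
        case l': True
        have eq: "f z = f s" if "z \<in> {s..t}" for z
          using m(2) l(2) that True l' st(4) by (metis order_antisym)
        have "f z \<le> f ((s+t)/2)" if "z \<in> {s..t}" for z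
          using eq[OF that] eq[of "(s+t)/2"] st by auto
        then show ?thesis using no_extremum[of s "(s+t)/2" t] st by auto
      qed
    qed
  qed
  show ?thesis
  proof (rule inj_onI)
    fix x y assume "x \<in> {p..q}" "y \<in> {p..q}" "f x = f y"
    then show "x = y" using key[of x y] key[of y x] by (cases x y rule: linorder_cases) auto
  qed
qed

text \<open>\<open>continuous_inj_imp_mono\<close> compares only three points at a time; comparing
  each pair with the ends \<open>p\<close> and \<open>q\<close> fixes one direction for the whole
  interval.\<close>

lemma inj_continuous_interval_mono:
  fixes f :: "real \<Rightarrow> real"
  assumes cont: "continuous_on {p..q} f" and inj: "inj_on f {p..q}"
  shows "strict_mono_on {p..q} f \<or> strict_antimono_on {p..q} f"
proof (cases "p < q")
  case False
  then have "strict_mono_on {p..q} f"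
    by (auto simp: strict_mono_on_def)
  then show ?thesis ..
next
  case True
  have betw: "(f x < f y \<and> f y < f z) \<or> (f z < f y \<and> f y < f x)"
    if "p \<le> x" "x < y" "y < z" "z \<le> q" for x y z
  proof (rule continuous_inj_imp_mono[of x y z f])
    show "continuous_on {x..z} f" by (rule continuous_on_subset[OF cont]) (use that in auto)
    show "inj_on f {x..z}" by (rule inj_on_subset[OF inj]) (use that in auto)
  qed (use that in auto)
  have ne: "f p \<noteq> f q" using inj True by (auto dest: inj_onD)
  show ?thesis
  proof (cases "f p < f q")
    case True
    have "f x < f y" if xy: "p \<le> x" "x < y" "y \<le> q" for x y
    proof (cases "x = p"; cases "y = q")
      show "f x < f y" if "x = p" "y = q" using that True by simp
      show "f x < f y" if "x = p" "y \<noteq> q" using betw[of x y q] that xy True by auto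
      show "f x < f y" if "x \<noteq> p" "y = q" using betw[of p x y] that xy True by auto
      show "f x < f y" if "x \<noteq> p" "y \<noteq> q" using betw[of p x y] betw[of p y q] that xy True by auto
    qed
    then show ?thesis by (auto simp: strict_mono_on_def)
  next
    case False
    have "f x > f y" if xy: "p \<le> x" "x < y" "y \<le> q" for x y
    proof (cases "x = p"; cases "y = q")
      show "f x > f y" if "x = p" "y = q" using that False ne by simp
      show "f x > f y" if "x = p" "y \<noteq> q" using betw[of x y q] that xy False by auto
      show "f x > f y" if "x \<noteq> p" "y = q" using betw[of p x y] that xy False by auto
      show "f x > f y" if "x \<noteq> p" "y \<noteq> q" using betw[of p x y] betw[of p y q] that xy False by auto
    qed
    then show ?thesis by (auto simp: monotone_on_def)
  qed
qed

text \<open>The half-open images matter as well: a decreasing map moves the missing endpoint to the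
  other side, which the distribution functions of atomic measures have to track.\<close>

lemma inj_continuous_image_interval:
  fixes f :: "real \<Rightarrow> real"
  assumes cont: "continuous_on {p..q} f" and inj: "inj_on f {p..q}" and "p < q"
  shows "(f p < f q \<and> f ` {p..q} = {f p..f q} \<and> f ` {p<..q} = {f p<..f q} \<and> f ` {p..<q} = {f p..<f q}) \<or>
         (f q < f p \<and> f ` {p..q} = {f q..f p} \<and> f ` {p<..q} = {f q..<f p} \<and> f ` {p..<q} = {f q<..f p})"
proof -
  have d1: "{p<..q} = {p..q} - {p}" "{p..<q} = {p..q} - {q}" using \<open>p < q\<close> by auto
  have im: "f ` {p<..q} = f ` {p..q} - {f p}" "f ` {p..<q} = f ` {p..q} - {f q}"
    unfolding d1 using \<open>p<q\<close> by (subst inj_on_image_set_diff[OF inj]; auto)+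
  consider "strict_mono_on {p..q} f" | "strict_antimono_on {p..q} f"
    using inj_continuous_interval_mono[OF cont inj] by blast
  then show ?thesis
  proof cases
    case 1
    have lt: "f p < f q" using 1 \<open>p<q\<close> by (auto simp: strict_mono_on_def)
    have "f ` {p..q} \<subseteq> {f p..f q}"
      using 1 by (force simp: strict_mono_on_def order_le_less)
    moreover have "{f p..f q} \<subseteq> f ` {p..q}"
    proof
      fix y assume "y \<in> {f p..f q}"
      then obtain x where "p \<le> x" "x \<le> q" "f x = y"
        using IVT'[of f p y q] cont \<open>p<q\<close> by auto
      then show "y \<in> f ` {p..q}" by auto
    qed
    ultimately have e: "f ` {p..q} = {f p..f q}" by auto
    show ?thesis using im lt unfolding e by auto
  next
    case 2
    have lt: "f q < f p" using 2 \<open>p<q\<close> by (auto simp: monotone_on_def)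
    have "f ` {p..q} \<subseteq> {f q..f p}"
      using 2 by (force simp: monotone_on_def order_le_less)
    moreover have "{f q..f p} \<subseteq> f ` {p..q}"
    proof
      fix y assume "y \<in> {f q..f p}"
      then obtain x where "p \<le> x" "x \<le> q" "f x = y"
        using IVT2'[of f q y p] cont \<open>p<q\<close> by auto
      then show "y \<in> f ` {p..q}" by auto
    qed
    ultimately have e: "f ` {p..q} = {f q..f p}" by auto
    show ?thesis using im lt unfolding e by auto
  qed
qed

text \<open>The extremal point of a compact set, namely of the parameters whose value lies outside
  \<open>V\<close>.\<close>

lemma last_exit:
  fixes f :: "real \<Rightarrow> real"
  assumes "continuous_on {a..x} f" "open V" "f a \<notin> V" "f x \<in> V" "a \<le> x"
  obtains p where "a \<le> p" "p < x" "f p \<notin> V" "\<And>t. p < t \<Longrightarrow> t \<le> x \<Longrightarrow> f t \<in> V"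
proof -
  let ?S = "{a..x} \<inter> f -` (- V)"
  have "closed ?S" using assms by (intro continuous_closed_preimage) auto
  then have "compact ?S" by (simp add: compact_eq_bounded_closed bounded_Int)
  moreover have "?S \<noteq> {}" using assms by auto
  ultimately obtain p where p: "p \<in> ?S" "\<forall>t\<in>?S. t \<le> p" using compact_attains_sup by blast
  show ?thesis
  proof (rule that)
    show "a \<le> p" "f p \<notin> V" "p < x" using p assms by (auto simp: order_le_less)
    show "f t \<in> V" if "p < t" "t \<le> x" for t
      using p that by (force simp: not_le[symmetric])
  qed
qed

lemma first_exit:
  fixes f :: "real \<Rightarrow> real"
  assumes "continuous_on {x..b} f" "open V" "f b \<notin> V" "f x \<in> V" "x \<le> b"
  obtains q where "x < q" "q \<le> b" "f q \<notin> V" "\<And>t. x \<le> t \<Longrightarrow> t < q \<Longrightarrow> f t \<in> V"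
proof -
  let ?S = "{x..b} \<inter> f -` (- V)"
  have "closed ?S" using assms by (intro continuous_closed_preimage) auto
  then have "compact ?S" by (simp add: compact_eq_bounded_closed bounded_Int)
  moreover have "?S \<noteq> {}" using assms by auto
  ultimately obtain q where q: "q \<in> ?S" "\<forall>t\<in>?S. q \<le> t" using compact_attains_inf by blast
  show ?thesis
  proof (rule that)
    show "q \<le> b" "f q \<notin> V" "x < q" using q assms by (auto simp: order_le_less)
    show "f t \<in> V" if "x \<le> t" "t < q" for t
      using q that by (force simp: not_le[symmetric])
  qed
qed

text \<open>The part of \<open>markov_partition\<close> that does not mention a map, so that it
  serves a map, its iterates and its perturbations alike.\<close>

locale interval_family =
  fixes P :: "real set set"
  assumes countable_family: "countable P"
    and elements: "\<And>i. i \<in> P \<Longrightarrow> \<exists>a b. 0 \<le> a \<and> a < b \<and> b \<le> 1 \<and> i = {a..b}"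
    and disjoint_interiors: "\<And>i j. i \<in> P \<Longrightarrow> j \<in> P \<Longrightarrow> i \<noteq> j \<Longrightarrow> interior i \<inter> interior j = {}"
    and countable_rest: "countable ({0..1} - \<Union>P)"
begin

abbreviation "B \<equiv> boundary_set P"

lemma elementE:
  assumes "i \<in> P"
  obtains a b where "0 \<le> a" "a < b" "b \<le> 1" "i = {a..b}" "interior i = {a<..<b}"
  using elements[OF assms] by auto

lemma interior_not_boundary: "i \<in> P \<Longrightarrow> y \<in> interior i \<Longrightarrow> y \<notin> B"
  by (auto simp: boundary_set_def)

lemma interior_unit: "i \<in> P \<Longrightarrow> y \<in> interior i \<Longrightarrow> 0 < y \<and> y < 1"
  by (erule elementE) auto

lemma element_subset: "i \<in> P \<Longrightarrow> i \<subseteq> {0..1}"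
  by (erule elementE) auto

lemma interior_disjoint_unique: "i \<in> P \<Longrightarrow> j \<in> P \<Longrightarrow> y \<in> interior i \<Longrightarrow> y \<in> interior j \<Longrightarrow> i = j"
  using disjoint_interiors by blast

lemma not_boundaryE:
  assumes "y \<in> {0..1}" "y \<notin> B"
  obtains i where "i \<in> P" "y \<in> interior i"
  using assms by (auto simp: boundary_set_def)

lemma interior_disjoint_element:
  assumes "i \<in> P" "j \<in> P" "i \<noteq> j"
  shows "i \<inter> interior j = {}"
proof -
  obtain a b where i: "i = {a..b}" "interior i = {a<..<b}" "a < b" using elementE[OF assms(1)] by metis
  have "closure (interior i) = i" using i by simp
  moreover have "closure (interior i) \<inter> interior j = {}"
    using disjoint_interiors[OF assms] by (simp add: open_Int_closure_eq_empty Int_commute)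
  ultimately show ?thesis by simp
qed

lemma endpoints_boundary:
  assumes "{a..b} \<in> P"
  shows "a \<in> B" "b \<in> B"
proof -
  obtain a' b' where "0 \<le> a'" "a' < b'" "b' \<le> 1" "{a..b} = {a'..b'}"
    using elementE[OF assms] by metis
  then have ab: "0 \<le> a" "a < b" "b \<le> 1" by auto
  have "x \<notin> interior j" if "x = a \<or> x = b" "j \<in> P" for x j
  proof (cases "j = {a..b}")
    case True then show ?thesis using that by auto
  next
    case False
    have "x \<in> {a..b}" using that ab by auto
    then show ?thesis using interior_disjoint_element[OF assms that(2)] False by blast
  qed
  then show "a \<in> B" "b \<in> B" using ab by (auto simp: boundary_set_def)
qed

lemma zero_one_boundary: "0 \<in> B" "1 \<in> B"
  using interior_unit by (auto simp: boundary_set_def dest: interior_unit)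

lemma boundary_unit: "B \<subseteq> {0..1}"
  by (auto simp: boundary_set_def)

lemma countable_boundary: "countable B"
proof -
  have "B \<subseteq> ({0..1} - \<Union>P) \<union> (\<Union>i\<in>P. {Inf i, Sup i})"
  proof
    fix x assume x: "x \<in> B"
    show "x \<in> ({0..1} - \<Union>P) \<union> (\<Union>i\<in>P. {Inf i, Sup i})"
    proof (cases "x \<in> \<Union>P")
      case True
      then obtain i where i: "i \<in> P" "x \<in> i" by auto
      then obtain a b where "i = {a..b}" "a < b" "interior i = {a<..<b}" by (metis elementE)
      moreover from this have "x \<notin> {a<..<b}" using x i interior_not_boundary[OF i(1)] by metis
      ultimately have "x = Inf i \<or> x = Sup i" using i by auto
      then show ?thesis by (intro UnI2 UN_I[OF i(1)]) auto
    next
      case False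
      then show ?thesis using x boundary_unit by blast
    qed
  qed
  then show ?thesis
    by (rule countable_subset) (use countable_rest countable_family in auto)
qed

text \<open>Generic points are dense because an open interval is uncountable while the boundary set
  is countable.\<close>

lemma interval_meets_interior:
  assumes "0 \<le> s" "s < t" "t \<le> 1"
  obtains i y where "i \<in> P" "y \<in> interior i" "s < y" "y < t"
proof -
  have "\<not> {s<..<t} \<subseteq> B"
    using countable_subset[OF _ countable_boundary] uncountable_open_interval[of s t] assms by auto
  then obtain y where "y \<in> {s<..<t}" "y \<notin> B" by blast
  moreover from this obtain i where "i \<in> P" "y \<in> interior i"
    using assms not_boundaryE[of y] by auto
  ultimately show ?thesis using that[of i y] by auto
qed

lemma nonempty_family: "P \<noteq> {}"
  using interval_meets_interior[of 0 1] by auto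

end

text \<open>All that is kept of the Markov property. The covering condition is recovered in
  \<open>branch\<close>, and the axioms are inherited by iterates.\<close>

locale boundary_map = interval_family P for P +
  fixes f :: "real \<Rightarrow> real"
  assumes cont: "continuous_on {0..1} f"
    and maps: "f ` {0..1} \<subseteq> {0..1}"
    and boundary_invariant: "\<And>x. x \<in> B \<Longrightarrow> f x \<in> B"
    and locally_injective: "\<And>x. x \<in> {0..1} \<Longrightarrow> f x \<notin> B \<Longrightarrow> \<exists>e>0. inj_on f ({0..1} \<inter> ball x e)"
begin

text \<open>The branch is the maximal interval around \<open>x\<close> that stays over the interior
  of \<open>j\<close>. The ends of \<open>i\<close> are boundary points, so the exits happen inside
  \<open>i\<close>. Local injectivity makes the branch injective, and the two exit values, being in
  \<open>j\<close> but not in its interior, must be its two distinct ends.\<close>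

lemma branch:
  assumes i: "i \<in> P" and j: "j \<in> P" and x: "x \<in> i" "f x \<in> interior j"
  obtains p q where "p < x" "x < q" "{p..q} \<subseteq> i" "inj_on f {p..q}" "f ` {p..q} = j"
    "f p \<notin> interior j" "f q \<notin> interior j" "f ` {p<..<q} \<subseteq> interior j" "interior j \<subseteq> f ` {p<..<q}"
proof -
  obtain a b where ab: "0 \<le> a" "a < b" "b \<le> 1" "i = {a..b}" using elementE[OF i] by metis
  obtain c d where cd: "0 \<le> c" "c < d" "d \<le> 1" "j = {c..d}" "interior j = {c<..<d}"
    using elementE[OF j] by metis
  have ci: "continuous_on {a..b} f" by (rule continuous_on_subset[OF cont]) (use ab in auto)
  have ends: "f a \<notin> {c<..<d}" "f b \<notin> {c<..<d}"
    using endpoints_boundary[of a b] i ab boundary_invariant interior_not_boundary[OF j] cd by metis+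
  have fx: "c < f x" "f x < d" using x cd by auto
  have xab: "a < x" "x < b" using x ends fx ab by (auto simp: order_le_less)
  obtain p where p: "a \<le> p" "p < x" "f p \<notin> {c<..<d}" "\<And>t. p < t \<Longrightarrow> t \<le> x \<Longrightarrow> f t \<in> {c<..<d}"
  proof (rule last_exit[of a x f "{c<..<d}"])
    show "continuous_on {a..x} f" by (rule continuous_on_subset[OF ci]) (use xab in auto)
  qed (use xab ends fx in auto)
  obtain q where q: "x < q" "q \<le> b" "f q \<notin> {c<..<d}" "\<And>t. x \<le> t \<Longrightarrow> t < q \<Longrightarrow> f t \<in> {c<..<d}"
  proof (rule first_exit[of x b f "{c<..<d}"])
    show "continuous_on {x..b} f" by (rule continuous_on_subset[OF ci]) (use xab in auto)
  qed (use xab ends fx in auto)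
  have sub: "{p..q} \<subseteq> {a..b}" "{p..q} \<subseteq> {0..1}" using p q ab by auto
  have inside: "f t \<in> {c<..<d}" if "p < t" "t < q" for t
    using p(4)[of t] q(4)[of t] that by linarith
  have cpq: "continuous_on {p..q} f" by (rule continuous_on_subset[OF ci sub(1)])
  have inj: "inj_on f {p..q}"
  proof (rule locally_injective_imp_inj_on[OF cpq])
    fix t assume t: "p < t" "t < q"
    then have "f t \<notin> B" using inside interior_not_boundary[OF j] cd by auto
    then obtain e where e: "e > 0" "inj_on f ({0..1} \<inter> ball t e)"
      using locally_injective[of t] t sub by (auto simp: subset_iff)
    have "inj_on f ({p..q} \<inter> ball t e)"
      by (rule inj_on_subset[OF e(2)]) (use sub in blast)
    then show "\<exists>e>0. inj_on f ({p..q} \<inter> ball t e)" using e by blast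
  qed
  have pq: "p < q" using p q by linarith
  have fcl: "f t \<in> {c..d}" if "t \<in> {p..q}" for t
  proof -
    have "f ` closure {p<..<q} \<subseteq> closure (f ` {p<..<q})"
      using cpq pq by (intro continuous_image_closure_subset[of "{p..q}"]) auto
    also have "\<dots> \<subseteq> {c..d}"
      using inside by (intro closure_minimal) (auto simp: order_less_imp_le)
    finally show ?thesis using that pq by (auto simp: image_subset_iff)
  qed
  have im: "(f p < f q \<and> f ` {p..q} = {f p..f q}) \<or> (f q < f p \<and> f ` {p..q} = {f q..f p})"
    using inj_continuous_image_interval[OF cpq inj pq] by blast
  have fpq: "f p \<in> {c,d}" "f q \<in> {c,d}" using fcl[of p] fcl[of q] p(3) q(3) pq by auto
  have im': "f ` {p..q} = {c..d}" using im fpq cd by auto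
  have "{c<..<d} \<subseteq> f ` {p<..<q}"
  proof
    fix y assume y: "y \<in> {c<..<d}"
    then obtain t where t: "t \<in> {p..q}" "f t = y" using im' by (metis atLeastAtMost_iff greaterThanLessThan_iff imageE order_less_imp_le)
    then have "t \<noteq> p" "t \<noteq> q" using y p(3) q(3) by auto
    then show "y \<in> f ` {p<..<q}" using t by force
  qed
  moreover have "f ` {p<..<q} \<subseteq> {c<..<d}" using inside by force
  ultimately show thesis
    using that[of p q] p q sub inj im' ab cd by auto
qed

lemma fiber_interior:
  assumes "i \<in> P" "j \<in> P" "x \<in> i" "f x \<in> interior j"
  shows "x \<in> interior i"
proof -
  obtain p q where "p < x" "x < q" "{p..q} \<subseteq> i" using branch[OF assms] by metis
  then have "x \<in> interior {p..q}" "interior {p..q} \<subseteq> interior i"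
    by (auto intro: interior_mono[THEN subsetD])
  then show ?thesis by blast
qed

text \<open>Branches are components of the preimage of \<open>V\<close>: the ends of each one map
  outside \<open>V\<close> and so cannot lie inside the other.\<close>

lemma branches_disjoint:
  assumes pq: "inj_on f {p..q}" "f p \<notin> V" "f q \<notin> V" "f ` {p<..<q} \<subseteq> V"
    and pq': "inj_on f {p'..q'}" "f p' \<notin> V" "f q' \<notin> V" "f ` {p'<..<q'} \<subseteq> V"
    and t: "t \<in> {p<..<q}" "t \<in> {p'<..<q'}"
  shows "p = p' \<and> q = q'"
proof -
  have "p' \<notin> {p<..<q}" "q' \<notin> {p<..<q}" "p \<notin> {p'<..<q'}" "q \<notin> {p'<..<q'}"
    using pq pq' by blast+
  then show ?thesis using t by auto
qed

text \<open>An accumulation point of an infinite fibre belongs to the fibre, but the branch around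
  it contains no second preimage.\<close>

lemma finite_fiber:
  assumes i: "i \<in> P" and j: "j \<in> P" and y: "y \<in> interior j"
  shows "finite {x\<in>i. f x = y}"
proof (rule ccontr)
  assume inf: "infinite {x\<in>i. f x = y}"
  have ci: "continuous_on i f" using cont element_subset[OF i] by (rule continuous_on_subset)
  have "compact i" using elementE[OF i] by (metis compact_Icc)
  then obtain l where l: "l \<in> i" "l islimpt {x\<in>i. f x = y}"
    using inf unfolding compact_eq_Bolzano_Weierstrass by (metis (no_types, lifting) mem_Collect_eq subsetI)
  have "closed {x\<in>i. f x = y}"
    using ci \<open>compact i\<close> by (intro continuous_closed_preimage_constant) (auto simp: compact_imp_closed)
  then have "l \<in> {x\<in>i. f x = y}" using l(2) unfolding closed_limpt by blast
  then have fl: "f l = y" by simp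
  then obtain p q where pq: "p < l" "l < q" "{p..q} \<subseteq> i" "inj_on f {p..q}"
    using branch[OF i j l(1)] y by metis
  have "l \<in> {p<..<q}" "open {p<..<q}" using pq by auto
  then obtain x where x: "x \<in> {x\<in>i. f x = y}" "x \<in> {p<..<q}" "x \<noteq> l"
    using l(2) unfolding islimpt_def by blast
  show False using inj_onD[OF pq(4), of x l] x pq fl by auto
qed

text \<open>Each preimage of \<open>y\<close> has a branch on which \<open>y'\<close> has a preimage
  as well. Two branches that yield the same preimage of \<open>y'\<close> overlap and hence
  coincide, so this transport is injective.\<close>

lemma card_fiber_le:
  assumes i: "i \<in> P" and j: "j \<in> P" and y: "y \<in> interior j" "y' \<in> interior j"
  shows "card {x\<in>i. f x = y} \<le> card {x\<in>i. f x = y'}"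
proof -
  define W where "W x p q x' \<longleftrightarrow> p < x \<and> x < q \<and> {p..q} \<subseteq> i \<and> inj_on f {p..q} \<and> f p \<notin> interior j \<and>
      f q \<notin> interior j \<and> f ` {p<..<q} \<subseteq> interior j \<and> x' \<in> {p<..<q} \<and> f x' = y'" for x p q x'
  have "\<exists>p q x'. W x p q x'" if x: "x \<in> {x\<in>i. f x = y}" for x
  proof -
    have "x \<in> i" "f x \<in> interior j" using x y by auto
    from branch[OF i j this] obtain p q where pq: "p < x" "x < q" "{p..q} \<subseteq> i" "inj_on f {p..q}"
      "f p \<notin> interior j" "f q \<notin> interior j" "f ` {p<..<q} \<subseteq> interior j" "interior j \<subseteq> f ` {p<..<q}"
      by metis
    obtain x' where "x' \<in> {p<..<q}" "f x' = y'" using pq(8) y(2) by blast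
    then have "W x p q x'" unfolding W_def using pq(1-7) by simp
    then show ?thesis by blast
  qed
  then obtain p q g where "\<And>x. x \<in> {x\<in>i. f x = y} \<Longrightarrow> W x (p x) (q x) (g x)"
    by metis
  note h = this[unfolded W_def]
  have "inj_on g {x\<in>i. f x = y}"
  proof (rule inj_onI)
    fix x z assume xz: "x \<in> {x\<in>i. f x = y}" "z \<in> {x\<in>i. f x = y}" "g x = g z"
    note hx = h[OF xz(1)] and hz = h[OF xz(2)]
    have "p x = p z \<and> q x = q z"
      by (rule branches_disjoint[of "p x" "q x" "interior j" "p z" "q z" "g x"]) (use hx hz xz(3) in simp_all)
    then have "x \<in> {p x..q x}" "z \<in> {p x..q x}" using conjunct1[OF hx] conjunct1[OF conjunct2[OF hx]]
        conjunct1[OF hz] conjunct1[OF conjunct2[OF hz]] by simp_all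
    moreover have "inj_on f {p x..q x}" "f x = f z" using hx xz by simp_all
    ultimately show "x = z" by (metis inj_onD)
  qed
  moreover have "g ` {x\<in>i. f x = y} \<subseteq> {x\<in>i. f x = y'}"
  proof
    fix t assume "t \<in> g ` {x\<in>i. f x = y}"
    then obtain x where x: "x \<in> {x\<in>i. f x = y}" "t = g x" by auto
    note hx = h[OF x(1)]
    have "g x \<in> {p x..q x}" "{p x..q x} \<subseteq> i" "f (g x) = y'" using hx by simp_all
    then have "g x \<in> i" "f (g x) = y'" by blast+
    then show "t \<in> {x\<in>i. f x = y'}" using x by auto
  qed
  ultimately show ?thesis using finite_fiber[OF i j y(2)] by (intro card_inj_on_le)
qed

end

text \<open>Counting points of a fibre turns composition with iterates into plain counting; the
  chosen point is irrelevant by \<open>fiber_count_eq\<close>. For a Markov partition this is the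
  entry of the transition matrix, see \<open>transition_number_eq_fiber_count\<close>.\<close>

definition fiber_count :: "(real \<Rightarrow> real) \<Rightarrow> real set \<Rightarrow> real set \<Rightarrow> nat" where
  "fiber_count f i j = card {x\<in>i. f x = (SOME y. y \<in> interior j)}"

context boundary_map
begin

lemma fiber_count_eq:
  assumes i: "i \<in> P" and j: "j \<in> P" and y: "y \<in> interior j"
  shows "card {x\<in>i. f x = y} = fiber_count f i j"
proof -
  have z: "(SOME y. y \<in> interior j) \<in> interior j" using y by (rule someI)
  show ?thesis unfolding fiber_count_def by (intro order_antisym card_fiber_le[OF i j] y z)
qed

lemma fiber_count_pos_iff:
  assumes i: "i \<in> P" and j: "j \<in> P"
  shows "fiber_count f i j > 0 \<longleftrightarrow> (\<exists>x\<in>i. f x \<in> interior j)"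
proof
  obtain y where y: "y \<in> interior j" using elementE[OF j] by (metis dense greaterThanLessThan_iff)
  assume "fiber_count f i j > 0"
  then have "{x\<in>i. f x = y} \<noteq> {}" using fiber_count_eq[OF i j y] by force
  then show "\<exists>x\<in>i. f x \<in> interior j" using y by auto
next
  assume "\<exists>x\<in>i. f x \<in> interior j"
  then obtain x where x: "x \<in> i" "f x \<in> interior j" by auto
  then have "card {z\<in>i. f z = f x} > 0" using finite_fiber[OF i j x(2)] by (auto simp: card_gt_0_iff)
  then show "fiber_count f i j > 0" using fiber_count_eq[OF i j x(2)] by simp
qed

lemma fiber_count_pos_covers:
  assumes i: "i \<in> P" and j: "j \<in> P" and "fiber_count f i j > 0"
  shows "j \<subseteq> f ` i"
proof -
  obtain x where "x \<in> i" "f x \<in> interior j" using assms fiber_count_pos_iff[OF i j] by blast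
  then obtain p q where "{p..q} \<subseteq> i" "f ` {p..q} = j" by (rule branch[OF i j])
  then show ?thesis by blast
qed

end

section \<open>Mixing maps\<close>

lemma unit_openin_intervals:
  "openin (top_of_set {0..1::real}) ({0..1} \<inter> {a<..<b})"
  "openin (top_of_set {0..1::real}) ({0..1} \<inter> {..<a})"
  "openin (top_of_set {0..1::real}) ({0..1} \<inter> {a<..})"
  by (intro openin_open_Int open_greaterThanLessThan open_lessThan open_greaterThan)+

text \<open>Large iterates of \<open>{s..t}\<close> are intervals meeting both \<open>{..<a}\<close>
  and \<open>{b<..}\<close>, hence contain everything in between. The ends 0 and 1 themselves need
  not be reached.\<close>

lemma mixing_image_covers:
  assumes cont: "\<And>n. continuous_on {0..1} (T ^^ n)" and mix: "topologically_mixing T"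
    and st: "0 \<le> s" "s < t" "t \<le> 1" and ab: "0 < a" "b < 1"
  shows "\<exists>N. \<forall>n\<ge>N. {a..b} \<subseteq> (T ^^ n) ` {s..t}"
proof -
  have m: "\<exists>n. \<forall>m\<ge>n. (T ^^ m) ` ({0..1} \<inter> {s<..<t}) \<inter> V \<noteq> {}"
    if "openin (top_of_set {0..1}) V" "V \<noteq> {}" for V
  proof -
    have "(s+t)/2 \<in> {0..1} \<inter> {s<..<t}" using st by auto
    then have "{0..1} \<inter> {s<..<t} \<noteq> {}" by blast
    then show ?thesis using mix that unit_openin_intervals(1)[of s t]
      unfolding topologically_mixing_def by blast
  qed
  have "0 \<in> {0..1} \<inter> {..<a}" "1 \<in> {0..1} \<inter> {b<..}" using ab by auto
  then have "{0..1} \<inter> {..<a} \<noteq> {}" "{0..1} \<inter> {b<..} \<noteq> {}" by blast+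
  then obtain N1 N2 where N1: "\<forall>m\<ge>N1. (T ^^ m) ` ({0..1} \<inter> {s<..<t}) \<inter> ({0..1} \<inter> {..<a}) \<noteq> {}"
    and N2: "\<forall>m\<ge>N2. (T ^^ m) ` ({0..1} \<inter> {s<..<t}) \<inter> ({0..1} \<inter> {b<..}) \<noteq> {}"
    using m unit_openin_intervals by metis
  have "{a..b} \<subseteq> (T ^^ n) ` {s..t}" if "n \<ge> max N1 N2" for n
  proof -
    have n: "n \<ge> N1" "n \<ge> N2" using that by auto
    have sub: "{0..1} \<inter> {s<..<t} \<subseteq> {s..t}" by auto
    obtain u where u: "u \<in> {s..t}" "(T ^^ n) u < a" using N1[rule_format, OF n(1)] sub by blast
    obtain v where v: "v \<in> {s..t}" "b < (T ^^ n) v" using N2[rule_format, OF n(2)] sub by blast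
    have "connected ((T ^^ n) ` {s..t})"
      by (intro connected_continuous_image continuous_on_subset[OF cont]) (use st in auto)
    then have iv: "is_interval ((T ^^ n) ` {s..t})" by (simp add: is_interval_connected_1)
    show ?thesis
    proof
      fix y assume y: "y \<in> {a..b}"
      have "(T ^^ n) u \<in> (T ^^ n) ` {s..t}" "(T ^^ n) v \<in> (T ^^ n) ` {s..t}" using u v by auto
      moreover have "(T ^^ n) u \<le> y" "y \<le> (T ^^ n) v" using u v y by auto
      ultimately show "y \<in> (T ^^ n) ` {s..t}" using mem_is_interval_1_I[OF iv] by blast
    qed
  qed
  then show ?thesis by blast
qed

lemma (in boundary_map) maps_point: "x \<in> {0..1} \<Longrightarrow> f x \<in> {0..1}"
  using maps by blast

text \<open>A point whose last iterate is not a boundary point has met no boundary point before, so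
  local injectivity can be composed along its orbit.\<close>

lemma (in boundary_map) iterate: "boundary_map P (f ^^ n)"
proof (induction n)
  case 0
  show ?case
  proof (unfold_locales)
    show "\<exists>e>0. inj_on (f ^^ 0) ({0..1} \<inter> ball x e)" for x
      by (rule exI[of _ 1]) simp
  qed auto
next
  case (Suc n)
  let ?g = "f ^^ n"
  interpret g: boundary_map P ?g by (rule Suc.IH)
  show ?case
  proof (unfold_locales)
    show "continuous_on {0..1} (f ^^ Suc n)"
      using continuous_on_compose[OF g.cont continuous_on_subset[OF cont g.maps]] by simp
    show "(f ^^ Suc n) ` {0..1} \<subseteq> {0..1}"
      using g.maps_point maps_point by auto
    show "(f ^^ Suc n) x \<in> B" if "x \<in> B" for x
      using g.boundary_invariant[OF that] boundary_invariant by simp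
    show "\<exists>e>0. inj_on (f ^^ Suc n) ({0..1} \<inter> ball x e)" if x: "x \<in> {0..1}" "(f ^^ Suc n) x \<notin> B" for x
    proof -
      have fx: "f (?g x) \<notin> B" "?g x \<notin> B" using x boundary_invariant by auto
      obtain e1 where e1: "e1 > 0" "inj_on ?g ({0..1} \<inter> ball x e1)"
        using g.locally_injective[OF x(1) fx(2)] by blast
      obtain e2 where e2: "e2 > 0" "inj_on f ({0..1} \<inter> ball (?g x) e2)"
        using locally_injective[OF g.maps_point[OF x(1)] fx(1)] by blast
      obtain d where d: "d > 0" "\<And>z. z \<in> {0..1} \<Longrightarrow> dist z x < d \<Longrightarrow> dist (?g z) (?g x) < e2"
        using g.cont x(1) e2(1) unfolding continuous_on_iff by metis
      have sub: "{0..1} \<inter> ball x (min e1 d) \<subseteq> {0..1} \<inter> ball x e1" by auto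
      have "?g ` ({0..1} \<inter> ball x (min e1 d)) \<subseteq> {0..1} \<inter> ball (?g x) e2"
        using d(2) g.maps_point by (fastforce simp: dist_commute)
      then have "inj_on (f \<circ> ?g) ({0..1} \<inter> ball x (min e1 d))"
        by (intro comp_inj_on inj_on_subset[OF e1(2) sub] inj_on_subset[OF e2(2)])
      then show ?thesis using e1(1) d(1) by (intro exI[of _ "min e1 d"]) (simp add: comp_def)
    qed
  qed
qed

text \<open>\<open>piecewise_monotone\<close> gives control near the points mapped into the boundary
  set, about whose neighbourhoods \<open>boundary_map\<close> says nothing.\<close>

locale mixing_system = boundary_map P T for P T +
  assumes mixing: "topologically_mixing T"
    and piecewise_monotone: "\<And>i. i \<in> P \<Longrightarrow> piecewise_monotone_on i T"
begin

lemma iterate_cont: "continuous_on {0..1} (T ^^ n)"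
  using boundary_map.cont[OF iterate] .

lemma iterate_maps: "x \<in> {0..1} \<Longrightarrow> (T ^^ n) x \<in> {0..1}"
  using boundary_map.maps_point[OF iterate] .

lemma image_covers:
  assumes "0 \<le> s" "s < t" "t \<le> 1" "0 < a" "b < 1"
  shows "\<exists>N. \<forall>n\<ge>N. {a..b} \<subseteq> (T ^^ n) ` {s..t}"
  using mixing_image_covers[OF iterate_cont mixing assms] .

lemma preimages_in_subintervals:
  assumes "0 \<le> s" "s < t" "t \<le> 1" "0 < y" "y < 1"
  shows "\<exists>N. \<forall>n\<ge>N. \<exists>x. s < x \<and> x < t \<and> (T ^^ n) x = y"
proof -
  let ?s = "(2 * s+t)/3" and ?t = "(s+2 * t)/3"
  have st: "s < ?s" "?t < t" "?s < ?t" using assms by auto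
  obtain N where N: "\<forall>n\<ge>N. {y..y} \<subseteq> (T ^^ n) ` {?s..?t}"
    using image_covers[of ?s ?t y y] assms st by auto
  have "\<exists>x. s < x \<and> x < t \<and> (T ^^ n) x = y" if n: "n \<ge> N" for n
  proof -
    have "y \<in> (T ^^ n) ` {?s..?t}" using N[rule_format, OF n] by auto
    then obtain x where "x \<in> {?s..?t}" "y = (T ^^ n) x" by blast
    then show ?thesis using st by (intro exI[of _ x]) auto
  qed
  then show ?thesis by blast
qed

text \<open>Three preimages of \<open>y\<close> are placed in three consecutive thirds. The branch
  through the middle one is injective, so it contains neither of the others and is trapped strictly
  between them.\<close>

lemma inner_branch:
  assumes st: "0 \<le> s" "s < t" "t \<le> 1" and k: "k \<in> P"
  shows "\<exists>N. \<forall>n\<ge>N. \<exists>p q. s < p \<and> p < q \<and> q < t \<and> inj_on (T ^^ n) {p..q} \<and> (T ^^ n) ` {p..q} = k"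
proof -
  obtain c d where cd: "0 \<le> c" "c < d" "d \<le> 1" "k = {c..d}" "interior k = {c<..<d}"
    using elementE[OF k] .
  obtain y where y: "c < y" "y < d" using dense[OF cd(2)] by blast
  let ?u = "(2 * s+t)/3" and ?v = "(s+2 * t)/3"
  have uv: "s < ?u" "?u < ?v" "?v < t" "0 \<le> ?u" "?v \<le> 1" using st by auto
  have y01: "0 < y" "y < 1" using y cd by auto
  obtain N1 where N1: "\<forall>n\<ge>N1. \<exists>x. s < x \<and> x < ?u \<and> (T ^^ n) x = y"
    using preimages_in_subintervals[of s ?u y] st uv y01 by auto
  obtain N2 where N2: "\<forall>n\<ge>N2. \<exists>x. ?u < x \<and> x < ?v \<and> (T ^^ n) x = y"
    using preimages_in_subintervals[of ?u ?v y] st uv y01 by auto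
  obtain N3 where N3: "\<forall>n\<ge>N3. \<exists>x. ?v < x \<and> x < t \<and> (T ^^ n) x = y"
    using preimages_in_subintervals[of ?v t y] st uv y01 by auto
  have "\<exists>p q. s < p \<and> p < q \<and> q < t \<and> inj_on (T ^^ n) {p..q} \<and> (T ^^ n) ` {p..q} = k"
    if n: "n \<ge> max N1 (max N2 N3)" for n
  proof -
    interpret g: boundary_map P "T ^^ n" by (rule iterate)
    have nn: "n \<ge> N1" "n \<ge> N2" "n \<ge> N3" using n by auto
    obtain x1 where x1: "s < x1" "x1 < ?u" "(T ^^ n) x1 = y" using N1 nn by blast
    obtain x2 where x2: "?u < x2" "x2 < ?v" "(T ^^ n) x2 = y" using N2 nn by blast
    obtain x3 where x3: "?v < x3" "x3 < t" "(T ^^ n) x3 = y" using N3 nn by blast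
    have yk: "y \<in> interior k" using y cd by auto
    have "x2 \<in> {0..1}" "(T ^^ n) x2 \<notin> B" using x2 uv interior_not_boundary[OF k yk] by auto
    then have "x2 \<notin> B" using g.boundary_invariant by blast
    then obtain i where i: "i \<in> P" "x2 \<in> interior i" using not_boundaryE[OF \<open>x2 \<in> {0..1}\<close> \<open>x2 \<notin> B\<close>] by blast
    then have "x2 \<in> i" "(T ^^ n) x2 \<in> interior k" using interior_subset x2 yk by auto
    from g.branch[OF i(1) k this] obtain p q where pq: "p < x2" "x2 < q" "inj_on (T ^^ n) {p..q}" "(T ^^ n) ` {p..q} = k"
      by metis
    have "x1 \<notin> {p..q}"
    proof
      assume "x1 \<in> {p..q}"
      then have "x1 = x2" using inj_onD[OF pq(3), of x1 x2] pq(1,2) x1(3) x2(3) by simp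
      then show False using x1 x2 by linarith
    qed
    moreover have "x3 \<notin> {p..q}"
    proof
      assume "x3 \<in> {p..q}"
      then have "x3 = x2" using inj_onD[OF pq(3), of x3 x2] pq(1,2) x3(3) x2(3) by simp
      then show False using x3 x2 by linarith
    qed
    ultimately have "x1 < p" "q < x3" using pq x1 x2 x3 by auto
    then have "s < p" "p < q" "q < t" using pq x1 x3 by linarith+
    then show ?thesis using pq by blast
  qed
  then show ?thesis by blast
qed

text \<open>This includes elements that touch 0 or 1, which \<open>image_covers\<close> cannot
  reach, because a whole branch over \<open>k\<close> fits into \<open>{s..t}\<close>.\<close>

lemma covers_element:
  assumes "0 \<le> s" "s < t" "t \<le> 1" "k \<in> P"
  shows "\<exists>N. \<forall>n\<ge>N. k \<subseteq> (T ^^ n) ` {s..t}"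
proof -
  obtain N where N: "\<forall>n\<ge>N. \<exists>p q. s < p \<and> p < q \<and> q < t \<and> inj_on (T ^^ n) {p..q} \<and> (T ^^ n) ` {p..q} = k"
    using inner_branch[OF assms] by blast
  have "k \<subseteq> (T ^^ n) ` {s..t}" if n: "n \<ge> N" for n
  proof -
    obtain p q where pq: "s < p" "p < q" "q < t" "(T ^^ n) ` {p..q} = k" using N n by blast
    have "{p..q} \<subseteq> {s..t}" using pq by auto
    then show ?thesis using pq(4) by blast
  qed
  then show ?thesis by blast
qed

lemma irreducible:
  assumes i: "i \<in> P" and j: "j \<in> P"
  shows "\<exists>N. \<forall>n\<ge>N. fiber_count (T ^^ n) i j > 0"
proof -
  obtain a b where ab: "0 \<le> a" "a < b" "b \<le> 1" "i = {a..b}" using elementE[OF i] by metis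
  obtain N where N: "\<forall>n\<ge>N. j \<subseteq> (T ^^ n) ` {a..b}" using covers_element[OF ab(1-3) j] by blast
  obtain y where y: "y \<in> interior j" using elementE[OF j] by (metis dense greaterThanLessThan_iff)
  have "fiber_count (T ^^ n) i j > 0" if "n \<ge> N" for n
    using boundary_map.fiber_count_pos_iff[OF iterate i j, of n] N that y interior_subset ab(4) by blast
  then show ?thesis by blast
qed

lemma fiber_finite:
  assumes "i \<in> P" "j \<in> P" "y \<in> interior j"
  shows "finite {x\<in>i. (T ^^ n) x = y}"
  using boundary_map.finite_fiber[OF iterate assms] .

lemma fiber_card:
  assumes "i \<in> P" "j \<in> P" "y \<in> interior j"
  shows "card {x\<in>i. (T ^^ n) x = y} = fiber_count (T ^^ n) i j"
  using boundary_map.fiber_count_eq[OF iterate assms] .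

text \<open>The midpoint of \<open>j\<close> is hit from either half of \<open>j\<close>. Two
  returns at one time are enough to force the radius of convergence below 1 later on.\<close>

lemma fiber_count_growth:
  assumes j: "j \<in> P"
  shows "\<exists>N. \<forall>n\<ge>N. fiber_count (T ^^ n) j j \<ge> 2"
proof -
  obtain a b where ab: "0 \<le> a" "a < b" "b \<le> 1" "j = {a..b}" "interior j = {a<..<b}" using elementE[OF j] .
  let ?c = "(a+b)/2"
  have c: "a < ?c" "?c < b" "0 < ?c" "?c < 1" using ab by auto
  obtain N1 where N1: "\<forall>n\<ge>N1. \<exists>x. a < x \<and> x < ?c \<and> (T ^^ n) x = ?c"
    using preimages_in_subintervals[of a ?c ?c] ab c by auto
  obtain N2 where N2: "\<forall>n\<ge>N2. \<exists>x. ?c < x \<and> x < b \<and> (T ^^ n) x = ?c"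
    using preimages_in_subintervals[of ?c b ?c] ab c by auto
  have "fiber_count (T ^^ n) j j \<ge> 2" if n: "n \<ge> max N1 N2" for n
  proof -
    have n: "n \<ge> N1" "n \<ge> N2" using n by auto
    obtain x1 where x1: "a < x1" "x1 < ?c" "(T ^^ n) x1 = ?c" using N1 n by blast
    obtain x2 where x2: "?c < x2" "x2 < b" "(T ^^ n) x2 = ?c" using N2 n by blast
    have y: "?c \<in> interior j" using ab c by simp
    have "{x1,x2} \<subseteq> {x\<in>j. (T ^^ n) x = ?c}" using x1 x2 ab c by auto
    then have "card {x1,x2} \<le> card {x\<in>j. (T ^^ n) x = ?c}"
      by (rule card_mono[OF fiber_finite[OF j j y]])
    moreover have "x1 \<noteq> x2" using x1 x2 by linarith
    ultimately show ?thesis using fiber_card[OF j j y] by simp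
  qed
  then show ?thesis by blast
qed

text \<open>One point \<open>z\<close> of \<open>j\<close> with \<open>(T ^^ q) z\<close> in the
  interior of \<open>k\<close> stands for a path from \<open>j\<close> to \<open>k\<close>; paths
  from \<open>i\<close> to \<open>j\<close> are then preimages of \<open>z\<close>, and these form
  part of the longer fibre.\<close>

lemma fiber_count_extend:
  assumes i: "i \<in> P" and j: "j \<in> P" and k: "k \<in> P" and pos: "fiber_count (T ^^ q) j k > 0"
  shows "fiber_count (T ^^ n) i j \<le> fiber_count (T ^^ (q + n)) i k"
proof -
  obtain z where z: "z \<in> j" "(T ^^ q) z \<in> interior k"
    using pos boundary_map.fiber_count_pos_iff[OF iterate j k] by blast
  have zj: "z \<in> interior j" using boundary_map.fiber_interior[OF iterate j k z] .
  have "{x\<in>i. (T ^^ n) x = z} \<subseteq> {x\<in>i. (T ^^ (q + n)) x = (T ^^ q) z}"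
    by (auto simp: funpow_add)
  then have "card {x\<in>i. (T ^^ n) x = z} \<le> card {x\<in>i. (T ^^ (q + n)) x = (T ^^ q) z}"
    by (rule card_mono[OF fiber_finite[OF i k z(2)]])
  then show ?thesis using fiber_card[OF i j zj] fiber_card[OF i k z(2)] by simp
qed

text \<open>Lifting the points through \<open>T ^^ p\<close> into \<open>i\<close> counts them by a
  longer fibre. \<open>J\<close> is left arbitrary, since it will be an element of another partition
  or a compact interval.\<close>

lemma fiber_count_prepend:
  assumes i: "i \<in> P" and k: "k \<in> P" and y: "y \<in> interior k" and J: "J \<subseteq> (T ^^ p) ` i"
  shows "finite {x\<in>J. (T ^^ n) x = y}" "card {x\<in>J. (T ^^ n) x = y} \<le> fiber_count (T ^^ (n + p)) i k"
proof -
  have "{x\<in>J. (T ^^ n) x = y} \<subseteq> (T ^^ p) ` {x\<in>i. (T ^^ (n + p)) x = y}"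
    using J by (auto simp: funpow_add)
  note s = this and f = fiber_finite[OF i k y, of "n + p"]
  show "finite {x\<in>J. (T ^^ n) x = y}" using finite_subset[OF s finite_imageI[OF f]] .
  have "card {x\<in>J. (T ^^ n) x = y} \<le> card ((T ^^ p) ` {x\<in>i. (T ^^ (n + p)) x = y})"
    by (rule card_mono[OF finite_imageI[OF f] s])
  also have "\<dots> \<le> card {x\<in>i. (T ^^ (n + p)) x = y}" by (rule card_image_le[OF f])
  finally show "card {x\<in>J. (T ^^ n) x = y} \<le> fiber_count (T ^^ (n + p)) i k"
    using fiber_card[OF i k y] by simp
qed

end

text \<open>Mixing links the two partitions: an iterate of \<open>j\<close> covers \<open>i\<close>,
  and some \<open>k\<close> in \<open>P\<close> meeting the interior of \<open>i\<close> leads back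
  to \<open>j\<close>. The shift \<open>p\<close> is the total length of these two detours.\<close>

lemma fiber_count_compare:
  assumes "mixing_system P T" "mixing_system Q T" and i: "i \<in> Q" and j: "j \<in> P"
  shows "\<exists>p. \<forall>n. fiber_count (T ^^ n) i i \<le> fiber_count (T ^^ (n + p)) j j"
proof -
  interpret P: mixing_system P T by fact
  interpret Q: mixing_system Q T by fact
  obtain a b where ab: "0 \<le> a" "a < b" "b \<le> 1" "i = {a..b}" "interior i = {a<..<b}" using Q.elementE[OF i] .
  obtain s t where st: "0 \<le> s" "s < t" "t \<le> 1" "j = {s..t}" using P.elementE[OF j] by metis
  \<comment> \<open>\<open>y\<close> is generic for both partitions at once: interior to
    \<open>i\<close> in \<open>Q\<close> and to \<open>k\<close> in \<open>P\<close>.\<close>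
  obtain k y where k: "k \<in> P" "y \<in> interior k" "a < y" "y < b"
    using P.interval_meets_interior[OF ab(1-3)] .
  obtain p where p: "i \<subseteq> (T ^^ p) ` j" using Q.covers_element[OF st(1-3) i] st(4) by blast
  obtain q where q: "fiber_count (T ^^ q) k j > 0" using P.irreducible[OF k(1) j] by blast
  have "fiber_count (T ^^ n) i i \<le> fiber_count (T ^^ (n + (p + q))) j j" for n
  proof -
    have "fiber_count (T ^^ n) i i = card {x\<in>i. (T ^^ n) x = y}"
      using Q.fiber_card[OF i i, of y] k ab by simp
    also have "\<dots> \<le> fiber_count (T ^^ (n + p)) j k"
      by (rule P.fiber_count_prepend[OF j k(1,2) p])
    also have "\<dots> \<le> fiber_count (T ^^ (q + (n + p))) j j"
      by (rule P.fiber_count_extend[OF j k(1) j q])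
    also have "q + (n + p) = n + (p + q)" by simp
    finally show ?thesis .
  qed
  then show ?thesis by blast
qed

section \<open>Markov partitions\<close>

context interval_family
begin

text \<open>When no element adjoins \<open>x\<close> from the right, elements accumulate there and
  so must become short.\<close>

lemma element_right:
  assumes x: "0 \<le> x" "x < 1" and no: "\<And>l r. {l..r} \<in> P \<Longrightarrow> l \<le> x \<Longrightarrow> x < r \<Longrightarrow> False" and e: "e > 0"
  obtains l r where "{l..r} \<in> P" "x < l" "l < r" "r < x + e"
proof -
  have right: "\<exists>l r. {l..r} \<in> P \<and> x < l \<and> l < r \<and> l < y \<and> (\<exists>z. z < y \<and> z \<in> {l<..<r})" if y: "x < y" "y \<le> 1" for y
  proof -
    obtain i z where iz: "i \<in> P" "z \<in> interior i" "x < z" "z < y"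
      using interval_meets_interior[OF x(1) y] .
    obtain l r where lr: "l < r" "i = {l..r}" "interior i = {l<..<r}" using elementE[OF iz(1)] by metis
    have "\<not> l \<le> x"
    proof
      assume "l \<le> x"
      then show False using no[of l r] iz lr by auto
    qed
    then show ?thesis using iz lr by (intro exI[of _ l] exI[of _ r]) auto
  qed
  define y where "y = min (x + e) 1"
  have y: "x < y" "y \<le> 1" "y \<le> x + e" using x e by (auto simp: y_def)
  obtain l r z where lr: "{l..r} \<in> P" "x < l" "l < r" "l < y" using right[OF y(1,2)] by blast
  have "l \<le> 1" using lr y by linarith
  \<comment> \<open>The first element starts close to \<open>x\<close> but may be long; a second one
    starting to its left has to end before it, which keeps it within \<open>e\<close> of
    \<open>x\<close>.\<close>
  then obtain l' r' z' where lr': "{l'..r'} \<in> P" "x < l'" "l' < r'" "l' < l" "z' < l" "z' \<in> {l'<..<r'}"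
    using right[OF lr(2)] by blast
  have "r' \<le> l"
  proof (rule ccontr)
    assume "\<not> r' \<le> l"
    define w where "w = (l + min r r') / 2"
    have "w \<in> {l<..<r}" "w \<in> {l'<..<r'}" using \<open>\<not> r' \<le> l\<close> lr lr' by (auto simp: w_def min_def)
    then have "{l..r} = {l'..r'}"
      using interior_disjoint_unique[OF lr(1) lr'(1), of w] by simp
    then show False using lr(3) lr'(3,4) by auto
  qed
  then show ?thesis using that[of l' r'] lr' lr y by linarith
qed

lemma element_left:
  assumes x: "0 < x" "x \<le> 1" and no: "\<And>l r. {l..r} \<in> P \<Longrightarrow> l < x \<Longrightarrow> x \<le> r \<Longrightarrow> False" and e: "e > 0"
  obtains l r where "{l..r} \<in> P" "x - e < l" "l < r" "r < x"
proof -
  have left: "\<exists>l r. {l..r} \<in> P \<and> r < x \<and> l < r \<and> y < r \<and> (\<exists>z. y < z \<and> z \<in> {l<..<r})" if y: "y < x" "0 \<le> y" for y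
  proof -
    obtain i z where iz: "i \<in> P" "z \<in> interior i" "y < z" "z < x"
      using interval_meets_interior[OF y(2,1) x(2)] .
    obtain l r where lr: "l < r" "i = {l..r}" "interior i = {l<..<r}" using elementE[OF iz(1)] by metis
    have "\<not> x \<le> r"
    proof
      assume "x \<le> r"
      then show False using no[of l r] iz lr by auto
    qed
    then show ?thesis using iz lr by (intro exI[of _ l] exI[of _ r]) auto
  qed
  define y where "y = max (x - e) 0"
  have y: "y < x" "0 \<le> y" "x - e \<le> y" using x e by (auto simp: y_def)
  obtain l r z where lr: "{l..r} \<in> P" "r < x" "l < r" "y < r" using left[OF y(1,2)] by blast
  have "0 \<le> r" using lr y by linarith
  then obtain l' r' z' where lr': "{l'..r'} \<in> P" "r' < x" "l' < r'" "r < r'" "r < z'" "z' \<in> {l'<..<r'}"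
    using left[OF lr(2)] by blast
  have "r \<le> l'"
  proof (rule ccontr)
    assume "\<not> r \<le> l'"
    define w where "w = (r + max l l') / 2"
    have "w \<in> {l<..<r}" "w \<in> {l'<..<r'}" using \<open>\<not> r \<le> l'\<close> lr lr' by (auto simp: w_def max_def)
    then have "{l..r} = {l'..r'}"
      using interior_disjoint_unique[OF lr(1) lr'(1), of w] by simp
    then show False using lr(3) lr'(3,4) by auto
  qed
  then show ?thesis using that[of l' r'] lr' lr y by linarith
qed

lemma small_element:
  assumes x: "x \<in> {0..1}" "x \<notin> \<Union>P" and e: "e > 0"
  obtains i where "i \<in> P" "i \<subseteq> ball x e"
proof -
  have no: False if "{l..r} \<in> P" "l \<le> x" "x \<le> r" for l r using that x(2) by force
  show ?thesis
  proof (cases "x < 1")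
    case True
    obtain l r where "{l..r} \<in> P" "x < l" "l < r" "r < x + e"
    proof (rule element_right[OF _ True _ e])
      show False if "{l..r} \<in> P" "l \<le> x" "x < r" for l r
        using no[OF that(1,2)] that(3) by simp
    qed (use x in auto)
    moreover from this have "{l..r} \<subseteq> ball x e" by (auto simp: dist_real_def)
    ultimately show ?thesis using that by blast
  next
    case False
    then have "x = 1" "0 < x" "x \<le> 1" using x by auto
    obtain l r where "{l..r} \<in> P" "x - e < l" "l < r" "r < x"
    proof (rule element_left[OF \<open>0 < x\<close> \<open>x \<le> 1\<close> _ e])
      show False if "{l..r} \<in> P" "l < x" "x \<le> r" for l r
        using no[OF that(1) _ that(3)] that(2) by simp
    qed auto
    moreover from this have "{l..r} \<subseteq> ball x e" by (auto simp: dist_real_def)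
    ultimately show ?thesis using that by blast
  qed
qed

end

section \<open>Monotone intervals of mixing maps\<close>

lemma iterate_continuous_unit:
  fixes T :: "real \<Rightarrow> real"
  assumes "continuous_on {0..1} T" "T ` {0..1} \<subseteq> {0..1}"
  shows "continuous_on {0..1} (T ^^ n) \<and> (T ^^ n) ` {0..1} \<subseteq> {0..1}"
proof (induction n)
  case (Suc n)
  have "continuous_on {0..1} (T \<circ> (T ^^ n))"
    using Suc continuous_on_subset[OF assms(1)] by (intro continuous_on_compose) auto
  moreover have "(T ^^ Suc n) ` {0..1} \<subseteq> {0..1}"
    using Suc assms(2) by (auto simp: image_subset_iff)
  ultimately show ?case by simp
qed auto

text \<open>If a monotone map takes the same value at two points, it is constant between them, and
  all later images of that interval are single points, which mixing forbids.\<close>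

lemma mixing_monotone_imp_inj:
  assumes T: "continuous_on {0..1::real} T" "T ` {0..1} \<subseteq> {0..1}" "topologically_mixing T"
    and J: "is_interval J" "J \<subseteq> {0..1}" "monotone_map_on J T"
  shows "inj_on T J"
proof -
  have False if xy: "x \<in> J" "y \<in> J" "T x = T y" "x < y" for x y
  proof -
    have sub: "{x..y} \<subseteq> J" using mem_is_interval_1_I[OF J(1) xy(1,2)] by auto
    have const: "T z = T x" if z: "z \<in> {x..y}" for z
    proof -
      have zJ: "z \<in> J" using sub z by blast
      have "T x \<le> T z \<and> T z \<le> T y \<or> T z \<le> T x \<and> T y \<le> T z"
        using J(3) xy(1,2) zJ z unfolding monotone_map_on_def monotone_on_def by auto
      then show ?thesis using xy(3) by linarith
    qed
    have "0 \<le> x" "y \<le> 1" using xy J(2) by auto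
    \<comment> \<open>Any nondegenerate compact subinterval of the open unit interval would serve in
      place of \<open>{1/4..1/2}\<close>.\<close>
    then obtain N where N: "\<forall>n\<ge>N. {1/4..1/2} \<subseteq> (T ^^ n) ` {x..y}"
      using mixing_image_covers[OF conjunct1[OF iterate_continuous_unit[OF T(1,2)]] T(3) _ xy(4), of "1/4" "1/2"] by auto
    have "(T ^^ Suc N) ` {x..y} \<subseteq> {(T ^^ N) (T x)}"
    proof
      fix w assume "w \<in> (T ^^ Suc N) ` {x..y}"
      then obtain z where z: "z \<in> {x..y}" "w = (T ^^ Suc N) z" by blast
      then have "w = (T ^^ N) (T z)" by (metis comp_apply funpow_Suc_right)
      then show "w \<in> {(T ^^ N) (T x)}" using const[OF z(1)] by simp
    qed
    moreover have "{1/4..1/2} \<subseteq> (T ^^ Suc N) ` {x..y}" using N[rule_format, of "Suc N"] by simp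
    ultimately have "{1/4..1/2} \<subseteq> {(T ^^ N) (T x)}" by blast
    moreover have "1/4 \<in> {1/4..1/2::real}" "1/2 \<in> {1/4..1/2::real}" by auto
    ultimately have "1/4 = (T ^^ N) (T x)" "1/2 = (T ^^ N) (T x)" by blast+
    then show False by simp
  qed
  then show ?thesis by (metis inj_onI linorder_neqE_linordered_idom)
qed

text \<open>Zorn's lemma for monotone intervals containing \<open>x\<close>. In a chain the
  direction is consistent: once a member fails to be increasing, all larger ones are
  decreasing.\<close>

lemma maximal_monotone_interval_exists:
  assumes "x \<in> i"
  shows "\<exists>i'. maximal_monotone_interval T i i' \<and> x \<in> i'"
proof -
  define A where "A = {K. x \<in> K \<and> is_interval K \<and> K \<subseteq> i \<and> monotone_map_on K T}"
  have "{x} \<in> A" using assms is_interval_cc[of x x] by (auto simp: A_def monotone_map_on_def monotone_on_def)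
  then have "A \<noteq> {}" by blast
  moreover have "\<Union>C \<in> A" if C: "C \<noteq> {}" "subset.chain A C" for C
  proof -
    have CA: "\<And>K. K \<in> C \<Longrightarrow> K \<in> A" and tot: "\<And>K L. K \<in> C \<Longrightarrow> L \<in> C \<Longrightarrow> K \<subseteq> L \<or> L \<subseteq> K"
      using C(2) by (auto simp: subset_chain_def)
    \<comment> \<open>Two points of the union lie in a common member, which can be taken above any
      prescribed member \<open>L\<close>.\<close>
    have common: "\<exists>K\<in>C. s \<in> K \<and> t \<in> K \<and> L \<subseteq> K" if h: "s \<in> \<Union>C" "t \<in> \<Union>C" "L \<in> C" for s t L
    proof -
      obtain K1 K2 where K: "K1 \<in> C" "s \<in> K1" "K2 \<in> C" "t \<in> K2" using h by blast
      have "\<exists>K3\<in>C. K1 \<subseteq> K3 \<and> K2 \<subseteq> K3" using tot[OF K(1,3)] K(1,3) by (metis order_refl)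
      then obtain K3 where K3: "K3 \<in> C" "K1 \<subseteq> K3" "K2 \<subseteq> K3" by (elim bexE conjE)
      have "\<exists>K4\<in>C. K3 \<subseteq> K4 \<and> L \<subseteq> K4" using tot[OF K3(1) h(3)] K3(1) h(3) by (metis order_refl)
      then obtain K4 where K4: "K4 \<in> C" "K3 \<subseteq> K4" "L \<subseteq> K4" by (elim bexE conjE)
      have "s \<in> K4" using K(2) K3(2) K4(2) by (meson subsetD)
      moreover have "t \<in> K4" using K(4) K3(3) K4(2) by (meson subsetD)
      ultimately show ?thesis using K4 by (intro bexI[of _ K4] conjI)
    qed
    obtain L0 where L0: "L0 \<in> C" using C(1) by blast
    have "x \<in> \<Union>C" "\<Union>C \<subseteq> i" using L0 CA by (auto simp: A_def)
    moreover have "is_interval (\<Union>C)"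
      unfolding is_interval_1
    proof (intro ballI allI impI)
      fix a b z assume ab: "a \<in> \<Union>C" "b \<in> \<Union>C" "a \<le> z \<and> z \<le> b"
      obtain K where "K \<in> C" "a \<in> K" "b \<in> K" using common[OF ab(1,2) L0] by blast
      moreover from this have "is_interval K" using CA by (auto simp: A_def)
      ultimately show "z \<in> \<Union>C" using mem_is_interval_1_I[of K a b z] ab by blast
    qed
    moreover have "monotone_map_on (\<Union>C) T"
    proof (cases "\<forall>K\<in>C. mono_on K T")
      case True
      have "mono_on (\<Union>C) T"
      proof (rule mono_onI)
        fix s t assume st: "s \<in> \<Union>C" "t \<in> \<Union>C" "s \<le> t"
        obtain K where "K \<in> C" "s \<in> K" "t \<in> K" using common[OF st(1,2) L0] by blast
        then show "T s \<le> T t" using True st(3) by (auto dest: mono_onD)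
      qed
      then show ?thesis by (simp add: monotone_map_on_def)
    next
      case False
      then obtain L where L: "L \<in> C" "\<not> mono_on L T" by blast
      have "antimono_on (\<Union>C) T"
      proof (rule monotone_onI)
        fix s t assume st: "s \<in> \<Union>C" "t \<in> \<Union>C" "s \<le> t"
        obtain K where K: "K \<in> C" "s \<in> K" "t \<in> K" "L \<subseteq> K" using common[OF st(1,2) L(1)] by blast
        then have "\<not> mono_on K T" using L(2) by (meson monotone_on_subset)
        then have "antimono_on K T" using CA[OF K(1)] by (auto simp: A_def monotone_map_on_def)
        then show "T s \<ge> T t" using K st(3) by (auto dest: monotone_onD)
      qed
      then show ?thesis by (simp add: monotone_map_on_def)
    qed
    ultimately show ?thesis by (simp add: A_def)
  qed
  ultimately obtain M where M: "M \<in> A" "\<forall>X\<in>A. M \<subseteq> X \<longrightarrow> X = M"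
    using subset_Zorn_nonempty[of A] by blast
  have "maximal_monotone_interval T i M"
    unfolding maximal_monotone_interval_def using M by (auto simp: A_def)
  then show ?thesis using M(1) by (auto simp: A_def)
qed

text \<open>A point mapped strictly between \<open>c\<close> and \<open>d\<close> lies strictly
  between preimages of \<open>c\<close> and \<open>d\<close> in \<open>J\<close>, so it is not an
  end of \<open>J\<close>.\<close>

lemma monotone_covering_interior:
  assumes J: "is_interval J" "monotone_map_on J T" "{c..d} \<subseteq> T ` J" and x: "x \<in> J" "c < T x" "T x < d"
  obtains s t where "s < x" "x < t" "{s..t} \<subseteq> (J :: real set)"
proof -
  have "c \<in> T ` J" "d \<in> T ` J" using J(3) x by auto
  then obtain u v where uv: "u \<in> J" "T u = c" "v \<in> J" "T v = d" by blast
  have sub: "{u..v} \<subseteq> J" "{v..u} \<subseteq> J"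
    using mem_is_interval_1_I[OF J(1) uv(1,3)] mem_is_interval_1_I[OF J(1) uv(3,1)] by auto
  from J(2) consider "mono_on J T" | "antimono_on J T" by (auto simp: monotone_map_on_def)
  then show ?thesis
  proof cases
    case 1
    have "u < x" "x < v" using 1 x uv unfolding monotone_on_def by (meson not_le)+
    then show ?thesis using that sub by blast
  next
    case 2
    have "v < x" "x < u" using 2 x uv unfolding monotone_on_def by (meson not_le)+
    then show ?thesis using that sub by blast
  qed
qed

text \<open>The covering condition puts an injective neighbourhood inside \<open>i\<close> around
  each point of \<open>i\<close> that is mapped into the interior of an element. This gives local
  injectivity, and it prevents endpoints of elements from being mapped to generic points.\<close>

lemma markov_partition_imp_mixing_system:
  assumes T: "continuous_on {0..1} T" "T ` {0..1} \<subseteq> {0..1}" "topologically_mixing T"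
    and P: "markov_partition T P"
  shows "mixing_system P T"
proof -
  note M = P[unfolded markov_partition_def]
  note M1 = M[THEN conjunct1] and Ma = M[THEN conjunct2]
  note M2 = Ma[THEN conjunct1] and Mb = Ma[THEN conjunct2]
  note M3 = Mb[THEN conjunct1] and Mc = Mb[THEN conjunct2]
  note M4 = Mc[THEN conjunct1] and M5 = Mc[THEN conjunct2, THEN conjunct1]
    and M6 = Mc[THEN conjunct2, THEN conjunct2]
  interpret interval_family P
    by (rule interval_family.intro[OF M1 M2[THEN bspec] M3[THEN bspec, THEN bspec, THEN mp] M4])
  have pm: "\<And>i. i \<in> P \<Longrightarrow> piecewise_monotone_on i T" by (rule M5[THEN bspec])
  have cover: "j \<subseteq> T ` i'" if "i \<in> P" "j \<in> P" "maximal_monotone_interval T i i'" "x \<in> i'" "T x \<in> interior j" for i j i' x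
  proof -
    have "T ` i' \<inter> interior j \<noteq> {}" using that(4,5) by blast
    then show ?thesis using M6[THEN bspec, OF that(1), THEN bspec, OF that(2), THEN spec, THEN mp] that(3) by simp
  qed
  have key: "\<exists>s t. s < x \<and> x < t \<and> {s..t} \<subseteq> i \<and> inj_on T {s..t}"
    if i: "i \<in> P" and j: "j \<in> P" and x: "x \<in> i" "T x \<in> interior j" for i j x
  proof -
    obtain i' where i': "maximal_monotone_interval T i i'" "x \<in> i'"
      using maximal_monotone_interval_exists[OF x(1)] by blast
    have m: "is_interval i'" "i' \<subseteq> i" "monotone_map_on i' T"
      using i'(1) by (auto simp: maximal_monotone_interval_def)
    obtain c d where cd: "j = {c..d}" "interior j = {c<..<d}" using elementE[OF j] by metis
    have "{c..d} \<subseteq> T ` i'" using cover[OF i j i' x(2)] cd by simp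
    moreover have "c < T x" "T x < d" using x(2) cd by auto
    ultimately obtain s t where st: "s < x" "x < t" "{s..t} \<subseteq> i'"
      using monotone_covering_interior[OF m(1,3) _ i'(2)] by metis
    have "inj_on T i'"
      using m element_subset[OF i] by (intro mixing_monotone_imp_inj[OF T]) auto
    then have "inj_on T {s..t}" using st(3) by (rule inj_on_subset)
    then show ?thesis using st m by blast
  qed
  have inv: "T x \<in> B" if xB: "x \<in> B" for x
  proof (rule ccontr)
    assume nB: "T x \<notin> B"
    have x01: "x \<in> {0..1}" using xB boundary_unit by blast
    then have "T x \<in> {0..1}" using T(2) by blast
    then obtain j where j: "j \<in> P" "T x \<in> interior j" using nB not_boundaryE by blast
    show False
    proof (cases "x \<in> \<Union>P")
      case True
      then obtain i where i: "i \<in> P" "x \<in> i" by blast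
      obtain s t where st: "s < x" "x < t" "{s..t} \<subseteq> i" using key[OF i(1) j(1) i(2) j(2)] by blast
      have "x \<in> {s<..<t}" "{s<..<t} \<subseteq> i" using st by force+
      then have "x \<in> interior i" by (meson interiorI open_greaterThanLessThan)
      then show False using interior_not_boundary[OF i(1)] xB by blast
    next
      \<comment> \<open>A point outside all elements is a limit of small elements. If its image were
        interior to \<open>j\<close>, a nearby small element would be mapped into the interior of
        \<open>j\<close>, although a maximal monotone interval in it must cover
        \<open>j\<close>.\<close>
      case False
      obtain e0 where "e0 > 0" "ball (T x) e0 \<subseteq> interior j"
        using j(2) open_interior open_contains_ball by blast
      moreover obtain e where e: "e > 0" "\<And>z. z \<in> {0..1} \<Longrightarrow> dist z x < e \<Longrightarrow> dist (T z) (T x) < e0"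
        using T(1) x01 \<open>e0 > 0\<close> unfolding continuous_on_iff by metis
      ultimately have near: "T z \<in> interior j" if "z \<in> {0..1}" "z \<in> ball x e" for z
        using that by (metis dist_commute mem_ball subset_iff)
      obtain i where i: "i \<in> P" "i \<subseteq> ball x e" using small_element[OF x01 False e(1)] .
      have Ti: "T ` i \<subseteq> interior j" using near i(2) element_subset[OF i(1)] by blast
      obtain a b where ab: "a < b" "i = {a..b}" using elementE[OF i(1)] by metis
      then have ai: "a \<in> i" by simp
      obtain i' where i': "maximal_monotone_interval T i i'" "a \<in> i'"
        using maximal_monotone_interval_exists[OF ai] by blast
      have "i' \<subseteq> i" using i'(1) by (simp add: maximal_monotone_interval_def)
      moreover have "j \<subseteq> T ` i'" using cover[OF i(1) j(1) i'] Ti ai by blast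
      ultimately have "j \<subseteq> interior j" using Ti by blast
      moreover obtain c d where cd: "c < d" "j = {c..d}" "interior j = {c<..<d}" using elementE[OF j(1)] by metis
      moreover have "c \<in> j" "c \<notin> interior j" using cd by auto
      ultimately show False by blast
    qed
  qed
  show ?thesis
  proof (unfold_locales)
    show "\<exists>e>0. inj_on T ({0..1} \<inter> ball x e)" if x: "x \<in> {0..1}" "T x \<notin> B" for x
    proof -
      have "x \<notin> B" using inv x by blast
      then obtain i where i: "i \<in> P" "x \<in> interior i" using x not_boundaryE by blast
      have "T x \<in> {0..1}" using T(2) x by blast
      then obtain j where j: "j \<in> P" "T x \<in> interior j" using x not_boundaryE by blast
      obtain s t where st: "s < x" "x < t" "inj_on T {s..t}"
        using key[OF i(1) j(1) _ j(2)] i(2) interior_subset by blast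
      have "{0..1} \<inter> ball x (min (x - s) (t - x)) \<subseteq> {s..t}" by (auto simp: dist_real_def)
      then have "inj_on T ({0..1} \<inter> ball x (min (x - s) (t - x)))" by (rule inj_on_subset[OF st(3)])
      then show ?thesis using st by (intro exI[of _ "min (x - s) (t - x)"]) auto
    qed
  qed (use T pm inv in auto)
qed

section \<open>Transition numbers and window perturbations\<close>

lemma inj_continuous_monotone_map_on:
  fixes f :: "real \<Rightarrow> real"
  assumes "continuous_on {p..q} f" "inj_on f {p..q}"
  shows "monotone_map_on {p..q} f"
proof -
  consider "strict_mono_on {p..q} f" | "strict_antimono_on {p..q} f"
    using inj_continuous_interval_mono[OF assms] by blast
  then show ?thesis
  proof cases
    case 1
    then have "mono_on {p..q} f" by (rule strict_mono_on_imp_mono_on)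
    then show ?thesis by (simp add: monotone_map_on_def)
  next
    case 2
    then have "antimono_on {p..q} f"
      unfolding monotone_on_def by (metis order_le_less)
    then show ?thesis by (simp add: monotone_map_on_def)
  qed
qed

text \<open>The intervals of a competing family contain preimages of \<open>y\<close> in their
  disjoint interiors, which bounds the maximum from above; the branches through the preimages of
  \<open>y\<close> form a family that attains the bound.\<close>

lemma (in mixing_system) transition_number_eq_fiber_count:
  assumes i: "i \<in> P" and j: "j \<in> P"
  shows "transition_number T i j = fiber_count T i j"
proof (cases "j \<subseteq> T ` i")
  case False
  then have "fiber_count T i j = 0" using fiber_count_pos_covers[OF i j] by blast
  then show ?thesis using False by (simp add: transition_number_def)
next
  case True
  obtain c d where cd: "c < d" "j = {c..d}" "interior j = {c<..<d}" using elementE[OF j] by metis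
  obtain y where "c < y" "y < d" using dense[OF cd(1)] by blast
  then have y: "y \<in> interior j" using cd by simp
  define F where "F = {x\<in>i. T x = y}"
  have F: "finite F" "card F = fiber_count T i j"
    using finite_fiber[OF i j y] fiber_count_eq[OF i j y] by (simp_all add: F_def)
  define good where "good \<J> \<longleftrightarrow> finite \<J> \<and>
             (\<forall>J\<in>\<J>. is_interval J \<and> J \<subseteq> i \<and> monotone_map_on J T \<and> j \<subseteq> T ` J) \<and>
             (\<forall>J\<in>\<J>. \<forall>K\<in>\<J>. J \<noteq> K \<longrightarrow> interior J \<inter> interior K = {})" for \<J>
  have upper: "card \<J> \<le> fiber_count T i j" if g: "good \<J>" for \<J>
  proof -
    have ex: "\<exists>x. x \<in> interior J \<and> x \<in> J \<and> T x = y" if J: "J \<in> \<J>" for J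
    proof -
      have JJ: "is_interval J" "monotone_map_on J T" "{c..d} \<subseteq> T ` J"
        using g J cd by (auto simp: good_def)
      have "y \<in> {c..d}" using \<open>c < y\<close> \<open>y < d\<close> by simp
      then obtain x where x: "x \<in> J" "T x = y" using JJ(3) by blast
      obtain s t where st: "s < x" "x < t" "{s..t} \<subseteq> J"
        using monotone_covering_interior[OF JJ x(1)] x(2) \<open>c < y\<close> \<open>y < d\<close> by metis
      have "x \<in> interior {s..t}" using st by simp
      then have "x \<in> interior J" using interior_mono[OF st(3)] by blast
      then show ?thesis using x by blast
    qed
    then obtain g where g': "\<And>J. J \<in> \<J> \<Longrightarrow> g J \<in> interior J \<and> g J \<in> J \<and> T (g J) = y" by metis
    have "inj_on g \<J>"
    proof (rule inj_onI)
      fix J K assume JK: "J \<in> \<J>" "K \<in> \<J>" "g J = g K"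
      then have "g J \<in> interior J \<inter> interior K" using g'[of J] g'[of K] by simp
      moreover have "J \<noteq> K \<Longrightarrow> interior J \<inter> interior K = {}" using g JK by (simp add: good_def)
      ultimately show "J = K" by blast
    qed
    moreover have "g ` \<J> \<subseteq> F"
    proof
      fix x assume "x \<in> g ` \<J>"
      then obtain J where J: "J \<in> \<J>" "x = g J" by blast
      have "J \<subseteq> i" using g J by (simp add: good_def)
      then show "x \<in> F" using g'[OF J(1)] J(2) by (auto simp: F_def)
    qed
    ultimately have "card \<J> \<le> card F" by (rule card_inj_on_le) (rule F)
    then show ?thesis using F by simp
  qed
  have ex: "\<exists>\<J>. good \<J> \<and> card \<J> = fiber_count T i j"
  proof -
    define W where "W x p q \<longleftrightarrow> p < x \<and> x < q \<and> {p..q} \<subseteq> i \<and> inj_on T {p..q} \<and> T ` {p..q} = j \<and>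
      T p \<notin> interior j \<and> T q \<notin> interior j \<and> T ` {p<..<q} \<subseteq> interior j" for x p q
    have "\<exists>p q. W x p q" if "x \<in> F" for x
    proof -
      have "x \<in> i" "T x \<in> interior j" using that y by (auto simp: F_def)
      from branch[OF i j this] show ?thesis unfolding W_def by metis
    qed
    then obtain p q where W: "\<And>x. x \<in> F \<Longrightarrow> W x (p x) (q x)" by metis
    have eq: "x = z" if xz: "x \<in> F" "z \<in> F" and w: "w \<in> {p x<..<q x}" "w \<in> {p z<..<q z}" for x z w
    proof -
      have "p x = p z \<and> q x = q z"
        by (rule branches_disjoint[of "p x" "q x" "interior j" "p z" "q z" w])
          (use W[OF xz(1)] W[OF xz(2)] w in \<open>simp_all add: W_def\<close>)
      then have "x \<in> {p x..q x}" "z \<in> {p x..q x}"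
        using W[OF xz(1)] W[OF xz(2)] by (simp_all add: W_def)
      moreover have "inj_on T {p x..q x}" "T x = T z" using W[OF xz(1)] xz by (simp_all add: W_def F_def)
      ultimately show ?thesis by (metis inj_onD)
    qed
    define \<J> where "\<J> = (\<lambda>x. {p x..q x}) ` F"
    have "inj_on (\<lambda>x. {p x..q x}) F"
    proof (rule inj_onI)
      fix x z assume xz: "x \<in> F" "z \<in> F" "{p x..q x} = {p z..q z}"
      have px: "p x < x" "x < q x" using W[OF xz(1)] by (simp_all add: W_def)
      then have "p x = p z \<and> q x = q z" using xz(3) by (simp add: Icc_eq_Icc)
      then show "x = z" using eq[OF xz(1,2), of x] px by simp
    qed
    then have "card \<J> = fiber_count T i j" using F(2) by (simp add: \<J>_def card_image)
    moreover have "good \<J>"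
      unfolding good_def
    proof (intro conjI ballI impI)
      show "finite \<J>" using F(1) by (simp add: \<J>_def)
    next
      fix J assume "J \<in> \<J>"
      then obtain x where x: "x \<in> F" "J = {p x..q x}" by (auto simp: \<J>_def)
      note Wx = W[OF x(1), unfolded W_def]
      show "is_interval J" using x by (simp add: is_interval_cc)
      show Ji: "J \<subseteq> i" using Wx x by simp
      show "j \<subseteq> T ` J" using Wx x by simp
      have "J \<subseteq> {0..1}" using Ji element_subset[OF i] by blast
      then show "monotone_map_on J T"
        using Wx x by (auto intro!: inj_continuous_monotone_map_on continuous_on_subset[OF cont])
    next
      fix J K assume JK: "J \<in> \<J>" "K \<in> \<J>" "J \<noteq> K"
      obtain x where x: "x \<in> F" "J = {p x..q x}" using JK by (auto simp: \<J>_def)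
      obtain z where z: "z \<in> F" "K = {p z..q z}" using JK by (auto simp: \<J>_def)
      show "interior J \<inter> interior K = {}"
      proof (rule ccontr)
        assume "interior J \<inter> interior K \<noteq> {}"
        then obtain w where "w \<in> interior J" "w \<in> interior K" by blast
        then have "x = z" using eq[OF x(1) z(1), of w] x z by simp
        then show False using JK x z by simp
      qed
    qed
    ultimately show ?thesis by blast
  qed
  let ?S = "{card \<J> | \<J>. good \<J>}"
  have "Max ?S = fiber_count T i j"
  proof (rule Max_eqI)
    have "?S \<subseteq> {..fiber_count T i j}" using upper by blast
    then show "finite ?S" by (rule finite_subset) simp
    show "n \<le> fiber_count T i j" if "n \<in> ?S" for n using that upper by blast
    obtain \<J> where "good \<J>" "card \<J> = fiber_count T i j" using ex by blast
    then show "fiber_count T i j \<in> ?S" by (intro CollectI exI[of _ \<J>]) simp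
  qed
  then show ?thesis using True unfolding transition_number_def good_def by simp
qed

section \<open>The same family for the perturbed map\<close>

lemma monotone_endpoint_image:
  fixes f :: "real \<Rightarrow> real"
  assumes "monotone_map_on {u..v} f" "u \<le> v" "f ` {u..v} = {m..M}" "m \<le> M"
  shows "f u \<in> {m, M}" "f v \<in> {m, M}"
proof -
  have "f u \<in> {m..M}" "f v \<in> {m..M}" using assms(2,3) by force+
  moreover have "m \<in> f ` {u..v}" "M \<in> f ` {u..v}" using assms(3,4) by auto
  then obtain z z' where z: "z \<in> {u..v}" "m = f z" "z' \<in> {u..v}" "M = f z'" by blast
  moreover have "(f u \<le> f z \<and> f z' \<le> f v) \<or> (f v \<le> f z \<and> f z' \<le> f u)"
    using assms(1) z assms(2) unfolding monotone_map_on_def monotone_on_def by auto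
  ultimately show "f u \<in> {m, M}" "f v \<in> {m, M}"
    using assms(1) assms(2) unfolding monotone_map_on_def monotone_on_def by force+
qed

text \<open>The axioms are checked directly for \<open>T\<close>. Outside the windows
  \<open>T\<close> is \<open>S\<close>; inside a window the ends of every piece are mapped to ends
  of the \<open>S\<close>-image of the window, which are boundary points, so a point with generic
  image is interior to a monotone piece.\<close>

lemma window_perturbation_system:
  assumes w: "window_perturbation S P P' T" and sysS: "mixing_system P S"
  shows "mixing_system P T"
    and "\<And>i j. i \<in> P - P' \<Longrightarrow> fiber_count T i j = fiber_count S i j"
    and "\<And>i j. i \<in> P \<Longrightarrow> j \<in> P \<Longrightarrow> fiber_count S i j \<le> fiber_count T i j"
proof -
  interpret S: mixing_system P S by fact
  have P': "P' \<subseteq> P" and mono: "\<And>j. j \<in> P' \<Longrightarrow> monotone_map_on j S" and Tc: "T \<in> cpmm"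
    and off: "\<And>x. x \<in> {0..1} - (\<Union>j\<in>P'. interior j) \<Longrightarrow> T x = S x"
    and win: "\<And>j. j \<in> P' \<Longrightarrow> \<exists>k\<ge>1. \<exists>D. D division_of j \<and> card D = 2 * k + 1 \<and>
        (\<forall>J\<in>D. interior J \<noteq> {} \<and> T ` J = S ` j \<and> monotone_map_on J T)"
    using w by (simp_all add: window_perturbation_def)
  have T: "continuous_on {0..1} T" "T ` {0..1} \<subseteq> {0..1}" "topologically_mixing T"
    using Tc by (simp_all add: cpmm_def)
  \<comment> \<open>An element is the closure of its interior, so no point of an unperturbed element
    is interior to a window.\<close>
  have same: "T x = S x" if "i \<in> P - P'" "x \<in> i" for i x
  proof (rule off)
    have "x \<notin> interior j" if j: "j \<in> P'" for j
      using S.interior_disjoint_element[of i j] \<open>i \<in> P - P'\<close> \<open>x \<in> i\<close> j P' by blast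
    then show "x \<in> {0..1} - (\<Union>j\<in>P'. interior j)" using that S.element_subset[of i] by blast
  qed
  have wind: "\<exists>D. D division_of j \<and> D \<noteq> {} \<and> (\<forall>J\<in>D. T ` J = S ` j \<and> monotone_map_on J T)"
    if j: "j \<in> P'" for j
  proof -
    obtain k D where D: "D division_of j" "card D = 2 * k + 1"
        "\<forall>J\<in>D. interior J \<noteq> {} \<and> T ` J = S ` j \<and> monotone_map_on J T"
      using win[OF j] by metis
    have "D \<noteq> {}" using D(2) by auto
    then show ?thesis using D by (intro exI[of _ D]) simp
  qed
  show sysT: "mixing_system P T"
  proof (unfold_locales)
    show "T x \<in> boundary_set P" if "x \<in> boundary_set P" for x
    proof -
      have "x \<in> {0..1} - (\<Union>j\<in>P'. interior j)" using that P' unfolding boundary_set_def by blast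
      then show ?thesis using off S.boundary_invariant[OF that] by simp
    qed
    show "piecewise_monotone_on i T" if i: "i \<in> P" for i
    proof (cases "i \<in> P'")
      case True
      then show ?thesis using wind[OF True] unfolding piecewise_monotone_on_def by blast
    next
      case False
      obtain D where D: "D division_of i" "\<And>J. J \<in> D \<Longrightarrow> monotone_map_on J S"
        using S.piecewise_monotone[OF i] unfolding piecewise_monotone_on_def by blast
      have "monotone_map_on J T" if J: "J \<in> D" for J
      proof -
        have "J \<subseteq> i" using division_ofD(2)[OF D(1) J] .
        then have "\<And>x. x \<in> J \<Longrightarrow> T x = S x" using same[of i] i False by blast
        then show ?thesis using D(2)[OF J] unfolding monotone_map_on_def monotone_on_def by simp
      qed
      then show ?thesis using D(1) unfolding piecewise_monotone_on_def by blast
    qed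
    show "\<exists>e>0. inj_on T ({0..1} \<inter> ball x e)" if x: "x \<in> {0..1}" "T x \<notin> boundary_set P" for x
    proof -
      have "x \<notin> boundary_set P"
      proof
        assume a: "x \<in> boundary_set P"
        then have "x \<in> {0..1} - (\<Union>j\<in>P'. interior j)" using P' unfolding boundary_set_def by blast
        then show False using off S.boundary_invariant[OF a] x by simp
      qed
      then obtain i where i: "i \<in> P" "x \<in> interior i" using S.not_boundaryE x(1) by blast
      then have xi: "x \<in> i" using interior_subset by blast
      obtain e1 where e1: "e1 > 0" "ball x e1 \<subseteq> i"
        using i(2) mem_interior by blast
      show ?thesis
      proof (cases "i \<in> P'")
        case False
        have Tx: "S x \<notin> boundary_set P" using same[of i x] xi i False x by simp
        obtain e2 where e2: "e2 > 0" "inj_on S ({0..1} \<inter> ball x e2)"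
          using S.locally_injective[OF x(1) Tx] by blast
        have "inj_on S ({0..1} \<inter> ball x (min e1 e2))" by (rule inj_on_subset[OF e2(2)]) auto
        moreover have "T z = S z" if "z \<in> {0..1} \<inter> ball x (min e1 e2)" for z
          using same[of i z] e1(2) that i False by auto
        ultimately have "inj_on T ({0..1} \<inter> ball x (min e1 e2))" by (metis inj_on_cong)
        then show ?thesis using e1 e2 by (intro exI[of _ "min e1 e2"]) simp
      next
        case True
        obtain D where DD: "D division_of i \<and> D \<noteq> {} \<and> (\<forall>J\<in>D. T ` J = S ` i \<and> monotone_map_on J T)"
          using wind[OF True] ..
        then have D: "D division_of i" "\<And>J. J \<in> D \<Longrightarrow> T ` J = S ` i" "\<And>J. J \<in> D \<Longrightarrow> monotone_map_on J T"
          by simp_all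
        have "x \<in> \<Union>D" using division_ofD(6)[OF D(1)] xi by simp
        then obtain J where J: "J \<in> D" "x \<in> J" by blast
        obtain u v where uv: "J = {u..v}" using division_ofD(4)[OF D(1) J(1)] by auto
        have uvx: "u \<le> x" "x \<le> v" using J uv by auto
        obtain a b where ab: "0 \<le> a" "a < b" "b \<le> 1" "i = {a..b}" using S.elementE[OF i(1)] by metis
        have injS: "inj_on S {a..b}"
          using mono[OF True] ab S.cont S.maps S.mixing
          by (intro mixing_monotone_imp_inj) (auto simp: is_interval_cc)
        have contS: "continuous_on {a..b} S" by (rule continuous_on_subset[OF S.cont]) (use ab in auto)
        obtain m M where mM: "S ` {a..b} = {m..M}" "m < M" "m \<in> {S a, S b}" "M \<in> {S a, S b}"
          using inj_continuous_image_interval[OF contS injS ab(2)] by blast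
        have "a \<in> boundary_set P" "b \<in> boundary_set P" using S.endpoints_boundary[of a b] i ab by auto
        then have mB: "m \<in> boundary_set P" "M \<in> boundary_set P" using mM S.boundary_invariant by auto
        have "T ` {u..v} = {m..M}" using D(2)[OF J(1)] uv ab mM by simp
        then have "T u \<in> {m, M}" "T v \<in> {m, M}"
          using monotone_endpoint_image[of u v T m M] D(3)[OF J(1)] uv uvx mM(2) by auto
        then have "x \<noteq> u" "x \<noteq> v" using x(2) mB by auto
        then have ux: "u < x" "x < v" using uvx by auto
        have "{u..v} \<subseteq> {0..1}" using division_ofD(2)[OF D(1) J(1)] uv S.element_subset[OF i(1)] by blast
        then have inj: "inj_on T {u..v}"
          using D(3)[OF J(1)] uv by (intro mixing_monotone_imp_inj[OF T]) (auto simp: is_interval_cc)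
        have "{0..1} \<inter> ball x (min (x - u) (v - x)) \<subseteq> {u..v}" by (auto simp: dist_real_def)
        then have "inj_on T ({0..1} \<inter> ball x (min (x - u) (v - x)))" by (rule inj_on_subset[OF inj])
        then show ?thesis using ux by (intro exI[of _ "min (x - u) (v - x)"]) auto
      qed
    qed
  qed (use T in auto)
  interpret T: mixing_system P T by fact
  show same_count: "fiber_count T i j = fiber_count S i j" if "i \<in> P - P'" for i j
  proof -
    have "{x\<in>i. T x = y} = {x\<in>i. S x = y}" for y using same[OF that] by auto
    then show ?thesis by (simp add: fiber_count_def)
  qed
  show "fiber_count S i j \<le> fiber_count T i j" if i: "i \<in> P" and j: "j \<in> P" for i j
  proof (cases "i \<in> P'")
    case False
    then show ?thesis using same_count i by simp
  next
    \<comment> \<open>A window contains at most one \<open>S\<close>-preimage, because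
      \<open>S\<close> is injective on it, while every piece of the division contains a
      \<open>T\<close>-preimage of the same point.\<close>
    case True
    show ?thesis
    proof (cases "fiber_count S i j = 0")
      case False
      then obtain x where x: "x \<in> i" "S x \<in> interior j" using S.fiber_count_pos_iff[OF i j] by blast
      obtain a b where ab: "0 \<le> a" "a < b" "b \<le> 1" "i = {a..b}" using S.elementE[OF i] by metis
      have inj: "inj_on S i"
        using mono[OF True] ab S.cont S.maps S.mixing
        by (intro mixing_monotone_imp_inj) (auto simp: is_interval_cc)
      have "{z\<in>i. S z = S x} = {x}" using inj x(1) by (auto dest: inj_onD)
      then have "fiber_count S i j = 1" using S.fiber_count_eq[OF i j x(2)] by simp
      moreover obtain D where DD: "D division_of i \<and> D \<noteq> {} \<and> (\<forall>J\<in>D. T ` J = S ` i \<and> monotone_map_on J T)"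
        using wind[OF True] ..
      moreover from this obtain J where "J \<in> D" by blast
      ultimately have D: "D division_of i" "J \<in> D" "T ` J = S ` i" by simp_all
      have "S x \<in> T ` J" using x(1) D(3) by blast
      then obtain z where "z \<in> J" "T z = S x" by (metis imageE)
      then have "z \<in> i" "T z \<in> interior j" using division_ofD(2)[OF D(1,2)] x by auto
      then have "fiber_count T i j > 0" using T.fiber_count_pos_iff[OF i j] by blast
      then show ?thesis using \<open>fiber_count S i j = 1\<close> by linarith
    qed simp
  qed
qed

section \<open>Recurrent nonnegative matrices\<close>

text \<open>The matrix notions are stated with infinite sums; as integrals over counting measure
  they are accessible to monotone convergence and to exchange of sums.\<close>

lemma infsum_ennreal_eq_nn_integral:
  fixes f :: "'a \<Rightarrow> ennreal"
  assumes "countable A"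
  shows "infsum f A = (\<integral>\<^sup>+x. f x \<partial>count_space A)"
proof (rule antisym)
  have sup: "infsum f A = (SUP F\<in>{F. finite F \<and> F \<subseteq> A}. sum f F)"
    by (rule nonneg_infsum_complete) simp
  show "infsum f A \<le> (\<integral>\<^sup>+x. f x \<partial>count_space A)"
    unfolding sup
  proof (rule SUP_least)
    fix F assume "F \<in> {F. finite F \<and> F \<subseteq> A}"
    then have F: "finite F" "F \<subseteq> A" by auto
    have "sum f F = (\<integral>\<^sup>+x. f x * indicator F x \<partial>count_space A)"
      using F by (subst nn_integral_count_space'[of F]) auto
    also have "\<dots> \<le> (\<integral>\<^sup>+x. f x \<partial>count_space A)"
      by (intro nn_integral_mono) (auto simp: indicator_def)
    finally show "sum f F \<le> (\<integral>\<^sup>+x. f x \<partial>count_space A)" .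
  qed
  show "(\<integral>\<^sup>+x. f x \<partial>count_space A) \<le> infsum f A"
  proof (cases "finite A")
    case True
    then show ?thesis by (simp add: nn_integral_count_space_finite)
  next
    case False
    then have bij: "bij_betw (from_nat_into A) UNIV A"
      by (rule bij_betw_from_nat_into[OF assms])
    have "(\<integral>\<^sup>+x. f x \<partial>count_space A) = (\<Sum>n. f (from_nat_into A n))"
      by (simp add: nn_integral_bij_count_space[OF bij, symmetric] nn_integral_count_space_nat)
    also have "\<dots> = (SUP n. \<Sum>k<n. f (from_nat_into A k))"
      by (rule suminf_eq_SUP)
    also have "\<dots> \<le> infsum f A"
    proof (rule SUP_least)
      fix n :: nat
      let ?F = "from_nat_into A ` {..<n}"
      have inj: "inj_on (from_nat_into A) {..<n}"
        using bij by (auto simp: bij_betw_def inj_on_def)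
      have "(\<Sum>k<n. f (from_nat_into A k)) = sum f ?F"
        by (simp add: sum.reindex[OF inj])
      also have "\<dots> \<le> (SUP F\<in>{F. finite F \<and> F \<subseteq> A}. sum f F)"
        using bij by (intro SUP_upper) (auto simp: bij_betw_def)
      finally show "(\<Sum>k<n. f (from_nat_into A k)) \<le> infsum f A" using sup by simp
    qed
    finally show ?thesis .
  qed
qed

lemma nn_integral_count_space_remove:
  fixes f :: "'a \<Rightarrow> ennreal"
  assumes "j \<in> A"
  shows "(\<integral>\<^sup>+x. f x \<partial>count_space A) = f j + (\<integral>\<^sup>+x. f x \<partial>count_space (A - {j}))"
proof -
  have "(\<integral>\<^sup>+x. f x \<partial>count_space A) = (\<integral>\<^sup>+x. f x * indicator {j} x + f x * indicator (A - {j}) x \<partial>count_space A)"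
    by (intro nn_integral_cong) (auto simp: indicator_def)
  also have "\<dots> = (\<integral>\<^sup>+x. f x * indicator {j} x \<partial>count_space A) + (\<integral>\<^sup>+x. f x * indicator (A - {j}) x \<partial>count_space A)"
    by (rule nn_integral_add) auto
  also have "(\<integral>\<^sup>+x. f x * indicator {j} x \<partial>count_space A) = f j"
    using assms by (subst nn_integral_count_space'[of "{j}"]) auto
  also have "(\<integral>\<^sup>+x. f x * indicator (A - {j}) x \<partial>count_space A) = (\<integral>\<^sup>+x. f x \<partial>count_space (A - {j}))"
    by (subst nn_integral_count_space_indicator, simp, subst (2) nn_integral_count_space_indicator)
      (auto intro!: nn_integral_cong simp: indicator_def)
  finally show ?thesis .
qed

section \<open>Renewal theory for a nonnegative matrix\<close>

locale countable_matrix =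
  fixes A :: "'a set" and M :: "'a \<Rightarrow> 'a \<Rightarrow> ennreal"
  assumes countable_index: "countable A"
begin

abbreviation "mp \<equiv> mat_pow A M"
abbreviation "fe \<equiv> first_entrance A M"

lemma mp_Suc: "mp (Suc n) i j = (\<integral>\<^sup>+\<alpha>. M i \<alpha> * mp n \<alpha> j \<partial>count_space A)"
  by (simp add: infsum_ennreal_eq_nn_integral[OF countable_index])

lemma fe_Suc_Suc: "fe (Suc (Suc n)) i j = (\<integral>\<^sup>+\<alpha>. M i \<alpha> * fe (Suc n) \<alpha> j \<partial>count_space (A - {j}))"
  by (simp only: first_entrance.simps infsum_ennreal_eq_nn_integral[OF countable_Diff[OF countable_index]])

text \<open>Renewal equation: paths to \<open>j\<close> are split at their first visit to
  \<open>j\<close>. The induction peels off the first step, which goes either to \<open>j\<close> or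
  to some \<open>\<alpha> \<noteq> j\<close>.\<close>

lemma first_entrance_decomposition:
  assumes j: "j \<in> A"
  shows "mp (Suc n) i j = (\<Sum>k\<le>n. fe (Suc k) i j * mp (n - k) j j)"
proof (induction n arbitrary: i)
  case 0
  have "mp (Suc 0) i j = M i j"
    unfolding mp_Suc using j by (subst nn_integral_count_space'[of "{j}"]) auto
  then show ?case by simp
next
  case (Suc n)
  have "mp (Suc (Suc n)) i j = M i j * mp (Suc n) j j +
      (\<integral>\<^sup>+\<alpha>. M i \<alpha> * mp (Suc n) \<alpha> j \<partial>count_space (A - {j}))"
    by (subst mp_Suc) (rule nn_integral_count_space_remove[OF j])
  also have "(\<integral>\<^sup>+\<alpha>. M i \<alpha> * mp (Suc n) \<alpha> j \<partial>count_space (A - {j})) =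
      (\<integral>\<^sup>+\<alpha>. (\<Sum>k\<le>n. M i \<alpha> * fe (Suc k) \<alpha> j * mp (n - k) j j) \<partial>count_space (A - {j}))"
    unfolding Suc.IH by (simp add: sum_distrib_left mult.assoc)
  also have "\<dots> = (\<Sum>k\<le>n. fe (Suc (Suc k)) i j * mp (n - k) j j)"
    by (subst nn_integral_sum, simp) (simp only: fe_Suc_Suc nn_integral_multc borel_measurable_count_space)
  also have "M i j * mp (Suc n) j j + (\<Sum>k\<le>n. fe (Suc (Suc k)) i j * mp (n - k) j j) =
      (\<Sum>k\<le>Suc n. fe (Suc k) i j * mp (Suc n - k) j j)"
    by (subst sum.atMost_Suc_shift) simp
  finally show ?case .
qed

definition green :: "'a \<Rightarrow> ennreal \<Rightarrow> ennreal" where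
  "green j z = (\<Sum>n. mp n j j * z ^ n)"

definition entrance :: "'a \<Rightarrow> 'a \<Rightarrow> ennreal \<Rightarrow> ennreal" where
  "entrance i j z = (\<Sum>n. fe (Suc n) i j * z ^ Suc n)"

lemma first_entrance_series_eq: "first_entrance_series A M i j z = entrance i j z"
proof -
  have bij: "bij_betw Suc UNIV {1..}"
    by (rule bij_betwI[of _ _ _ "\<lambda>n. n - 1"]) auto
  have "first_entrance_series A M i j z = (\<integral>\<^sup>+n. fe n i j * z ^ n \<partial>count_space {1..})"
    unfolding first_entrance_series_def by (rule infsum_ennreal_eq_nn_integral) simp
  also have "\<dots> = (\<integral>\<^sup>+n. fe (Suc n) i j * z ^ Suc n \<partial>count_space UNIV)"
    by (rule nn_integral_bij_count_space[OF bij, symmetric])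
  also have "\<dots> = entrance i j z"
    unfolding entrance_def by (rule nn_integral_count_space_nat)
  finally show ?thesis .
qed

lemma green_term_Suc:
  assumes j: "j \<in> A"
  shows "mp (Suc n) j j * z ^ Suc n = (\<Sum>k\<le>n. (fe (Suc k) j j * z ^ Suc k) * (mp (n - k) j j * z ^ (n - k)))"
  unfolding first_entrance_decomposition[OF j] sum_distrib_right
proof (rule sum.cong[OF refl])
  fix k assume "k \<in> {..n}"
  then have "Suc n = Suc k + (n - k)" by simp
  then have "z ^ Suc n = z ^ Suc k * z ^ (n - k)" by (metis power_add)
  then show "fe (Suc k) j j * mp (n - k) j j * z ^ Suc n =
      (fe (Suc k) j j * z ^ Suc k) * (mp (n - k) j j * z ^ (n - k))"
    by (simp only: mult_ac)
qed

text \<open>Finite form of the identity \<open>G = 1 + F * G\<close>. Bounding the triangle by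
  rectangles from inside and from outside gives the two halves of the recurrence criterion without
  subtracting infinite values.\<close>

lemma renewal_sum:
  assumes j: "j \<in> A"
  shows "(\<Sum>n<Suc N. mp n j j * z ^ n) =
    1 + (\<Sum>(k, m)\<in>{(k, m). k + m < N}. (fe (Suc k) j j * z ^ Suc k) * (mp m j j * z ^ m))"
proof -
  have "(\<Sum>n<Suc N. mp n j j * z ^ n) = 1 + (\<Sum>n<N. mp (Suc n) j j * z ^ Suc n)"
    by (subst sum.lessThan_Suc_shift) simp
  also have "(\<Sum>n<N. mp (Suc n) j j * z ^ Suc n) =
      (\<Sum>n<N. \<Sum>k\<le>n. (fe (Suc k) j j * z ^ Suc k) * (mp (n - k) j j * z ^ (n - k)))"
    by (simp only: green_term_Suc[OF j])
  also have "\<dots> = (\<Sum>(k, m)\<in>{(k, m). k + m < N}. (fe (Suc k) j j * z ^ Suc k) * (mp m j j * z ^ m))"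
    by (rule sum.triangle_reindex[symmetric])
  finally show ?thesis .
qed

lemma finite_triangle: "finite {(k :: nat, m). k + m < N}"
  by (rule finite_subset[of _ "{..<N} \<times> {..<N}"]) auto

text \<open>In the limit \<open>G \<ge> 1 + F * G \<ge> 1 + G\<close>, which no finite
  \<open>G\<close> satisfies.\<close>

lemma renewal_divergence:
  assumes j: "j \<in> A" and F: "entrance j j z \<ge> 1"
  shows "green j z = \<infinity>"
proof (rule ccontr)
  let ?f = "\<lambda>k. fe (Suc k) j j * z ^ Suc k" and ?g = "\<lambda>m. mp m j j * z ^ m"
  assume fin: "green j z \<noteq> \<infinity>"
  \<comment> \<open>The rectangle \<open>K\<close> by \<open>L\<close> lies in the triangle
    \<open>k + m < K + L\<close>.\<close>
  have "1 + (\<Sum>k<K. ?f k) * (\<Sum>m<L. ?g m) \<le> green j z" for K L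
  proof -
    have "(\<Sum>k<K. ?f k) * (\<Sum>m<L. ?g m) = (\<Sum>(k, m)\<in>{..<K} \<times> {..<L}. ?f k * ?g m)"
      by (simp only: sum_product sum.cartesian_product)
    also have "\<dots> \<le> (\<Sum>(k, m)\<in>{(k, m). k + m < K + L}. ?f k * ?g m)"
      by (rule sum_mono2[OF finite_triangle]) auto
    finally have "1 + (\<Sum>k<K. ?f k) * (\<Sum>m<L. ?g m) \<le> (\<Sum>n<Suc (K + L). ?g n)"
      unfolding renewal_sum[OF j] by (rule add_left_mono)
    also have "\<dots> \<le> green j z"
      unfolding green_def by (rule sum_le_suminf) auto
    finally show ?thesis .
  qed
  then have "(\<lambda>L. 1 + (\<Sum>k<K. ?f k) * (\<Sum>m<L. ?g m)) L \<le> green j z" for K L by simp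
  moreover have "(\<Sum>m. ?g m) = (SUP L. \<Sum>m<L. ?g m)" by (rule suminf_eq_SUP)
  ultimately have "(SUP L. 1 + (\<Sum>k<K. ?f k) * (\<Sum>m<L. ?g m)) \<le> green j z" for K
    by (intro SUP_least) auto
  then have 1: "1 + (\<Sum>k<K. ?f k) * green j z \<le> green j z" for K
    unfolding green_def suminf_eq_SUP[of ?g] by (simp add: ennreal_SUP_add_right SUP_mult_left_ennreal)
  have "(SUP K. 1 + (\<Sum>k<K. ?f k) * green j z) \<le> green j z"
    using 1 by (intro SUP_least) auto
  then have "1 + entrance j j z * green j z \<le> green j z"
    unfolding entrance_def suminf_eq_SUP[of ?f] by (simp add: ennreal_SUP_add_right SUP_mult_right_ennreal)
  moreover have "1 * green j z \<le> entrance j j z * green j z" by (rule mult_right_mono[OF F]) simp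
  ultimately have "1 + green j z \<le> green j z"
    by (metis add_left_mono mult_1 order_trans)
  moreover have "green j z < 1 + green j z"
    using fin by (simp add: ennreal_add_left_cancel_less[of "green j z" 0 1, simplified] add.commute less_top)
  ultimately show False by simp
qed

text \<open>With \<open>F = r < 1\<close> the partial sums satisfy \<open>g \<le> 1 + r * g\<close>,
  hence are at most \<open>1 / (1 - r)\<close>; finiteness of the coefficients is what allows
  \<open>g\<close> to be cancelled.\<close>

lemma renewal_convergence:
  assumes j: "j \<in> A" and fin: "\<And>n. mp n j j \<noteq> \<infinity>" and z: "z \<noteq> \<infinity>" and F: "entrance j j z < 1"
  shows "green j z \<noteq> \<infinity>"
proof -
  let ?f = "\<lambda>k. fe (Suc k) j j * z ^ Suc k" and ?g = "\<lambda>m. mp m j j * z ^ m"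
  have gfin: "(\<Sum>n<N. ?g n) \<noteq> \<infinity>" for N
    using fin z by (simp add: ennreal_mult_eq_top_iff power_eq_top_ennreal)
  obtain r where r: "entrance j j z = ennreal r" "0 \<le> r" "r < 1"
    using F by (cases "entrance j j z") (auto simp: ennreal_less_one_iff)
  have bound: "(\<Sum>n<N. ?g n) \<le> ennreal (1 / (1 - r))" for N
  proof -
    obtain g where g: "(\<Sum>n<N. ?g n) = ennreal g" "0 \<le> g"
      using gfin[of N] by (cases "\<Sum>n<N. ?g n") auto
    have "(\<Sum>(k, m)\<in>{(k, m). k + m < N}. ?f k * ?g m) \<le> (\<Sum>(k, m)\<in>{..<N} \<times> {..<N}. ?f k * ?g m)"
      by (rule sum_mono2) auto
    also have "\<dots> = (\<Sum>k<N. ?f k) * (\<Sum>m<N. ?g m)"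
      by (simp only: sum_product sum.cartesian_product)
    also have "\<dots> \<le> entrance j j z * (\<Sum>m<N. ?g m)"
      unfolding entrance_def by (intro mult_right_mono sum_le_suminf) auto
    finally have "(\<Sum>n<Suc N. ?g n) \<le> 1 + entrance j j z * (\<Sum>m<N. ?g m)"
      unfolding renewal_sum[OF j] by (rule add_left_mono)
    moreover have "(\<Sum>n<N. ?g n) \<le> (\<Sum>n<Suc N. ?g n)" by (rule sum_mono2) auto
    ultimately have "ennreal g \<le> 1 + ennreal r * ennreal g" using g(1) r(1) by (metis order_trans)
    then have "ennreal g \<le> ennreal (1 + r * g)"
      using g r by (simp add: ennreal_plus ennreal_mult flip: ennreal_1)
    then have "g \<le> 1 + r * g" using g r by (subst (asm) ennreal_le_iff) auto
    then have "g * (1 - r) \<le> 1" by (simp add: algebra_simps)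
    then have "g \<le> 1 / (1 - r)" using r by (simp add: pos_le_divide_eq)
    then show ?thesis using g by (simp add: ennreal_leI)
  qed
  have "green j z \<le> ennreal (1 / (1 - r))"
    unfolding green_def suminf_eq_SUP using bound by (intro SUP_least) auto
  then show ?thesis by (metis ennreal_neq_top infinity_ennreal_def neq_top_trans)
qed

text \<open>Divergence of the Green series at \<open>R\<close> excludes \<open>F < 1\<close>.
  Convergence below \<open>R\<close> gives \<open>F < 1\<close> there, and polynomials are
  continuous, so every partial sum is at most 1 at \<open>R\<close> too.\<close>

lemma recurrent_entrance:
  assumes j: "j \<in> A" and fin: "\<And>n. mp n j j \<noteq> \<infinity>" and R: "R > 0"
    and div: "green j (ennreal R) = \<infinity>" and conv: "\<And>z. 0 < z \<Longrightarrow> z < R \<Longrightarrow> green j (ennreal z) \<noteq> \<infinity>"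
  shows "entrance j j (ennreal R) = 1"
proof (rule antisym)
  show "entrance j j (ennreal R) \<ge> 1"
    using renewal_convergence[OF j fin, of "ennreal R"] div by (force simp: not_le[symmetric])
  have fe_fin: "fe (Suc k) j j \<noteq> \<infinity>" for k
  proof -
    have "fe (Suc k) j j * mp (k - k) j j \<le> (\<Sum>m\<le>k. fe (Suc m) j j * mp (k - m) j j)"
      by (rule member_le_sum) auto
    then have "fe (Suc k) j j \<le> mp (Suc k) j j" unfolding first_entrance_decomposition[OF j] by simp
    then show ?thesis using fin[of "Suc k"] by (metis infinity_ennreal_def neq_top_trans)
  qed
  define a where "a k = enn2real (fe (Suc k) j j)" for k
  have a: "fe (Suc k) j j = ennreal (a k)" "0 \<le> a k" for k
    using fe_fin[of k] by (simp_all add: a_def less_top)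
  have part: "(\<Sum>k<K. fe (Suc k) j j * ennreal z ^ Suc k) = ennreal (\<Sum>k<K. a k * z ^ Suc k)" if "z \<ge> 0" for z K
    using that a by (simp add: ennreal_power ennreal_mult[symmetric] del: power_Suc)
  have "(\<Sum>k<K. a k * z ^ Suc k) \<le> 1" if z: "0 < z" "z < R" for z K
  proof -
    have "entrance j j (ennreal z) < 1"
      using renewal_divergence[OF j] conv[OF z] by (metis not_le)
    then have "(\<Sum>k<K. fe (Suc k) j j * ennreal z ^ Suc k) \<le> 1"
    proof -
      have "(\<Sum>k<K. fe (Suc k) j j * ennreal z ^ Suc k) \<le> entrance j j (ennreal z)"
        unfolding entrance_def by (rule sum_le_suminf) auto
      then show ?thesis using \<open>entrance j j (ennreal z) < 1\<close> by (metis order_trans order_less_imp_le)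
    qed
    then show ?thesis using part[of z K] z by (simp add: ennreal_le_1 del: power_Suc)
  qed
  note le1 = this
  have ev: "eventually (\<lambda>z. 0 < z \<and> z < R) (at_left R)"
    using R eventually_at_left_field by blast
  have "(\<Sum>k<K. a k * R ^ Suc k) \<le> 1" for K
  proof (rule tendsto_upperbound)
    show "((\<lambda>z. \<Sum>k<K. a k * z ^ Suc k) \<longlongrightarrow> (\<Sum>k<K. a k * R ^ Suc k)) (at_left R)"
      by (intro tendsto_intros)
    show "\<forall>\<^sub>F z in at_left R. (\<Sum>k<K. a k * z ^ Suc k) \<le> 1"
      using ev by (rule eventually_mono) (use le1 in blast)
  qed simp
  then have "(\<Sum>k<K. fe (Suc k) j j * ennreal R ^ Suc k) \<le> 1" for K
    using part[of R K] R by (simp add: ennreal_le_1 del: power_Suc)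
  then show "entrance j j (ennreal R) \<le> 1"
    unfolding entrance_def suminf_eq_SUP by (intro SUP_least) auto
qed

text \<open>Peeling off the first step leaves \<open>R\<close> times a sum whose term for
  \<open>\<alpha> = j\<close> is \<open>M i j\<close> alone, without an entrance factor. Since that
  factor would be \<open>F j j = 1\<close>, the sum is the full matrix product.\<close>

lemma entrance_eigenvector:
  assumes j: "j \<in> A" and one: "entrance j j R = 1"
  shows "R * (\<integral>\<^sup>+\<alpha>. M i \<alpha> * entrance \<alpha> j R \<partial>count_space A) = entrance i j R"
proof -
  have "entrance i j R = (\<Sum>n. fe (Suc (Suc n)) i j * R ^ Suc (Suc n)) + fe (Suc 0) i j * R ^ Suc 0"
    unfolding entrance_def by (subst suminf_offset[of _ 1]) (simp_all add: add.commute)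
  also have "(\<Sum>n. fe (Suc (Suc n)) i j * R ^ Suc (Suc n)) =
      (\<Sum>n. \<integral>\<^sup>+\<alpha>. R * (M i \<alpha> * (fe (Suc n) \<alpha> j * R ^ Suc n)) \<partial>count_space (A - {j}))"
  proof (rule suminf_cong)
    fix n
    have "(\<integral>\<^sup>+\<alpha>. R * (M i \<alpha> * (fe (Suc n) \<alpha> j * R ^ Suc n)) \<partial>count_space (A - {j})) =
      (\<integral>\<^sup>+\<alpha>. (M i \<alpha> * fe (Suc n) \<alpha> j) * R ^ Suc (Suc n) \<partial>count_space (A - {j}))"
      by (intro nn_integral_cong) (simp add: mult_ac)
    also have "\<dots> = fe (Suc (Suc n)) i j * R ^ Suc (Suc n)"
      by (simp only: fe_Suc_Suc nn_integral_multc borel_measurable_count_space)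
    finally show "fe (Suc (Suc n)) i j * R ^ Suc (Suc n) =
      (\<integral>\<^sup>+\<alpha>. R * (M i \<alpha> * (fe (Suc n) \<alpha> j * R ^ Suc n)) \<partial>count_space (A - {j}))" by simp
  qed
  also have "\<dots> = (\<integral>\<^sup>+\<alpha>. (\<Sum>n. R * (M i \<alpha> * (fe (Suc n) \<alpha> j * R ^ Suc n))) \<partial>count_space (A - {j}))"
    by (rule nn_integral_suminf[symmetric]) simp
  also have "\<dots> = (\<integral>\<^sup>+\<alpha>. R * (M i \<alpha> * entrance \<alpha> j R) \<partial>count_space (A - {j}))"
    unfolding entrance_def by (simp only: ennreal_suminf_cmult)
  also have "\<dots> = R * (\<integral>\<^sup>+\<alpha>. M i \<alpha> * entrance \<alpha> j R \<partial>count_space (A - {j}))"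
    by (rule nn_integral_cmult) simp
  finally have "entrance i j R = R * (M i j * entrance j j R + (\<integral>\<^sup>+\<alpha>. M i \<alpha> * entrance \<alpha> j R \<partial>count_space (A - {j})))"
    using one by (simp add: distrib_left mult_ac add.commute)
  then show ?thesis using nn_integral_count_space_remove[OF j, of "\<lambda>\<alpha>. M i \<alpha> * entrance \<alpha> j R"] by simp
qed

text \<open>Finite sets \<open>F\<close> suffice, as the whole sum is their supremum, and they make
  the exchange with the sum over the first step immediate.\<close>

lemma iterated_supersolution:
  assumes super: "\<And>i. i \<in> A \<Longrightarrow> R * (\<integral>\<^sup>+\<alpha>. M i \<alpha> * u \<alpha> \<partial>count_space A) \<le> u i"
    and F: "finite F" "F \<subseteq> A" and i: "i \<in> A"
  shows "R ^ n * (\<Sum>\<alpha>\<in>F. mp n i \<alpha> * u \<alpha>) \<le> u i"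
  using i
proof (induction n arbitrary: i)
  case 0
  have "(\<Sum>\<alpha>\<in>F. (if i = \<alpha> then 1 else 0) * u \<alpha>) = (\<Sum>\<alpha>\<in>F. if i = \<alpha> then u i else 0)"
    by (intro sum.cong) auto
  also have "\<dots> \<le> u i" using F(1) by (simp add: sum.delta)
  finally show ?case by simp
next
  case (Suc n)
  have "(\<Sum>\<alpha>\<in>F. mp (Suc n) i \<alpha> * u \<alpha>) = (\<Sum>\<alpha>\<in>F. \<integral>\<^sup>+\<beta>. M i \<beta> * mp n \<beta> \<alpha> * u \<alpha> \<partial>count_space A)"
    by (simp only: mp_Suc nn_integral_multc borel_measurable_count_space)
  also have "\<dots> = (\<integral>\<^sup>+\<beta>. (\<Sum>\<alpha>\<in>F. M i \<beta> * mp n \<beta> \<alpha> * u \<alpha>) \<partial>count_space A)"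
    by (rule nn_integral_sum[symmetric]) simp
  also have "\<dots> = (\<integral>\<^sup>+\<beta>. M i \<beta> * (\<Sum>\<alpha>\<in>F. mp n \<beta> \<alpha> * u \<alpha>) \<partial>count_space A)"
    by (simp only: sum_distrib_left mult.assoc)
  finally have "R ^ Suc n * (\<Sum>\<alpha>\<in>F. mp (Suc n) i \<alpha> * u \<alpha>) =
      R * (R ^ n * (\<integral>\<^sup>+\<beta>. M i \<beta> * (\<Sum>\<alpha>\<in>F. mp n \<beta> \<alpha> * u \<alpha>) \<partial>count_space A))"
    by (simp only: power_Suc mult.assoc)
  also have "R ^ n * (\<integral>\<^sup>+\<beta>. M i \<beta> * (\<Sum>\<alpha>\<in>F. mp n \<beta> \<alpha> * u \<alpha>) \<partial>count_space A) =
      (\<integral>\<^sup>+\<beta>. M i \<beta> * (R ^ n * (\<Sum>\<alpha>\<in>F. mp n \<beta> \<alpha> * u \<alpha>)) \<partial>count_space A)"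
    by (subst nn_integral_cmult[symmetric]) (simp_all add: mult_ac)
  also have "R * \<dots> \<le> R * (\<integral>\<^sup>+\<beta>. M i \<beta> * u \<beta> \<partial>count_space A)"
    by (intro mult_left_mono nn_integral_mono) (use Suc.IH in \<open>simp_all add: mult_left_mono\<close>)
  also have "\<dots> \<le> u i" using super[OF Suc.prems] .
  finally show ?case .
qed

text \<open>Entrance series are the minimal nonnegative solutions, so a supersolution on the
  complement of \<open>A'\<close> that dominates them where \<open>A'\<close> is entered dominates them throughout.\<close>

lemma entrance_le_supersolution:
  assumes j: "j \<in> A'" "A' \<subseteq> A" and one: "entrance j j R = 1"
    and super: "\<And>i. i \<in> A - A' \<Longrightarrow> R * (\<integral>\<^sup>+\<alpha>. M i \<alpha> * v \<alpha> \<partial>count_space A) \<le> v i"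
    and entry: "\<And>i \<alpha>. i \<in> A - A' \<Longrightarrow> \<alpha> \<in> A' \<Longrightarrow> M i \<alpha> \<noteq> 0 \<Longrightarrow> entrance \<alpha> j R \<le> C * v \<alpha>"
    and i: "i \<in> A - A'"
  shows "entrance i j R \<le> C * v i"
proof -
  have jA: "j \<in> A" using j by blast
  \<comment> \<open>Truncated entrance series satisfy a one-step recursion, so the comparison can
    run by induction on the length \<open>N\<close>.\<close>
  define F where "F N i = (\<Sum>k<N. fe (Suc k) i j * R ^ Suc k)" for N i
  have F_le: "F N \<alpha> \<le> entrance \<alpha> j R" for N \<alpha>
    unfolding F_def entrance_def by (rule sum_le_suminf) auto
  have F_Suc: "F (Suc N) i = R * (M i j + (\<integral>\<^sup>+\<alpha>. M i \<alpha> * F N \<alpha> \<partial>count_space (A - {j})))" for N i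
  proof -
    have "F (Suc N) i = M i j * R + (\<Sum>k<N. fe (Suc (Suc k)) i j * R ^ Suc (Suc k))"
      unfolding F_def by (subst sum.lessThan_Suc_shift) simp
    also have "(\<Sum>k<N. fe (Suc (Suc k)) i j * R ^ Suc (Suc k)) =
        (\<Sum>k<N. \<integral>\<^sup>+\<alpha>. (M i \<alpha> * fe (Suc k) \<alpha> j) * R ^ Suc (Suc k) \<partial>count_space (A - {j}))"
      by (simp only: fe_Suc_Suc nn_integral_multc borel_measurable_count_space)
    also have "\<dots> = (\<integral>\<^sup>+\<alpha>. (\<Sum>k<N. (M i \<alpha> * fe (Suc k) \<alpha> j) * R ^ Suc (Suc k)) \<partial>count_space (A - {j}))"
      by (rule nn_integral_sum[symmetric]) simp
    also have "\<dots> = (\<integral>\<^sup>+\<alpha>. R * (M i \<alpha> * F N \<alpha>) \<partial>count_space (A - {j}))"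
      unfolding F_def sum_distrib_left by (intro nn_integral_cong sum.cong) (simp_all add: mult_ac)
    also have "\<dots> = R * (\<integral>\<^sup>+\<alpha>. M i \<alpha> * F N \<alpha> \<partial>count_space (A - {j}))"
      by (rule nn_integral_cmult) simp
    finally show ?thesis by (simp add: distrib_left mult_ac)
  qed
  have "F N i \<le> C * v i" if "i \<in> A - A'" for N i
    using that
  proof (induction N arbitrary: i)
    case 0
    then show ?case by (simp add: F_def)
  next
    case (Suc N)
    \<comment> \<open>The direct step into \<open>j\<close> carries no factor \<open>v\<close>; as
      \<open>j\<close> is in \<open>A'\<close> and \<open>F j j = 1\<close>, the entry condition at
      \<open>j\<close> reads \<open>1 \<le> C * v j\<close>.\<close>
    have entry_j: "M i j \<le> M i j * (C * v j)"
    proof (cases "M i j = 0")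
      case False
      then have "1 \<le> C * v j" using entry[OF Suc.prems j(1)] one by simp
      then have "M i j * 1 \<le> M i j * (C * v j)" by (rule mult_left_mono) simp
      then show ?thesis by simp
    qed simp
    have le: "M i \<alpha> * F N \<alpha> \<le> M i \<alpha> * (C * v \<alpha>)" if \<alpha>: "\<alpha> \<in> A - {j}" for \<alpha>
    proof (cases "\<alpha> \<in> A'")
      case True
      show ?thesis
      proof (cases "M i \<alpha> = 0")
        case False
        then have "F N \<alpha> \<le> C * v \<alpha>" using entry[OF Suc.prems True] F_le[of N \<alpha>] by (metis order_trans)
        then show ?thesis by (rule mult_left_mono) simp
      qed simp
    next
      case False
      then have "F N \<alpha> \<le> C * v \<alpha>" using Suc.IH \<alpha> by blast
      then show ?thesis by (rule mult_left_mono) simp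
    qed
    have "F (Suc N) i \<le> R * (M i j * (C * v j) + (\<integral>\<^sup>+\<alpha>. M i \<alpha> * (C * v \<alpha>) \<partial>count_space (A - {j})))"
    proof -
      have "(\<integral>\<^sup>+\<alpha>. M i \<alpha> * F N \<alpha> \<partial>count_space (A - {j})) \<le> (\<integral>\<^sup>+\<alpha>. M i \<alpha> * (C * v \<alpha>) \<partial>count_space (A - {j}))"
        by (rule nn_integral_mono) (use le in simp)
      then show ?thesis unfolding F_Suc by (intro mult_left_mono[OF add_mono[OF entry_j]]) simp_all
    qed
    also have "\<dots> = R * (\<integral>\<^sup>+\<alpha>. M i \<alpha> * (C * v \<alpha>) \<partial>count_space A)"
      using nn_integral_count_space_remove[OF jA, of "\<lambda>\<alpha>. M i \<alpha> * (C * v \<alpha>)"] by simp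
    also have "(\<integral>\<^sup>+\<alpha>. M i \<alpha> * (C * v \<alpha>) \<partial>count_space A) = (\<integral>\<^sup>+\<alpha>. C * (M i \<alpha> * v \<alpha>) \<partial>count_space A)"
      by (intro nn_integral_cong) (simp add: mult_ac)
    also have "\<dots> = C * (\<integral>\<^sup>+\<alpha>. M i \<alpha> * v \<alpha> \<partial>count_space A)"
      by (rule nn_integral_cmult) simp
    also have "R * (C * (\<integral>\<^sup>+\<alpha>. M i \<alpha> * v \<alpha> \<partial>count_space A)) = C * (R * (\<integral>\<^sup>+\<alpha>. M i \<alpha> * v \<alpha> \<partial>count_space A))"
      by (simp add: mult_ac)
    also have "\<dots> \<le> C * v i" using super[OF Suc.prems] by (rule mult_left_mono) simp
    finally show ?case .
  qed
  then show ?thesis using i unfolding entrance_def F_def suminf_eq_SUP by (intro SUP_least) auto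
qed

text \<open>The radius is positive and finite: at 0 the entrance series vanishes, and at
  \<open>\<infinity>\<close> it is 0 or infinite, while recurrence says that it equals 1. The Green
  series then diverges at \<open>R\<close> by \<open>renewal_divergence\<close>.\<close>

lemma recurrent_matrixE:
  assumes "recurrent_matrix A M" and fin: "\<And>i n. i \<in> A \<Longrightarrow> mp n i i \<noteq> \<infinity>"
  obtains i R where "i \<in> A" "0 < R" "green i (ennreal R) = \<infinity>"
    "\<And>z. 0 < z \<Longrightarrow> z < R \<Longrightarrow> green i (ennreal z) \<noteq> \<infinity>"
proof -
  define a where "a i n = enn2real (mp n i i)" for i n
  obtain i where i: "i \<in> A" and F: "entrance i i (e2ennreal (conv_radius (a i))) = 1"
    using assms(1) unfolding recurrent_matrix_def power_radius_def first_entrance_series_eq a_def by blast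
  have a: "mp n i i = ennreal (a i n)" "0 \<le> a i n" for n
    using fin[OF i, of n] by (simp_all add: a_def less_top)
  have ne0: "conv_radius (a i) \<noteq> 0"
  proof
    assume "conv_radius (a i) = 0"
    then show False using F by (simp add: entrance_def e2ennreal_neg)
  qed
  have neinf: "conv_radius (a i) \<noteq> \<infinity>"
  proof
    assume inf: "conv_radius (a i) = \<infinity>"
    have F': "entrance i i \<infinity> = 1" using F inf by (simp add: e2ennreal_infty)
    show False
    proof (cases "\<forall>n. fe (Suc n) i i = 0")
      case True
      then show False using F' by (simp add: entrance_def)
    next
      case False
      then obtain n where "fe (Suc n) i i \<noteq> 0" by blast
      then have "fe (Suc n) i i * \<infinity> ^ Suc n = \<infinity>"
        by (simp add: ennreal_mult_eq_top_iff power_top_ennreal del: first_entrance.simps)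
      moreover have "(\<Sum>k\<in>{n}. fe (Suc k) i i * \<infinity> ^ Suc k) \<le> entrance i i \<infinity>"
        unfolding entrance_def by (rule sum_le_suminf) auto
      ultimately show False using F' by (simp add: top_unique)
    qed
  qed
  obtain R where R: "conv_radius (a i) = ereal R" "R > 0"
    using ne0 neinf conv_radius_nonneg[of "a i"] by (cases "conv_radius (a i)") auto
  show ?thesis
  proof (rule that[OF i R(2)])
    show "green i (ennreal R) = \<infinity>"
      using F R by (intro renewal_divergence[OF i]) (simp add: e2ennreal_ereal)
    show "green i (ennreal z) \<noteq> \<infinity>" if z: "0 < z" "z < R" for z
    proof -
      have "summable (\<lambda>n. a i n * z ^ n)"
        by (rule summable_in_conv_radius) (use z R in simp)
      then have "(\<Sum>n. ennreal (a i n * z ^ n)) \<noteq> top"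
        using a z by (intro ennreal_suminf_neq_top) auto
      moreover have "mp n i i * ennreal z ^ n = ennreal (a i n * z ^ n)" for n
        using a z by (simp add: ennreal_mult ennreal_power)
      ultimately show ?thesis unfolding green_def by simp
    qed
  qed
qed

end

section \<open>Powers of the transition matrix\<close>

lemma nn_integral_count_space_least:
  fixes f :: "'a \<Rightarrow> ennreal"
  assumes "countable A" "\<And>F. finite F \<Longrightarrow> F \<subseteq> A \<Longrightarrow> sum f F \<le> c"
  shows "(\<integral>\<^sup>+x. f x \<partial>count_space A) \<le> c"
proof -
  have "infsum f A = (SUP F\<in>{F. finite F \<and> F \<subseteq> A}. sum f F)"
    by (rule nonneg_infsum_complete) simp
  also have "\<dots> \<le> c" using assms(2) by (intro SUP_least) auto
  finally show ?thesis using infsum_ennreal_eq_nn_integral[OF assms(1), of f] by simp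
qed

text \<open>A shift of the coefficients costs only the factor \<open>z ^ p\<close>, so for
  \<open>z \<noteq> 0\<close> divergence passes from \<open>a\<close> to \<open>b\<close> at the
  same \<open>z\<close>.\<close>

lemma shifted_series_le:
  fixes a b :: "nat \<Rightarrow> ennreal"
  assumes "\<And>n. a n \<le> b (n + p)"
  shows "z ^ p * (\<Sum>n. a n * z ^ n) \<le> (\<Sum>n. b n * z ^ n)"
proof -
  have "z ^ p * (\<Sum>n. a n * z ^ n) = (\<Sum>n. a n * z ^ (n + p))"
    by (subst ennreal_suminf_cmult[symmetric]) (simp add: power_add mult_ac)
  also have "\<dots> \<le> (\<Sum>n. b (n + p) * z ^ (n + p))"
    by (intro suminf_le mult_right_mono assms) auto
  also have "\<dots> \<le> (\<Sum>n. b (n + p) * z ^ (n + p)) + (\<Sum>n<p. b n * z ^ n)" by simp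
  also have "\<dots> = (\<Sum>n. b n * z ^ n)" by (rule suminf_offset[symmetric]) simp
  finally show ?thesis .
qed

context mixing_system
begin

text \<open>Matrix multiplication in terms of fibres: the points of \<open>i\<close> sent to
  \<open>y\<close> in \<open>n + 1\<close> steps are sorted by their first image, which is generic
  and so interior to exactly one element.\<close>

lemma fiber_count_Suc:
  assumes i: "i \<in> P" and j: "j \<in> P"
  shows "(\<integral>\<^sup>+\<alpha>. of_nat (fiber_count T i \<alpha>) * of_nat (fiber_count (T ^^ n) \<alpha> j) \<partial>count_space P) =
    (of_nat (fiber_count (T ^^ Suc n) i j) :: ennreal)"
proof -
  obtain y where y: "y \<in> interior j" using elementE[OF j] by (metis dense greaterThanLessThan_iff)
  define X where "X = {x\<in>i. (T ^^ Suc n) x = y}"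
  have step: "(T ^^ Suc n) x = (T ^^ n) (T x)" for x by (simp only: funpow_Suc_right comp_apply)
  have finX: "finite X" and cardX: "card X = fiber_count (T ^^ Suc n) i j"
    using fiber_finite[OF i j y, of "Suc n"] fiber_card[OF i j y, of "Suc n"] by (simp_all only: X_def)
  define Z where "Z = T ` X"
  have finZ: "finite Z" using finX by (simp add: Z_def)
  have Zint: "\<exists>\<alpha>\<in>P. z \<in> interior \<alpha>" if "z \<in> Z" for z
  proof -
    obtain x where x: "x \<in> i" "(T ^^ n) (T x) = y" "z = T x" using \<open>z \<in> Z\<close> step by (auto simp: Z_def X_def)
    have "z \<in> {0..1}" using x element_subset[OF i] maps_point by blast
    moreover have "z \<notin> B"
      using boundary_map.boundary_invariant[OF iterate, of z n] interior_not_boundary[OF j y] x by auto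
    ultimately show ?thesis using not_boundaryE by blast
  qed
  then obtain el where el: "\<And>z. z \<in> Z \<Longrightarrow> el z \<in> P \<and> z \<in> interior (el z)" by metis
  \<comment> \<open>Only the finitely many elements containing a first image contribute; for all
    others one of the two factors is 0.\<close>
  define A0 where "A0 = el ` Z"
  have A0: "finite A0" "A0 \<subseteq> P" using finZ el by (auto simp: A0_def)
  define Zf where "Zf \<alpha> = {z\<in>\<alpha>. (T ^^ n) z = y}" for \<alpha>
  have Zf_card: "card (Zf \<alpha>) = fiber_count (T ^^ n) \<alpha> j" "finite (Zf \<alpha>)" if "\<alpha> \<in> P" for \<alpha>
    using fiber_card[OF that j y] fiber_finite[OF that j y] by (simp_all add: Zf_def)
  have Zf_int: "z \<in> interior \<alpha>" if "\<alpha> \<in> P" "z \<in> Zf \<alpha>" for z \<alpha>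
    by (rule boundary_map.fiber_interior[OF iterate that(1) j, of z n]) (use that y in \<open>simp_all add: Zf_def\<close>)
  have in_Z: "z \<in> Z" if z: "\<alpha> \<in> P" "z \<in> Zf \<alpha>" "fiber_count T i \<alpha> > 0" for z \<alpha>
  proof -
    have "card {x\<in>i. T x = z} > 0" using fiber_count_eq[OF i z(1) Zf_int[OF z(1,2)]] z(3) by simp
    then obtain x where "x \<in> i" "T x = z" by (auto simp: card_gt_0_iff)
    then show ?thesis using z(2) step by (auto simp: Z_def X_def Zf_def)
  qed
  have in_A0: "\<alpha> \<in> A0" if a: "\<alpha> \<in> P" "fiber_count T i \<alpha> > 0" "fiber_count (T ^^ n) \<alpha> j > 0" for \<alpha>
  proof -
    have "Zf \<alpha> \<noteq> {}" using Zf_card[OF a(1)] a(3) by force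
    then obtain z where z: "z \<in> Zf \<alpha>" by blast
    then have "z \<in> Z" using in_Z a by blast
    moreover have "el z = \<alpha>" using el[OF \<open>z \<in> Z\<close>] interior_disjoint_unique[of "el z" \<alpha> z] Zf_int[OF a(1) z] a(1) by blast
    ultimately show ?thesis by (auto simp: A0_def)
  qed
  have pos: "fiber_count T i \<alpha> > 0" if aA0: "\<alpha> \<in> A0" for \<alpha>
  proof -
    obtain z where z: "z \<in> Z" "\<alpha> = el z" using aA0 by (auto simp: A0_def)
    then obtain x where "x \<in> i" "T x = z" by (auto simp: Z_def X_def)
    then show ?thesis using fiber_count_pos_iff[OF i, of \<alpha>] el[OF z(1)] z by blast
  qed
  have Zeq: "Z = (\<Union>\<alpha>\<in>A0. Zf \<alpha>)"
  proof
    show "(\<Union>\<alpha>\<in>A0. Zf \<alpha>) \<subseteq> Z" using in_Z pos A0 by blast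
    show "Z \<subseteq> (\<Union>\<alpha>\<in>A0. Zf \<alpha>)"
    proof
      fix z assume z: "z \<in> Z"
      then obtain x where "x \<in> X" "z = T x" by (auto simp: Z_def)
      then have "(T ^^ n) z = y" using step by (simp add: X_def)
      then have "z \<in> Zf (el z)" using el[OF z] interior_subset by (auto simp: Zf_def)
      then show "z \<in> (\<Union>\<alpha>\<in>A0. Zf \<alpha>)" using z by (auto simp: A0_def)
    qed
  qed
  have "card X = (\<Sum>z\<in>Z. card {x\<in>X. T x = z})"
    using sum.image_gen[OF finX, of "\<lambda>_. 1::nat" T] by (simp add: Z_def)
  also have "\<dots> = (\<Sum>z\<in>Z. card {x\<in>i. T x = z})"
  proof (rule sum.cong[OF refl])
    fix z assume "z \<in> Z"
    then have "(T ^^ n) z = y" using step by (auto simp: Z_def X_def)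
    then have "{x\<in>X. T x = z} = {x\<in>i. T x = z}" using step by (auto simp: X_def)
    then show "card {x\<in>X. T x = z} = card {x\<in>i. T x = z}" by simp
  qed
  also have "\<dots> = (\<Sum>\<alpha>\<in>A0. \<Sum>z\<in>Zf \<alpha>. card {x\<in>i. T x = z})"
    unfolding Zeq
  proof (rule sum.UNION_disjoint[OF A0(1)])
    show "\<forall>\<alpha>\<in>A0. finite (Zf \<alpha>)" using Zf_card A0 by blast
    show "\<forall>\<alpha>\<in>A0. \<forall>\<beta>\<in>A0. \<alpha> \<noteq> \<beta> \<longrightarrow> Zf \<alpha> \<inter> Zf \<beta> = {}"
      using Zf_int A0 interior_disjoint_unique by blast
  qed
  also have "\<dots> = (\<Sum>\<alpha>\<in>A0. fiber_count T i \<alpha> * fiber_count (T ^^ n) \<alpha> j)"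
  proof (rule sum.cong[OF refl])
    fix \<alpha> assume "\<alpha> \<in> A0"
    then have a: "\<alpha> \<in> P" using A0 by blast
    have "(\<Sum>z\<in>Zf \<alpha>. card {x\<in>i. T x = z}) = (\<Sum>z\<in>Zf \<alpha>. fiber_count T i \<alpha>)"
      using fiber_count_eq[OF i a] Zf_int[OF a] by (intro sum.cong) auto
    then show "(\<Sum>z\<in>Zf \<alpha>. card {x\<in>i. T x = z}) = fiber_count T i \<alpha> * fiber_count (T ^^ n) \<alpha> j"
      using Zf_card[OF a] by simp
  qed
  finally have main: "card X = (\<Sum>\<alpha>\<in>A0. fiber_count T i \<alpha> * fiber_count (T ^^ n) \<alpha> j)" .
  have "(\<integral>\<^sup>+\<alpha>. of_nat (fiber_count T i \<alpha>) * of_nat (fiber_count (T ^^ n) \<alpha> j) \<partial>count_space P) =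
    (\<Sum>\<alpha>\<in>A0. of_nat (fiber_count T i \<alpha>) * of_nat (fiber_count (T ^^ n) \<alpha> j) :: ennreal)"
  proof (rule nn_integral_count_space'[OF A0(1) _ A0(2)])
    fix \<alpha> assume "\<alpha> \<in> P" "\<alpha> \<notin> A0"
    then have "fiber_count T i \<alpha> = 0 \<or> fiber_count (T ^^ n) \<alpha> j = 0" using in_A0[of \<alpha>] by blast
    then show "of_nat (fiber_count T i \<alpha>) * of_nat (fiber_count (T ^^ n) \<alpha> j) = (0::ennreal)" by auto
  qed
  also have "\<dots> = of_nat (card X)" unfolding main by simp
  finally show ?thesis using cardX by simp
qed

lemma fiber_count_zero:
  assumes i: "i \<in> P" and j: "j \<in> P"
  shows "fiber_count (T ^^ 0) i j = (if i = j then 1 else 0)"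
proof -
  obtain y where y: "y \<in> interior j" using elementE[OF j] by (metis dense greaterThanLessThan_iff)
  have c: "card {x\<in>i. x = y} = fiber_count (T ^^ 0) i j" using fiber_card[OF i j y, of 0] by simp
  show ?thesis
  proof (cases "i = j")
    case True
    then have "{x\<in>i. x = y} = {y}" using y interior_subset by blast
    then show ?thesis using c True by simp
  next
    case False
    then have e: "{x\<in>i. x = y} = {}" using interior_disjoint_element[OF i j] y by blast
    have "fiber_count (T ^^ 0) i j = 0" using c[symmetric] by (simp only: e card.empty)
    then show ?thesis using False by simp
  qed
qed

lemma mat_pow_fiber_count:
  assumes M: "\<And>i j. i \<in> P \<Longrightarrow> j \<in> P \<Longrightarrow> M i j = of_nat (fiber_count T i j)"
    and ij: "i \<in> P" "j \<in> P"
  shows "mat_pow P M n i j = of_nat (fiber_count (T ^^ n) i j)"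
  using ij
proof (induction n arbitrary: i)
  case 0
  then show ?case by (simp only: mat_pow.simps fiber_count_zero) simp
next
  case (Suc n)
  have "mat_pow P M (Suc n) i j = (\<integral>\<^sup>+\<alpha>. M i \<alpha> * mat_pow P M n \<alpha> j \<partial>count_space P)"
    by (simp add: infsum_ennreal_eq_nn_integral[OF countable_family])
  also have "\<dots> = (\<integral>\<^sup>+\<alpha>. of_nat (fiber_count T i \<alpha>) * of_nat (fiber_count (T ^^ n) \<alpha> j) \<partial>count_space P)"
    by (rule nn_integral_cong) (use Suc M in simp)
  also have "\<dots> = of_nat (fiber_count (T ^^ Suc n) i j)" by (rule fiber_count_Suc[OF Suc.prems])
  finally show ?case .
qed

end

text \<open>The partition that witnesses recurrence may differ from \<open>P\<close>. Comparing the
  return counts in both directions transfers divergence at \<open>R\<close> and convergence below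
  \<open>R\<close>.\<close>

lemma recurrent_map_series:
  assumes T: "T \<in> cpmm" "recurrent_map T" and sys: "mixing_system P T" and j: "j \<in> P"
  obtains R where "R > 0" "(\<Sum>n. of_nat (fiber_count (T ^^ n) j j) * ennreal R ^ n) = \<infinity>"
    "\<And>z. 0 < z \<Longrightarrow> z < R \<Longrightarrow> (\<Sum>n. of_nat (fiber_count (T ^^ n) j j) * ennreal z ^ n) \<noteq> \<infinity>"
proof -
  obtain Q where Q: "markov_partition T Q" "recurrent_matrix Q (transition_matrix T)"
    using T(2) unfolding recurrent_map_def by blast
  have sysQ: "mixing_system Q T"
    using T(1) Q(1) by (intro markov_partition_imp_mixing_system) (simp_all add: cpmm_def)
  interpret Q: mixing_system Q T by (rule sysQ)
  interpret M: countable_matrix Q "transition_matrix T" by unfold_locales (rule Q.countable_family)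
  have mp: "mat_pow Q (transition_matrix T) n i k = of_nat (fiber_count (T ^^ n) i k)" if "i \<in> Q" "k \<in> Q" for n i k
    by (rule Q.mat_pow_fiber_count[OF _ that]) (simp add: transition_matrix_def Q.transition_number_eq_fiber_count)
  have fin: "mat_pow Q (transition_matrix T) n i i \<noteq> \<infinity>" if "i \<in> Q" for i n
    using mp[OF that that] by simp
  obtain i R where i: "i \<in> Q" and R: "0 < R" and div: "M.green i (ennreal R) = \<infinity>"
    and conv: "\<And>z. 0 < z \<Longrightarrow> z < R \<Longrightarrow> M.green i (ennreal z) \<noteq> \<infinity>"
    by (rule M.recurrent_matrixE[OF Q(2) fin]) auto
  have green: "M.green i z = (\<Sum>n. of_nat (fiber_count (T ^^ n) i i) * z ^ n)" for z
    unfolding M.green_def by (simp add: mp[OF i i])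
  let ?d = "\<lambda>n. of_nat (fiber_count (T ^^ n) j j) :: ennreal"
  let ?c = "\<lambda>n. of_nat (fiber_count (T ^^ n) i i) :: ennreal"
  obtain p where "\<forall>n. fiber_count (T ^^ n) i i \<le> fiber_count (T ^^ (n + p)) j j"
    using fiber_count_compare[OF sys sysQ i j] by blast
  then have p: "?c n \<le> ?d (n + p)" for n by simp
  obtain q where "\<forall>n. fiber_count (T ^^ n) j j \<le> fiber_count (T ^^ (n + q)) i i"
    using fiber_count_compare[OF sysQ sys j i] by blast
  then have q: "?d n \<le> ?c (n + q)" for n by simp
  show ?thesis
  proof (rule that[OF R])
    have "ennreal R ^ p * \<infinity> \<le> (\<Sum>n. ?d n * ennreal R ^ n)"
      using shifted_series_le[of ?c ?d p "ennreal R", OF p] div green by simp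
    moreover have "ennreal R \<noteq> 0" using R by simp
    ultimately show "(\<Sum>n. ?d n * ennreal R ^ n) = \<infinity>"
      by (simp add: ennreal_mult_top top_unique)
    show "(\<Sum>n. ?d n * ennreal z ^ n) \<noteq> \<infinity>" if z: "0 < z" "z < R" for z
    proof
      assume inf: "(\<Sum>n. ?d n * ennreal z ^ n) = \<infinity>"
      have "ennreal z ^ q * \<infinity> \<le> M.green i (ennreal z)"
        using shifted_series_le[of ?d ?c q "ennreal z", OF q] inf green by simp
      moreover have "ennreal z \<noteq> 0" using z by simp
      ultimately show False using conv[OF z] by (simp add: ennreal_mult_top top_unique)
    qed
  qed
qed

section \<open>Entropy\<close>

text \<open>A polynomial factor does not affect the growth rate; the square leaves room for the
  choice of a separation time and of an entry time.\<close>

lemma h_top_le: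
  assumes mu: "\<mu> \<ge> 1"
    and bound: "\<And>\<epsilon>. \<epsilon> > 0 \<Longrightarrow> \<exists>K. \<forall>n\<ge>1. \<forall>E. separated_set T n \<epsilon> E \<longrightarrow> real (card E) \<le> K * (real n)\<^sup>2 * \<mu> ^ n"
  shows "h_top T \<le> ereal (ln \<mu>)"
  unfolding h_top_def
proof (rule SUP_least)
  fix \<epsilon> :: real assume "\<epsilon> \<in> {0<..}"
  then obtain K where K: "\<And>n E. n \<ge> 1 \<Longrightarrow> separated_set T n \<epsilon> E \<Longrightarrow> real (card E) \<le> K * (real n)\<^sup>2 * \<mu> ^ n"
    using bound[of \<epsilon>] by auto
  \<comment> \<open>\<open>L \<ge> 1\<close> makes the logarithms in the bound nonnegative, which
    also covers the empty set with \<open>ln 0 = 0\<close>.\<close>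
  define L where "L = max K 1"
  define b where "b n = ln L / real n + 2 * (ln (real n) / real n) + ln \<mu>" for n
  have "b \<longlonglongrightarrow> 0 + 2 * 0 + ln \<mu>"
    unfolding b_def by (intro tendsto_intros lim_const_over_n lim_ln_over_n)
  then have lim: "(\<lambda>n. ereal (b n)) \<longlonglongrightarrow> ereal (ln \<mu>)" by simp
  have le: "(SUP E\<in>{E. separated_set T n \<epsilon> E}. ereal (ln (real (card E)) / real n)) \<le> ereal (b n)"
    if n: "n \<ge> 1" for n
  proof (rule SUP_least)
    fix E assume "E \<in> {E. separated_set T n \<epsilon> E}"
    then have E: "real (card E) \<le> K * (real n)\<^sup>2 * \<mu> ^ n" using K n by blast
    have n0: "real n \<ge> 1" using n by simp
    have pos: "1 \<le> (real n)\<^sup>2" "1 \<le> \<mu> ^ n" "1 \<le> L" using n0 mu by (simp_all add: one_le_power L_def)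
    have "K * (real n)\<^sup>2 * \<mu> ^ n \<le> L * (real n)\<^sup>2 * \<mu> ^ n"
      using pos by (intro mult_right_mono) (simp_all add: L_def)
    then have le: "real (card E) \<le> L * (real n)\<^sup>2 * \<mu> ^ n" using E by linarith
    have ln_eq: "ln (L * (real n)\<^sup>2 * \<mu> ^ n) = ln L + 2 * ln (real n) + real n * ln \<mu>"
      using pos n0 mu by (simp add: ln_mult ln_realpow)
    have "ln (real (card E)) \<le> ln L + 2 * ln (real n) + real n * ln \<mu>"
    proof (cases "card E = 0")
      case True
      then show ?thesis using pos n0 mu by simp
    next
      case False
      then have "ln (real (card E)) \<le> ln (L * (real n)\<^sup>2 * \<mu> ^ n)" using le by (intro ln_mono) auto
      then show ?thesis using ln_eq by simp
    qed
    then have "ln (real (card E)) / real n \<le> (ln L + 2 * ln (real n) + real n * ln \<mu>) / real n"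
      using n0 by (intro divide_right_mono) auto
    also have "\<dots> = b n" using n0 by (simp add: b_def field_simps)
    finally show "ereal (ln (real (card E)) / real n) \<le> ereal (b n)" by simp
  qed
  have "limsup (\<lambda>n. SUP E\<in>{E. separated_set T n \<epsilon> E}. ereal (ln (real (card E)) / real n)) \<le> limsup (\<lambda>n. ereal (b n))"
    by (rule Limsup_mono) (use le in \<open>auto simp: eventually_sequentially intro!: exI[of _ 1]\<close>)
  also have "\<dots> = ereal (ln \<mu>)" using lim by (intro lim_imp_Limsup) simp_all
  finally show "limsup (\<lambda>n. SUP E\<in>{E. separated_set T n \<epsilon> E}. ereal (ln (real (card E)) / real n)) \<le> ereal (ln \<mu>)" .
qed

text \<open>Separated sets along the multiples of \<open>m\<close> are enough, since a
  \<open>limsup\<close> dominates the \<open>limsup\<close> of any subsequence.\<close>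

lemma h_top_ge:
  assumes eps: "\<epsilon> > 0" and m: "m \<ge> 1" and r: "r \<ge> 1"
    and sep: "\<And>k. \<exists>E. separated_set T (m * k) \<epsilon> E \<and> card E = r ^ k"
  shows "h_top T \<ge> ereal (ln (real r) / real m)"
proof -
  let ?X = "\<lambda>n. SUP E\<in>{E. separated_set T n \<epsilon> E}. ereal (ln (real (card E)) / real n)"
  \<comment> \<open>\<open>Suc k\<close> avoids the time 0, where the quotient in
    \<open>h_top\<close> divides by 0.\<close>
  define s where "s k = m * Suc k" for k
  have "strict_mono s" using m by (auto simp: s_def strict_mono_def)
  have X: "ereal (ln (real r) / real m) \<le> (?X \<circ> s) k" for k
  proof -
    obtain E where E: "separated_set T (m * Suc k) \<epsilon> E" "card E = r ^ Suc k" using sep by blast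
    have e1: "ln (real (card E)) = ln (real r) * real (Suc k)"
      using r by (simp add: E(2) ln_realpow del: power_Suc of_nat_Suc)
    have e2: "real (s k) = real m * real (Suc k)" unfolding s_def by (rule of_nat_mult)
    have "ln (real (card E)) / real (s k) = ln (real r) / real m"
      unfolding e1 e2 by (rule mult_divide_mult_cancel_right) simp
    then have "ereal (ln (real r) / real m) = ereal (ln (real (card E)) / real (s k))" by simp
    also have "\<dots> \<le> ?X (s k)" using E(1) by (intro SUP_upper) (simp add: s_def)
    finally show ?thesis by simp
  qed
  have "ereal (ln (real r) / real m) \<le> limsup (?X \<circ> s)"
    by (rule le_Limsup) (use X in \<open>simp_all add: always_eventually\<close>)
  also have "\<dots> \<le> limsup ?X" by (rule limsup_subseq_mono[OF \<open>strict_mono s\<close>])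
  also have "\<dots> \<le> h_top T" unfolding h_top_def by (rule SUP_upper) (use eps in simp)
  finally show ?thesis .
qed

text \<open>Each separated set is pulled back into every \<open>K x\<close> by
  \<open>T ^^ m\<close>: points in different pieces are apart at time 0, points in one piece are
  separated once \<open>m\<close> further steps have passed.\<close>

lemma horseshoe_separated:
  fixes T :: "real \<Rightarrow> real"
  assumes X: "finite X" and I: "I \<noteq> {}" "I \<subseteq> {0..1}"
    and K: "\<And>x. x \<in> X \<Longrightarrow> K x \<subseteq> I" "\<And>x. x \<in> X \<Longrightarrow> I \<subseteq> (T ^^ m) ` K x"
    and sep: "\<And>x x' s t. x \<in> X \<Longrightarrow> x' \<in> X \<Longrightarrow> x \<noteq> x' \<Longrightarrow> s \<in> K x \<Longrightarrow> t \<in> K x' \<Longrightarrow> dist s t > \<epsilon>"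
    and eps: "\<epsilon> > 0" and m: "m \<ge> 1"
  shows "\<exists>E. E \<subseteq> I \<and> separated_set T (m * k) \<epsilon> E \<and> card E = card X ^ k"
proof (induction k)
  case 0
  obtain x where "x \<in> I" using I by blast
  then show ?case using I by (intro exI[of _ "{x}"]) (auto simp: separated_set_def)
next
  case (Suc k)
  then obtain E where E: "E \<subseteq> I" "separated_set T (m * k) \<epsilon> E" "card E = card X ^ k" by blast
  have finE: "finite E" using E(2) by (simp add: separated_set_def)
  have "\<exists>z. z \<in> K x \<and> (T ^^ m) z = e" if "x \<in> X" "e \<in> E" for x e
    using K(2)[OF that(1)] that(2) E(1) by (metis imageE subsetD)
  then obtain g where g: "\<And>x e. x \<in> X \<Longrightarrow> e \<in> E \<Longrightarrow> g x e \<in> K x \<and> (T ^^ m) (g x e) = e" by metis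
  define E' where "E' = (\<lambda>(x, e). g x e) ` (X \<times> E)"
  have inj: "inj_on (\<lambda>(x, e). g x e) (X \<times> E)"
  proof (rule inj_onI)
    fix v w assume vw: "v \<in> X \<times> E" "w \<in> X \<times> E" "(\<lambda>(x, e). g x e) v = (\<lambda>(x, e). g x e) w"
    obtain x e x' e' where eq: "v = (x, e)" "w = (x', e')" by (cases v, cases w) auto
    then have in': "x \<in> X" "e \<in> E" "x' \<in> X" "e' \<in> E" "g x e = g x' e'" using vw by auto
    have "e = e'" using g[OF in'(1,2)] g[OF in'(3,4)] in'(5) by metis
    moreover have "x = x'"
    proof (rule ccontr)
      assume "x \<noteq> x'"
      then have "dist (g x e) (g x' e') > \<epsilon>"
        using sep[of x x' "g x e" "g x' e'"] g[OF in'(1,2)] g[OF in'(3,4)] in' by blast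
      then show False using in'(5) eps by simp
    qed
    ultimately show "v = w" using eq by simp
  qed
  have "card E' = card X ^ Suc k"
    unfolding E'_def card_image[OF inj] card_cartesian_product E(3) by simp
  moreover have sub: "E' \<subseteq> I"
  proof
    fix z assume "z \<in> E'"
    then obtain x e where "x \<in> X" "e \<in> E" "z = g x e" by (auto simp: E'_def)
    then show "z \<in> I" using g[of x e] K(1)[of x] by blast
  qed
  moreover have "separated_set T (m * Suc k) \<epsilon> E'"
    unfolding separated_set_def
  proof (intro conjI ballI impI)
    show "finite E'" using finE X by (simp add: E'_def)
    show "E' \<subseteq> {0..1}" using sub I by blast
    fix z z' assume zz: "z \<in> E'" "z' \<in> E'" "z \<noteq> z'"
    obtain x e where z: "x \<in> X" "e \<in> E" "z = g x e" using zz by (auto simp: E'_def)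
    obtain x' e' where z': "x' \<in> X" "e' \<in> E" "z' = g x' e'" using zz by (auto simp: E'_def)
    show "\<exists>t<m * Suc k. dist ((T ^^ t) z) ((T ^^ t) z') > \<epsilon>"
    proof (cases "x = x'")
      case False
      then have "dist z z' > \<epsilon>" using sep[of x x' z z'] g z z' by blast
      then show ?thesis using m by (intro exI[of _ 0]) simp
    next
      case True
      then have "e \<noteq> e'" using zz z z' by blast
      then obtain t where t: "t < m * k" "dist ((T ^^ t) e) ((T ^^ t) e') > \<epsilon>"
        using E(2) z z' unfolding separated_set_def by blast
      have "(T ^^ (t + m)) z = (T ^^ t) e" "(T ^^ (t + m)) z' = (T ^^ t) e'"
        using g z z' by (simp_all add: funpow_add)
      then show ?thesis using t by (intro exI[of _ "t + m"]) simp
    qed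
  qed
  ultimately show ?case by blast
qed

lemma finite_compact_separation:
  fixes K :: "'b \<Rightarrow> 'a :: heine_borel set"
  assumes X: "finite X" and K: "\<And>x. x \<in> X \<Longrightarrow> compact (K x)"
    and disj: "\<And>x x'. x \<in> X \<Longrightarrow> x' \<in> X \<Longrightarrow> x \<noteq> x' \<Longrightarrow> K x \<inter> K x' = {}"
  shows "\<exists>\<epsilon>>0. \<forall>x\<in>X. \<forall>x'\<in>X. x \<noteq> x' \<longrightarrow> (\<forall>s\<in>K x. \<forall>t\<in>K x'. dist s t > \<epsilon>)"
proof -
  have "\<exists>d>0. \<forall>s\<in>K x. \<forall>t\<in>K x'. d \<le> dist s t" if "x \<in> X" "x' \<in> X" "x \<noteq> x'" for x x'
    by (rule separate_compact_closed[OF K[OF that(1)] compact_imp_closed[OF K[OF that(2)]] disj[OF that]])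
  then obtain d where d: "\<And>x x'. x \<in> X \<Longrightarrow> x' \<in> X \<Longrightarrow> x \<noteq> x' \<Longrightarrow> d x x' > 0 \<and> (\<forall>s\<in>K x. \<forall>t\<in>K x'. d x x' \<le> dist s t)"
    by metis
  \<comment> \<open>The 1 keeps \<open>D\<close> nonempty when there are no two distinct indices;
    half of its minimum gives a strict inequality.\<close>
  define D where "D = insert 1 ((\<lambda>(x, x'). d x x') ` {(x, x'). x \<in> X \<and> x' \<in> X \<and> x \<noteq> x'})"
  have "{(x, x'). x \<in> X \<and> x' \<in> X \<and> x \<noteq> x'} \<subseteq> X \<times> X" by auto
  then have "finite {(x, x'). x \<in> X \<and> x' \<in> X \<and> x \<noteq> x'}" by (rule finite_subset) (simp add: X)
  then have fin: "finite D" by (simp add: D_def)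
  then have min: "Min D \<in> D" by (intro Min_in) (auto simp: D_def)
  have pos: "Min D > 0" using min d by (auto simp: D_def)
  have "dist s t > Min D / 2" if h: "x \<in> X" "x' \<in> X" "x \<noteq> x'" "s \<in> K x" "t \<in> K x'" for x x' s t
  proof -
    have "d x x' \<in> D" using h by (auto simp: D_def)
    then have "Min D \<le> d x x'" using fin by simp
    also have "\<dots> \<le> dist s t" using d[OF h(1-3)] h by blast
    finally show ?thesis using pos by linarith
  qed
  then show ?thesis using pos by (intro exI[of _ "Min D / 2"]) auto
qed

section \<open>Entropy and the growth of fibre counts\<close>

context mixing_system
begin

text \<open>Neighbouring branches may share an end, so they are cut down to the preimages of the
  compact hull \<open>{lo..hi}\<close> of the fibre, which lies in the interior of \<open>j\<close>.
  The two extreme branches may leave the hull and are discarded; hence the loss of 2.\<close>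

lemma horseshoe_entropy:
  assumes j: "j \<in> P" and m: "m \<ge> 1" and N: "fiber_count (T ^^ m) j j \<ge> 3"
  shows "h_top T \<ge> ereal (ln (real (fiber_count (T ^^ m) j j - 2)) / real m)"
proof -
  interpret f: boundary_map P "T ^^ m" by (rule iterate)
  let ?f = "T ^^ m"
  obtain c d where cd: "0 \<le> c" "c < d" "d \<le> 1" "j = {c..d}" "interior j = {c<..<d}" using elementE[OF j] .
  obtain y where "c < y" "y < d" using dense[OF cd(2)] by blast
  then have y: "y \<in> interior j" using cd by simp
  define X where "X = {x\<in>j. ?f x = y}"
  have fin: "finite X" and card: "card X = fiber_count ?f j j"
    using fiber_finite[OF j j y] fiber_card[OF j j y] by (simp_all add: X_def)
  have "X \<noteq> {}" using card N by auto
  define lo hi where "lo = Min X" and "hi = Max X"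
  have lohi: "lo \<in> X" "hi \<in> X" "\<And>x. x \<in> X \<Longrightarrow> lo \<le> x \<and> x \<le> hi"
    using fin \<open>X \<noteq> {}\<close> by (simp_all add: lo_def hi_def)
  have Xint: "x \<in> interior j" if "x \<in> X" for x
    by (rule f.fiber_interior[OF j j]) (use that y in \<open>simp_all add: X_def\<close>)
  define X' where "X' = X - {lo, hi}"
  have card': "card X' = fiber_count ?f j j - 2"
  proof (cases "lo = hi")
    case True
    have "X \<subseteq> {lo}" using lohi(3) True by force
    then have "card X \<le> 1" using card_mono[of "{lo}" X] by simp
    then show ?thesis using card N by simp
  next
    case False
    then show ?thesis using lohi fin card by (simp add: X'_def card_Diff_subset)
  qed
  define W where "W x p q \<longleftrightarrow> p < x \<and> x < q \<and> lo \<le> p \<and> q \<le> hi \<and> inj_on ?f {p..q} \<and> {p..q} \<subseteq> j \<and>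
      ?f p \<notin> interior j \<and> ?f q \<notin> interior j \<and> ?f ` {p<..<q} \<subseteq> interior j \<and> interior j \<subseteq> ?f ` {p<..<q}" for x p q
  have "\<exists>p q. W x p q" if x: "x \<in> X'" for x
  proof -
    have xX: "x \<in> X" "x \<noteq> lo" "x \<noteq> hi" using x by (auto simp: X'_def)
    have "x \<in> j" "?f x \<in> interior j" using xX y by (auto simp: X_def)
    from f.branch[OF j j this] obtain p q where pq: "p < x" "x < q" "{p..q} \<subseteq> j" "inj_on ?f {p..q}"
      "?f p \<notin> interior j" "?f q \<notin> interior j" "?f ` {p<..<q} \<subseteq> interior j" "interior j \<subseteq> ?f ` {p<..<q}" by metis
    have out: "z \<notin> {p..q}" if "z \<in> X" "z \<noteq> x" for z
    proof
      assume "z \<in> {p..q}"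
      moreover have "x \<in> {p..q}" "?f z = ?f x" using pq that xX by (auto simp: X_def)
      ultimately show False using pq(4) that(2) by (metis inj_onD)
    qed
    have "lo \<notin> {p..q}" "hi \<notin> {p..q}" using out lohi xX by auto
    moreover have "lo \<le> x" "x \<le> hi" using lohi(3) xX by auto
    ultimately have "lo \<le> p" "q \<le> hi" using pq(1,2) by auto
    then have "W x p q" using pq by (simp add: W_def)
    then show ?thesis by blast
  qed
  then obtain p q where W: "\<And>x. x \<in> X' \<Longrightarrow> W x (p x) (q x)" by metis
  define I where "I = {lo..hi}"
  have Iint: "I \<subseteq> interior j" using Xint[OF lohi(1)] Xint[OF lohi(2)] cd by (auto simp: I_def)
  define K where "K x = {p x..q x} \<inter> ?f -` I" for x
  have K_open: "K x \<subseteq> {p x<..<q x}" if "x \<in> X'" for x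
  proof
    fix t assume t: "t \<in> K x"
    then have "?f t \<in> interior j" using Iint by (auto simp: K_def)
    then have "t \<noteq> p x" "t \<noteq> q x" using W[OF that] by (auto simp: W_def)
    then show "t \<in> {p x<..<q x}" using t by (auto simp: K_def)
  qed
  have comp: "compact (K x)" if x: "x \<in> X'" for x
  proof -
    have "{p x..q x} \<subseteq> j" using W[OF x] by (simp add: W_def)
    then have "{p x..q x} \<subseteq> {0..1}" using element_subset[OF j] by blast
    then have "closed (K x)"
      unfolding K_def I_def
      by (intro continuous_closed_preimage continuous_on_subset[OF iterate_cont] closed_atLeastAtMost)
    moreover have "bounded (K x)" by (auto simp: K_def bounded_Int)
    ultimately show ?thesis by (simp add: compact_eq_bounded_closed)
  qed
  have disj: "K x \<inter> K x' = {}" if xx: "x \<in> X'" "x' \<in> X'" "x \<noteq> x'" for x x'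
  proof (rule ccontr)
    assume "K x \<inter> K x' \<noteq> {}"
    then obtain t where t: "t \<in> {p x<..<q x}" "t \<in> {p x'<..<q x'}" using K_open[OF xx(1)] K_open[OF xx(2)] by blast
    have "p x = p x' \<and> q x = q x'"
      by (rule f.branches_disjoint[of "p x" "q x" "interior j" "p x'" "q x'" t])
        (use W[OF xx(1)] W[OF xx(2)] t in \<open>simp_all add: W_def\<close>)
    then have m: "x \<in> {p x..q x}" "x' \<in> {p x..q x}" using W[OF xx(1)] W[OF xx(2)] by (simp_all add: W_def)
    have i: "inj_on ?f {p x..q x}" and e: "?f x = ?f x'" using W[OF xx(1)] xx by (simp_all add: W_def X'_def X_def)
    show False using inj_onD[OF i e m] xx(3) by simp
  qed
  have finX': "finite X'" using fin by (simp add: X'_def)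
  obtain \<epsilon> where eps: "\<epsilon> > 0" "\<forall>x\<in>X'. \<forall>x'\<in>X'. x \<noteq> x' \<longrightarrow> (\<forall>s\<in>K x. \<forall>t\<in>K x'. dist s t > \<epsilon>)"
    using finite_compact_separation[where K=K and X=X', OF finX' comp disj] by blast
  have KI: "K x \<subseteq> I" if "x \<in> X'" for x
    using K_open[OF that] W[OF that] by (auto simp: W_def I_def)
  have cover: "I \<subseteq> ?f ` K x" if "x \<in> X'" for x
  proof
    fix z assume z: "z \<in> I"
    then have "z \<in> ?f ` {p x<..<q x}" using Iint W[OF that] by (auto simp: W_def)
    then obtain t where "t \<in> {p x<..<q x}" "z = ?f t" by blast
    then show "z \<in> ?f ` K x" using z by (auto simp: K_def)
  qed
  have "lo \<in> I" using lohi by (auto simp: I_def)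
  moreover have "I \<subseteq> {0..1}" using Iint interior_subset element_subset[OF j] by blast
  ultimately have "\<exists>E. separated_set T (m * k) \<epsilon> E \<and> card E = card X' ^ k" for k
    using horseshoe_separated[where X=X' and I=I and K=K and T=T and m=m and \<epsilon>=\<epsilon> and k=k] finX' KI cover eps m by blast
  then show ?thesis
    using h_top_ge[where r="card X'" and T=T, OF eps(1) m] card' N by auto
qed

text \<open>Horseshoes lose two branches, but for large \<open>n\<close> the count minus 2 is at
  least a third of \<open>\<mu> ^ n\<close>, and \<open>ln 3 / n\<close> tends to 0.\<close>

lemma entropy_lower_bound:
  assumes j: "j \<in> P" and mu: "\<mu> > 1" and inf: "\<And>N. \<exists>n\<ge>N. real (fiber_count (T ^^ n) j j) \<ge> \<mu> ^ n"
  shows "h_top T \<ge> ereal (ln \<mu>)"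
proof (rule ccontr)
  assume "\<not> h_top T \<ge> ereal (ln \<mu>)"
  then have "h_top T < ereal (ln \<mu>)" by simp
  then obtain h where h: "h_top T < ereal h" "ereal h < ereal (ln \<mu>)" by (rule ereal_dense2[THEN exE]) auto
  have "(\<lambda>n. ln \<mu> - ln 3 / real n) \<longlonglongrightarrow> ln \<mu> - 0"
    by (intro tendsto_intros lim_const_over_n)
  then have "eventually (\<lambda>n. h < ln \<mu> - ln 3 / real n) sequentially"
    using h by (intro order_tendstoD(1)) auto
  then obtain N1 where N1: "\<And>n. n \<ge> N1 \<Longrightarrow> h < ln \<mu> - ln 3 / real n"
    by (auto simp: eventually_sequentially)
  obtain N2 where N2: "3 < \<mu> ^ N2" using real_arch_pow[OF mu] by blast
  obtain n where n: "n \<ge> max (max N1 N2) 1" "real (fiber_count (T ^^ n) j j) \<ge> \<mu> ^ n" using inf by blast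
  have n': "n \<ge> N1" "n \<ge> N2" "n \<ge> 1" using n by auto
  have "\<mu> ^ N2 \<le> \<mu> ^ n" using n' mu by (intro power_increasing) auto
  then have c: "real (fiber_count (T ^^ n) j j) > 3" and p3: "\<mu> ^ n > 3" using N2 n by linarith+
  let ?c = "fiber_count (T ^^ n) j j"
  have c3: "?c \<ge> 3" using c by linarith
  have "real (?c - 2) = real ?c - 2" using c3 by simp
  then have "\<mu> ^ n / 3 \<le> real (?c - 2)" using n(2) p3 by linarith
  then have "ln (\<mu> ^ n / 3) \<le> ln (real (?c - 2))" using mu by (intro ln_mono) auto
  moreover have "ln (\<mu> ^ n / 3) = real n * ln \<mu> - ln 3" using mu by (simp add: ln_div ln_realpow)
  ultimately have "(real n * ln \<mu> - ln 3) / real n \<le> ln (real (?c - 2)) / real n"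
    by (intro divide_right_mono) auto
  moreover have "(real n * ln \<mu> - ln 3) / real n = ln \<mu> - ln 3 / real n" using n' by (simp add: field_simps)
  ultimately have "h < ln (real (?c - 2)) / real n" using N1[OF n'(1)] by linarith
  then have "ereal h \<le> h_top T" using horseshoe_entropy[OF j n'(3) c3] by (meson ereal_less_eq(3) order_less_imp_le order_trans)
  then show False using h(1) by simp
qed

text \<open>One generic point is taken in each of \<open>N\<close> equal slots shorter than
  \<open>\<epsilon> / 2\<close>; an interval longer than \<open>\<epsilon>\<close> contains a whole
  slot.\<close>

lemma dense_generic_points:
  assumes "\<epsilon> > 0"
  obtains Y where "finite Y" "Y \<subseteq> {0..1} - B"
    "\<And>s t. 0 \<le> s \<Longrightarrow> t \<le> 1 \<Longrightarrow> t - s > \<epsilon> \<Longrightarrow> \<exists>y\<in>Y. s < y \<and> y < t"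
proof -
  obtain N :: nat where N: "2 / \<epsilon> < real N" using reals_Archimedean2 by blast
  have N0: "real N > 0" using N assms by (meson divide_pos_pos less_trans zero_less_numeral)
  then have NN: "2 / real N < \<epsilon>" using N assms by (simp add: field_simps)
  have "\<exists>y. real l / real N < y \<and> y < (real l + 1) / real N \<and> y \<in> {0..1} - B" if l: "l < N" for l
  proof -
    have "real l + 1 \<le> real N" using l by linarith
    then have "0 \<le> real l / real N" "real l / real N < (real l + 1) / real N" "(real l + 1) / real N \<le> 1"
      using N0 by (simp_all add: divide_simps)
    then obtain i y where "i \<in> P" "y \<in> interior i" "real l / real N < y" "y < (real l + 1) / real N"
      using interval_meets_interior by metis
    then show ?thesis using interior_not_boundary[of i y] interior_unit[of i y] by auto
  qed
  then obtain y where y: "\<And>l. l < N \<Longrightarrow> real l / real N < y l \<and> y l < (real l + 1) / real N \<and> y l \<in> {0..1} - B"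
    by metis
  show ?thesis
  proof (rule that[of "y ` {..<N}"])
    show "finite (y ` {..<N})" by simp
    show "y ` {..<N} \<subseteq> {0..1} - B" using y by blast
    show "\<exists>z\<in>y ` {..<N}. s < z \<and> z < t" if st: "0 \<le> s" "t \<le> 1" "t - s > \<epsilon>" for s t
    proof -
      define l where "l = nat \<lceil>s * real N\<rceil>"
      have "0 \<le> s * real N" using st N0 by simp
      then have l: "s * real N \<le> real l" "real l < s * real N + 1"
        unfolding l_def by linarith+
      have "2 < \<epsilon> * real N" using NN N0 by (simp add: field_simps)
      also have "\<dots> < (t - s) * real N" using st N0 by simp
      finally have "real l + 1 < t * real N" using l by (simp add: algebra_simps)
      moreover have "t * real N \<le> real N" using st N0 by simp
      ultimately have lN: "l < N" by linarith
      have "s \<le> real l / real N" using l N0 by (simp add: field_simps)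
      moreover have "(real l + 1) / real N \<le> t" using \<open>real l + 1 < t * real N\<close> N0 by (simp add: field_simps)
      ultimately have "s < y l" "y l < t" using y[OF lN] by linarith+
      then show ?thesis using lN by blast
    qed
  qed
qed

text \<open>Some iterate stretches the gap between neighbouring separated points over a generic point,
  so separated points are counted by preimages of finitely many generic points.\<close>

lemma card_separated_le:
  assumes a: "0 \<le> a" "b \<le> 1" and E: "finite E" "E \<subseteq> {a..b}"
    and sep: "\<And>x x'. x \<in> E \<Longrightarrow> x' \<in> E \<Longrightarrow> x \<noteq> x' \<Longrightarrow> \<exists>k<n. dist ((T ^^ k) x) ((T ^^ k) x') > \<epsilon>"
    and Y: "finite Y" "\<And>s t. 0 \<le> s \<Longrightarrow> t \<le> 1 \<Longrightarrow> t - s > \<epsilon> \<Longrightarrow> \<exists>y\<in>Y. s < y \<and> y < t"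
    and fin: "\<And>k y. y \<in> Y \<Longrightarrow> finite {z\<in>{a..b}. (T ^^ k) z = y}"
  shows "card E \<le> 1 + (\<Sum>k<n. \<Sum>y\<in>Y. card {z\<in>{a..b}. (T ^^ k) z = y})"
proof (cases "E = {}")
  case False
  \<comment> \<open>The largest point has no right neighbour; it accounts for the summand 1 in the
    bound.\<close>
  define E' where "E' = E - {Max E}"
  define nx where "nx x = Min {x'\<in>E. x < x'}" for x
  have nx: "nx x \<in> E \<and> x < nx x \<and> (\<forall>x'\<in>E. x < x' \<longrightarrow> nx x \<le> x')" if x: "x \<in> E'" for x
  proof -
    have "x \<in> E" "x \<noteq> Max E" using x by (auto simp: E'_def)
    then have "x < Max E" using E(1) by (simp add: order_less_le)
    then have "Max E \<in> {x'\<in>E. x < x'}" using E(1) False by simp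
    then have ne: "{x'\<in>E. x < x'} \<noteq> {}" by blast
    have "nx x \<in> {x'\<in>E. x < x'}" unfolding nx_def using E(1) ne by (intro Min_in) auto
    then show ?thesis unfolding nx_def using E(1) by auto
  qed
  define V where "V x z k y \<longleftrightarrow> k < n \<and> y \<in> Y \<and> x < z \<and> z < nx x \<and> (T ^^ k) z = y" for x z k y
  have "\<exists>z k y. V x z k y" if x: "x \<in> E'" for x
  proof -
    have xE: "x \<in> E" using x by (simp add: E'_def)
    let ?x' = "nx x"
    have x': "?x' \<in> E" "x < ?x'" using nx[OF x] by auto
    obtain k where k: "k < n" "dist ((T ^^ k) x) ((T ^^ k) ?x') > \<epsilon>" using sep[OF xE x'(1)] x'(2) by auto
    let ?g = "T ^^ k"
    have unit: "x \<in> {0..1}" "?x' \<in> {0..1}" using xE x' E(2) a by auto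
    have g01: "?g x \<in> {0..1}" "?g ?x' \<in> {0..1}" using iterate_maps unit by auto
    have contg: "continuous_on {x..?x'} ?g"
      by (rule continuous_on_subset[OF iterate_cont]) (use unit in auto)
    show ?thesis
    proof (cases "?g x \<le> ?g ?x'")
      case True
      then have "?g ?x' - ?g x > \<epsilon>" using k by (simp add: dist_real_def)
      then obtain y where y: "y \<in> Y" "?g x < y" "y < ?g ?x'" using Y(2)[of "?g x" "?g ?x'"] g01 by auto
      obtain z where z: "x \<le> z" "z \<le> ?x'" "?g z = y" using IVT'[of ?g x y ?x'] y x' contg by auto
      then have "z \<noteq> x" "z \<noteq> ?x'" using y by auto
      then have "V x z k y" using z y k by (simp add: V_def order_less_le)
      then show ?thesis by blast
    next
      case False
      then have "?g x - ?g ?x' > \<epsilon>" using k by (simp add: dist_real_def)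
      then obtain y where y: "y \<in> Y" "?g ?x' < y" "y < ?g x" using Y(2)[of "?g ?x'" "?g x"] g01 by auto
      obtain z where z: "x \<le> z" "z \<le> ?x'" "?g z = y" using IVT2'[of ?g ?x' y x] y x' contg by auto
      then have "z \<noteq> x" "z \<noteq> ?x'" using y by auto
      then have "V x z k y" using z y k by (simp add: V_def order_less_le)
      then show ?thesis by blast
    qed
  qed
  then obtain h k y where "\<And>x. x \<in> E' \<Longrightarrow> V x (h x) (k x) (y x)" by metis
  note h = this[unfolded V_def]
  have lt: "h x < h x'" if "x \<in> E'" "x' \<in> E'" "x < x'" for x x'
  proof -
    have "x' \<in> E" using that by (simp add: E'_def)
    then have "nx x \<le> x'" using nx[OF that(1)] that(3) by blast
    then show ?thesis using h[OF that(1)] h[OF that(2)] by linarith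
  qed
  have inj: "inj_on h E'"
  proof (rule inj_onI)
    fix x x' assume "x \<in> E'" "x' \<in> E'" "h x = h x'"
    then show "x = x'" using lt[of x x'] lt[of x' x] by (cases x x' rule: linorder_cases) auto
  qed
  let ?U = "\<Union>k<n. \<Union>y\<in>Y. {z\<in>{a..b}. (T ^^ k) z = y}"
  have "h ` E' \<subseteq> ?U"
  proof
    fix z assume "z \<in> h ` E'"
    then obtain x where x: "x \<in> E'" "z = h x" by blast
    have "x \<in> E" "nx x \<in> E" using x nx[OF x(1)] by (auto simp: E'_def)
    then have "a \<le> x" "nx x \<le> b" using E(2) by auto
    then have "z \<in> {a..b}" using h[OF x(1)] x(2) by auto
    then have "z \<in> {z\<in>{a..b}. (T ^^ k x) z = y x}" using h[OF x(1)] x(2) by simp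
    moreover have "k x \<in> {..<n}" "y x \<in> Y" using h[OF x(1)] by simp_all
    ultimately show "z \<in> ?U" by blast
  qed
  moreover have "finite ?U" by (intro finite_UN_I finite_lessThan Y(1) fin)
  ultimately have "card E' \<le> card ?U" using inj by (intro card_inj_on_le)
  also have "\<dots> \<le> (\<Sum>k<n. card (\<Union>y\<in>Y. {z\<in>{a..b}. (T ^^ k) z = y}))"
    by (rule card_UN_le) simp
  also have "\<dots> \<le> (\<Sum>k<n. \<Sum>y\<in>Y. card {z\<in>{a..b}. (T ^^ k) z = y})"
    by (intro sum_mono card_UN_le Y(1))
  finally have "card E' \<le> (\<Sum>k<n. \<Sum>y\<in>Y. card {z\<in>{a..b}. (T ^^ k) z = y})" .
  moreover have "card E = Suc (card E')"
    unfolding E'_def using E(1) False by (metis Max_in card_Suc_Diff1)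
  ultimately show ?thesis by simp
qed simp

text \<open>Near the endpoints of the unit interval an orbit is determined up to precision
  \<open>\<epsilon>\<close> by the endpoint it starts at, so separated orbits can be started in a compact interval
  \<open>{a..b}\<close>, which is covered by an iterate of a single element.\<close>

lemma entropy_upper_bound:
  assumes j: "j \<in> P" and mu: "\<mu> \<ge> 1" and C: "\<And>n. real (fiber_count (T ^^ n) j j) \<le> C * \<mu> ^ n"
  shows "h_top T \<le> ereal (ln \<mu>)"
proof (rule h_top_le[OF mu])
  fix \<epsilon> :: real assume eps: "\<epsilon> > 0"
  have "uniformly_continuous_on {0..1} T" by (intro compact_uniformly_continuous cont compact_Icc)
  then obtain d where d: "d > 0" "\<And>x x'. x \<in> {0..1} \<Longrightarrow> x' \<in> {0..1} \<Longrightarrow> dist x x' < d \<Longrightarrow> dist (T x) (T x') < 1/4"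
    unfolding uniformly_continuous_on_def by (metis divide_pos_pos zero_less_numeral zero_less_one)
  \<comment> \<open>\<open>a < d\<close> keeps images of points in one outer zone within 1/4,
    \<open>a < \<epsilon>\<close> keeps the points themselves unseparated, and
    \<open>a \<le> 1/8\<close> keeps the two outer zones more than 1/4 apart.\<close>
  define a where "a = min d (min \<epsilon> (1/4)) / 2"
  define b where "b = 1 - a"
  have ab: "0 < a" "a \<le> 1/8" "b = 1 - a" "b < 1" "a < d" "a < \<epsilon>" using d eps by (auto simp: a_def b_def)
  define zone where "zone x = (if x < a then 0 else if x > b then 2 else 1 :: nat)" for x
  have zone1: "zone x = 1 \<longleftrightarrow> x \<in> {a..b}" for x by (auto simp: zone_def)
  have zone_close: "dist x x' < a" if "x \<in> {0..1}" "x' \<in> {0..1}" "zone x = zone x'" "zone x \<noteq> 1" for x x'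
    using that ab by (auto simp: zone_def dist_real_def split: if_splits)
  have zone_eq: "zone x = zone x'" if "dist x x' < 1/4" "zone x \<noteq> 1" "zone x' \<noteq> 1" for x x'
    using that ab by (auto simp: zone_def dist_real_def split: if_splits)
  obtain Y where Y: "finite Y" "Y \<subseteq> {0..1} - B"
    "\<And>s t. 0 \<le> s \<Longrightarrow> t \<le> 1 \<Longrightarrow> t - s > \<epsilon> \<Longrightarrow> \<exists>y\<in>Y. s < y \<and> y < t"
    using dense_generic_points[OF eps] by blast
  obtain s t where st: "0 \<le> s" "s < t" "t \<le> 1" "j = {s..t}" using elementE[OF j] by metis
  obtain p where p: "{a..b} \<subseteq> (T ^^ p) ` j" using image_covers[OF st(1-3) ab(1,4)] st(4) by blast
  define V where "V y D \<longleftrightarrow> (\<forall>k. finite {z\<in>{a..b}. (T ^^ k) z = y} \<and>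
      real (card {z\<in>{a..b}. (T ^^ k) z = y}) \<le> D * \<mu> ^ k) \<and> D \<ge> 0" for y D
  have "\<exists>D. V y D" if y: "y \<in> Y" for y
  proof -
    obtain i where i: "i \<in> P" "y \<in> interior i" using y Y(2) not_boundaryE by blast
    obtain q where q: "fiber_count (T ^^ q) i j > 0" using irreducible[OF i(1) j] by blast
    have "finite {z\<in>{a..b}. (T ^^ k) z = y} \<and> real (card {z\<in>{a..b}. (T ^^ k) z = y}) \<le> (C * \<mu> ^ (q + p)) * \<mu> ^ k" for k
    proof
      show "finite {z\<in>{a..b}. (T ^^ k) z = y}" by (rule fiber_count_prepend(1)[OF j i p])
      have "card {z\<in>{a..b}. (T ^^ k) z = y} \<le> fiber_count (T ^^ (k + p)) j i"
        by (rule fiber_count_prepend(2)[OF j i p])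
      also have "\<dots> \<le> fiber_count (T ^^ (q + (k + p))) j j"
        by (rule fiber_count_extend[OF j i(1) j q])
      finally have "real (card {z\<in>{a..b}. (T ^^ k) z = y}) \<le> real (fiber_count (T ^^ (q + (k + p))) j j)" by simp
      also have "\<dots> \<le> C * \<mu> ^ (q + (k + p))" by (rule C)
      also have "\<dots> = (C * \<mu> ^ (q + p)) * \<mu> ^ k" by (simp add: power_add)
      finally show "real (card {z\<in>{a..b}. (T ^^ k) z = y}) \<le> (C * \<mu> ^ (q + p)) * \<mu> ^ k" .
    qed
    moreover have "C \<ge> 0" using C[of 0] by simp
    then have "C * \<mu> ^ (q + p) \<ge> 0" using mu by simp
    ultimately have "V y (C * \<mu> ^ (q + p))" unfolding V_def by blast
    then show ?thesis ..
  qed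
  then obtain D where "\<And>y. y \<in> Y \<Longrightarrow> V y (D y)" by metis
  then have D: "\<And>y k. y \<in> Y \<Longrightarrow> finite {z\<in>{a..b}. (T ^^ k) z = y} \<and>
      real (card {z\<in>{a..b}. (T ^^ k) z = y}) \<le> D y * \<mu> ^ k \<and> D y \<ge> 0" by (simp only: V_def)
  define DD where "DD = (\<Sum>y\<in>Y. D y)"
  have DD: "DD \<ge> 0" unfolding DD_def using D by (intro sum_nonneg) blast
  \<comment> \<open>There are at most \<open>3 * (n + 1) \<le> 6 * n\<close> classes of starting
    zone and entry time, each with at most \<open>n * \<mu> ^ n * (1 + DD)\<close> points.\<close>
  show "\<exists>K. \<forall>n\<ge>1. \<forall>E. separated_set T n \<epsilon> E \<longrightarrow> real (card E) \<le> K * (real n)\<^sup>2 * \<mu> ^ n"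
  proof (intro exI[of _ "6 * (1 + DD)"] allI impI)
    fix n :: nat and E assume n: "n \<ge> 1" and sE: "separated_set T n \<epsilon> E"
    have E: "finite E" "E \<subseteq> {0..1}" "\<And>x x'. x \<in> E \<Longrightarrow> x' \<in> E \<Longrightarrow> x \<noteq> x' \<Longrightarrow> \<exists>k<n. dist ((T ^^ k) x) ((T ^^ k) x') > \<epsilon>"
      using sE by (auto simp: separated_set_def)
    \<comment> \<open>The first time at which the orbit is in the middle zone, or \<open>n\<close>
      if it does not get there before.\<close>
    define r where "r x = (LEAST k. k = n \<or> zone ((T ^^ k) x) = 1)" for x
    have r: "r x = n \<or> zone ((T ^^ r x) x) = 1" for x
      unfolding r_def by (rule LeastI[of "\<lambda>k. k = n \<or> zone ((T ^^ k) x) = 1" n]) simp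
    have r_le: "r x \<le> n" for x unfolding r_def by (rule Least_le) simp
    have r_less: "zone ((T ^^ k) x) \<noteq> 1" if "k < r x" for x k
      using not_less_Least[of k "\<lambda>k. k = n \<or> zone ((T ^^ k) x) = 1"] that by (auto simp: r_def)
    define key where "key x = (zone x, r x)" for x
    have keys: "key ` E \<subseteq> {0, 1, 2} \<times> {..n}" using r_le by (auto simp: key_def zone_def split: if_splits)
    have per_class: "real (card {x\<in>E. key x = \<kappa>}) \<le> 1 + real n * \<mu> ^ n * DD" for \<kappa>
    proof -
      obtain z s where \<kappa>: "\<kappa> = (z, s)" by (cases \<kappa>)
      define G where "G = {x\<in>E. key x = \<kappa>}"
      have G: "x \<in> E" "zone x = z" "r x = s" "x \<in> {0..1}" if "x \<in> G" for x
        using that E(2) by (auto simp: G_def key_def \<kappa>)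
      \<comment> \<open>Points in the same outer zone have images less than 1/4 apart, and before
        the entry time these images are again in outer zones, hence in the same one.\<close>
      have same: "zone ((T ^^ k) x) = zone ((T ^^ k) x')" if "x \<in> G" "x' \<in> G" "k < s" for x x' k
        using \<open>k < s\<close>
      proof (induction k)
        case 0
        then show ?case using G(2) that by simp
      next
        case (Suc k)
        then have eq: "zone ((T ^^ k) x) = zone ((T ^^ k) x')" by simp
        have ne: "zone ((T ^^ k) x) \<noteq> 1" using r_less[of k x] Suc.prems G(3)[OF that(1)] by simp
        have unit: "(T ^^ k) x \<in> {0..1}" "(T ^^ k) x' \<in> {0..1}" using iterate_maps G(4) that by auto
        have "dist ((T ^^ k) x) ((T ^^ k) x') < d" using zone_close[OF unit eq ne] ab(5) by linarith
        then have "dist ((T ^^ Suc k) x) ((T ^^ Suc k) x') < 1/4" using d(2)[OF unit] by simp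
        moreover have "zone ((T ^^ Suc k) x) \<noteq> 1" "zone ((T ^^ Suc k) x') \<noteq> 1"
          using r_less[of "Suc k" x] r_less[of "Suc k" x'] Suc.prems G(3) that by auto
        ultimately show ?case by (rule zone_eq)
      qed
      \<comment> \<open>Before the entry time two points of a class stay within
        \<open>a < \<epsilon>\<close>, so they can only be separated afterwards, when both orbits
        continue from the middle zone.\<close>
      have late: "\<exists>k<n. s \<le> k \<and> dist ((T ^^ k) x) ((T ^^ k) x') > \<epsilon>" if xx: "x \<in> G" "x' \<in> G" "x \<noteq> x'" for x x'
      proof -
        obtain k where k: "k < n" "dist ((T ^^ k) x) ((T ^^ k) x') > \<epsilon>" using E(3)[of x x'] G(1) xx by blast
        have "\<not> k < s"
        proof
          assume ks: "k < s"
          have unit: "(T ^^ k) x \<in> {0..1}" "(T ^^ k) x' \<in> {0..1}" using iterate_maps G(4) xx by auto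
          have "zone ((T ^^ k) x) \<noteq> 1" using r_less[of k x] ks G(3)[OF xx(1)] by simp
          then have "dist ((T ^^ k) x) ((T ^^ k) x') < a" using zone_close[OF unit same[OF xx(1,2) ks]] by simp
          then show False using k ab by linarith
        qed
        then show ?thesis using k by (intro exI[of _ k]) simp
      qed
      have finG: "finite G" using E(1) by (simp add: G_def)
      have rest_nonneg: "real n * \<mu> ^ n * DD \<ge> 0" using DD mu by simp
      show ?thesis
      proof (cases "\<exists>x\<in>G. s < n")
        \<comment> \<open>Without an entry into the middle zone no time is left for separation, so
          the class has at most one point.\<close>
        case False
        have "x = x'" if xG: "x \<in> G" "x' \<in> G" for x x'
        proof (rule ccontr)
          assume "x \<noteq> x'"
          then obtain k where "k < n" "s \<le> k" using late[OF xG] by blast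
          then show False using False xG by force
        qed
        then have "card G \<le> 1" using finG by (simp add: card_le_Suc0_iff_eq)
        then show ?thesis using rest_nonneg by (simp add: G_def)
      next
        case True
        then have sn: "s < n" by blast
        let ?g = "T ^^ s"
        have inj: "inj_on ?g G"
        proof (rule inj_onI, rule ccontr)
          fix x x' assume xx: "x \<in> G" "x' \<in> G" "?g x = ?g x'" "x \<noteq> x'"
          obtain k where k: "s \<le> k" "dist ((T ^^ k) x) ((T ^^ k) x') > \<epsilon>" using late[OF xx(1,2,4)] by blast
          have "(T ^^ k) w = (T ^^ (k - s)) (?g w)" for w using k(1) by (metis comp_apply funpow_add le_add_diff_inverse2)
          then show False using k(2) xx(3) eps by simp
        qed
        have mid: "?g ` G \<subseteq> {a..b}"
        proof
          fix w assume "w \<in> ?g ` G"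
          then obtain x where x: "x \<in> G" "w = ?g x" by blast
          then show "w \<in> {a..b}" using r[of x] G(3)[OF x(1)] sn zone1 by auto
        qed
        have sep: "\<exists>k<n. dist ((T ^^ k) w) ((T ^^ k) w') > \<epsilon>" if ww: "w \<in> ?g ` G" "w' \<in> ?g ` G" "w \<noteq> w'" for w w'
        proof -
          obtain x x' where x: "x \<in> G" "w = ?g x" "x' \<in> G" "w' = ?g x'" using ww by blast
          then have "x \<noteq> x'" using ww by blast
          then obtain k where k: "k < n" "s \<le> k" "dist ((T ^^ k) x) ((T ^^ k) x') > \<epsilon>" using late x by blast
          have "(T ^^ k) v = (T ^^ (k - s)) (?g v)" for v using k(2) by (metis comp_apply funpow_add le_add_diff_inverse2)
          then show ?thesis using k x by (intro exI[of _ "k - s"]) auto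
        qed
        have "card G = card (?g ` G)" using card_image[OF inj] by simp
        also have "\<dots> \<le> 1 + (\<Sum>k<n. \<Sum>y\<in>Y. card {z\<in>{a..b}. (T ^^ k) z = y})"
          by (rule card_separated_le[where \<epsilon> = \<epsilon>]) (use ab finG mid sep Y D in auto)
        finally have "real (card G) \<le> real (1 + (\<Sum>k<n. \<Sum>y\<in>Y. card {z\<in>{a..b}. (T ^^ k) z = y}))"
          by (rule of_nat_mono)
        also have "\<dots> = 1 + (\<Sum>k<n. \<Sum>y\<in>Y. real (card {z\<in>{a..b}. (T ^^ k) z = y}))" by simp
        also have "(\<Sum>k<n. \<Sum>y\<in>Y. real (card {z\<in>{a..b}. (T ^^ k) z = y})) \<le> (\<Sum>k<n. \<Sum>y\<in>Y. D y * \<mu> ^ n)"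
        proof (intro sum_mono)
          fix k y assume ky: "k \<in> {..<n}" "y \<in> Y"
          have "\<mu> ^ k \<le> \<mu> ^ n" using ky mu by (intro power_increasing) auto
          then have "D y * \<mu> ^ k \<le> D y * \<mu> ^ n" using D[OF ky(2)] by (intro mult_left_mono) auto
          then show "real (card {z\<in>{a..b}. (T ^^ k) z = y}) \<le> D y * \<mu> ^ n" using D[OF ky(2), of k] by linarith
        qed
        also have "(\<Sum>k<n. \<Sum>y\<in>Y. D y * \<mu> ^ n) = real n * \<mu> ^ n * DD"
          by (simp add: DD_def sum_distrib_right[symmetric])
        finally show ?thesis by (simp add: G_def)
      qed
    qed
    have "card E = (\<Sum>\<kappa>\<in>key ` E. card {x\<in>E. key x = \<kappa>})"
      using sum.image_gen[OF E(1), of "\<lambda>_. 1::nat" key] by simp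
    then have "real (card E) = (\<Sum>\<kappa>\<in>key ` E. real (card {x\<in>E. key x = \<kappa>}))" by simp
    also have "\<dots> \<le> (\<Sum>\<kappa>\<in>key ` E. 1 + real n * \<mu> ^ n * DD)" by (intro sum_mono per_class)
    also have "\<dots> = real (card (key ` E)) * (1 + real n * \<mu> ^ n * DD)" by simp
    also have "\<dots> \<le> (6 * real n) * (real n * \<mu> ^ n * (1 + DD))"
    proof (rule mult_mono)
      have "card (key ` E) \<le> card ({0, 1, 2 :: nat} \<times> {..n})" by (rule card_mono[OF _ keys]) simp
      also have "\<dots> = 3 * (n + 1)" by (simp add: card_cartesian_product)
      finally have "card (key ` E) \<le> 6 * n" using n by simp
      then have "real (card (key ` E)) \<le> real (6 * n)" by (rule of_nat_mono)
      then show "real (card (key ` E)) \<le> 6 * real n" by simp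
      have "1 * 1 \<le> real n * \<mu> ^ n" using n mu by (intro mult_mono) (simp_all add: one_le_power)
      then show "1 + real n * \<mu> ^ n * DD \<le> real n * \<mu> ^ n * (1 + DD)" by (simp add: distrib_left)
      show "0 \<le> 1 + real n * \<mu> ^ n * DD" using DD mu by simp
    qed simp
    also have "\<dots> = 6 * (1 + DD) * (real n)\<^sup>2 * \<mu> ^ n" by (simp add: power2_eq_square)
    finally show "real (card E) \<le> 6 * (1 + DD) * (real n)\<^sup>2 * \<mu> ^ n" .
  qed
qed

end

section \<open>Linearizable maps give supersolutions\<close>

text \<open>Tilt \<open>g\<close> to a function \<open>f\<close>, choose a level
  \<open>\<eta>\<close> that \<open>f\<close> does not take on \<open>C\<close>, and let
  \<open>t\<close> be the last point at which \<open>f\<close> is at most \<open>\<eta>\<close>.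
  There \<open>f\<close> equals \<open>\<eta>\<close>, so \<open>t\<close> is not exceptional and
  \<open>f\<close> has a negative derivative, which contradicts the choice of
  \<open>t\<close>.\<close>

lemma derivative_bound_countable_exception:
  fixes g :: "real \<Rightarrow> real"
  assumes cont: "continuous_on {a..b} g" and ab: "a \<le> b" and C: "countable C"
    and der: "\<And>x. x \<in> {a..b} - C \<Longrightarrow> \<exists>D. (g has_real_derivative D) (at x within {a..b}) \<and> D \<le> s"
  shows "g b - g a \<le> s * (b - a)"
proof (rule ccontr)
  assume "\<not> ?thesis"
  then have gt: "g b - g a > s * (b - a)" by simp
  then have "a < b" using ab by (cases "a = b") auto
  define X where "X = g b - g a - s * (b - a)"
  \<comment> \<open>Half of the excess slope: the tilted function still increases from
    \<open>a\<close> to \<open>b\<close>, but its derivative is at most \<open>- e\<close>.\<close>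
  define e where "e = X / (2 * (b - a))"
  have "X > 0" using gt by (simp add: X_def)
  then have "e > 0" "2 * e * (b - a) = X" using \<open>a < b\<close> by (simp_all add: e_def field_simps)
  then have e: "e > 0" "2 * e * (b - a) = g b - g a - s * (b - a)" by (simp_all add: X_def)
  define f where "f t = g t - (s + e) * t" for t
  have "f b - f a = g b - g a - s * (b - a) - e * (b - a)" by (simp add: f_def algebra_simps)
  also have "\<dots> = e * (b - a)" using e(2) by (simp add: algebra_simps)
  finally have "f a < f b" using e(1) \<open>a < b\<close> by (smt (verit) mult_pos_pos)
  have contf: "continuous_on {a..b} f" unfolding f_def by (intro continuous_intros cont)
  have "\<not> {f a<..<f b} \<subseteq> f ` C"
    using countable_subset[OF _ countable_image[OF C, of f]] uncountable_open_interval[of "f a" "f b"] \<open>f a < f b\<close> by auto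
  then obtain \<eta> where \<eta>: "\<eta> \<in> {f a<..<f b}" "\<eta> \<notin> f ` C" by blast
  let ?S = "{a..b} \<inter> f -` {..\<eta>}"
  have "closed ?S" using contf by (intro continuous_closed_preimage) auto
  then have "compact ?S" by (simp add: compact_eq_bounded_closed bounded_Int)
  moreover have "a \<in> ?S" using \<eta> ab by simp
  then have "?S \<noteq> {}" by blast
  ultimately obtain t where t: "t \<in> ?S" "\<forall>t'\<in>?S. t' \<le> t" using compact_attains_sup by blast
  have tab: "a \<le> t" "t \<le> b" "f t \<le> \<eta>" using t(1) by auto
  have "t \<noteq> b" using tab \<eta> by auto
  then have "t < b" using tab by simp
  have "f t = \<eta>"
  proof -
    have "continuous_on {t..b} f" by (rule continuous_on_subset[OF contf]) (use tab in auto)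
    then obtain t' where t': "t \<le> t'" "t' \<le> b" "f t' = \<eta>" using IVT'[of f t \<eta> b] tab \<eta> by auto
    then have "t' \<in> ?S" using tab by auto
    then show ?thesis using t(2) t' by force
  qed
  then have "t \<notin> C" using \<eta>(2) by blast
  then obtain D where D: "(g has_real_derivative D) (at t within {a..b})" "D \<le> s" using der[of t] tab by auto
  have "(f has_real_derivative D - (s + e)) (at t within {a..b})"
    unfolding f_def using D(1) by (auto intro!: derivative_eq_intros)
  moreover have "D - (s + e) < 0" using D(2) e(1) by simp
  ultimately obtain d where d: "d > 0" "\<And>h. h > 0 \<Longrightarrow> t + h \<in> {a..b} \<Longrightarrow> h < d \<Longrightarrow> f (t + h) < f t"
    using has_real_derivative_neg_dec_right by metis
  define h where "h = min (d / 2) (b - t)"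
  have h: "h > 0" "h < d" "t + h \<in> {a..b}" using d(1) \<open>t < b\<close> tab by (auto simp: h_def min_def)
  then have "t + h \<in> ?S" using d(2)[of h] \<open>f t = \<eta>\<close> by auto
  then show False using t(2) h(1) by force
qed

lemma constant_slope_lipschitz:
  assumes cont: "continuous_on {0..1} g" and cs: "constant_slope g s" and xy: "x \<in> {0..1}" "y \<in> {0..1}"
  shows "\<bar>g y - g x\<bar> \<le> s * \<bar>y - x\<bar>"
proof -
  obtain C where C: "countable C" "\<And>x. x \<in> {0..1} - C \<Longrightarrow> \<exists>D. (g has_real_derivative D) (at x within {0..1}) \<and> \<bar>D\<bar> = s"
    using cs unfolding constant_slope_def by blast
  have main: "\<bar>g y - g x\<bar> \<le> s * (y - x)" if xy: "x \<in> {0..1}" "y \<in> {0..1}" "x \<le> y" for x y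
  proof -
    have sub: "{x..y} \<subseteq> {0..1}" using xy by auto
    have c: "continuous_on {x..y} g" by (rule continuous_on_subset[OF cont sub])
    have der: "\<exists>D. (g has_real_derivative D) (at z within {x..y}) \<and> \<bar>D\<bar> = s" if "z \<in> {x..y} - C" for z
      using C(2)[of z] that sub by (meson DERIV_subset Diff_iff subsetD)
    have "g y - g x \<le> s * (y - x)"
    proof (rule derivative_bound_countable_exception[OF c xy(3) C(1)])
      fix z assume "z \<in> {x..y} - C"
      then obtain D where "(g has_real_derivative D) (at z within {x..y})" "\<bar>D\<bar> = s" using der by blast
      then show "\<exists>D. (g has_real_derivative D) (at z within {x..y}) \<and> D \<le> s" by (intro exI[of _ D]) auto
    qed
    moreover have "(- g y) - (- g x) \<le> s * (y - x)"
    proof (rule derivative_bound_countable_exception[OF _ xy(3) C(1)])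
      show "continuous_on {x..y} (\<lambda>z. - g z)" by (intro continuous_intros c)
      fix z assume "z \<in> {x..y} - C"
      then obtain D where "(g has_real_derivative D) (at z within {x..y})" "\<bar>D\<bar> = s" using der by blast
      then show "\<exists>D. ((\<lambda>z. - g z) has_real_derivative D) (at z within {x..y}) \<and> D \<le> s"
        by (intro exI[of _ "- D"]) (auto intro: DERIV_minus)
    qed
    ultimately show ?thesis by linarith
  qed
  show ?thesis
  proof (cases "x \<le> y")
    case True
    then show ?thesis using main[OF xy True] by simp
  next
    case False
    then show ?thesis using main[OF xy(2,1)] by (simp add: abs_minus_commute)
  qed
qed

lemma inj_continuous_image_Icc_Ioo:
  fixes f :: "real \<Rightarrow> real"
  assumes cont: "continuous_on {p..q} f" and inj: "inj_on f {p..q}" and "p \<le> q"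
  shows "f ` {p..q} = {min (f p) (f q)..max (f p) (f q)}"
    and "f ` {p<..<q} = {min (f p) (f q)<..<max (f p) (f q)}"
proof -
  have "f ` {p..q} = {min (f p) (f q)..max (f p) (f q)} \<and> f ` {p<..<q} = {min (f p) (f q)<..<max (f p) (f q)}"
  proof (cases "p = q")
    case False
    then have pq: "p < q" using assms(3) by simp
    have "{p<..<q} = {p..q} - {p, q}" by auto
    then have o: "f ` {p<..<q} = f ` {p..q} - {f p, f q}"
      using inj_on_image_set_diff[OF inj, of "{p..q}" "{p, q}"] pq by auto
    consider "f p < f q" "f ` {p..q} = {f p..f q}" | "f q < f p" "f ` {p..q} = {f q..f p}"
      using inj_continuous_image_interval[OF cont inj pq] by blast
    then show ?thesis
    proof cases
      case 1
      then have "f ` {p<..<q} = {f p<..<f q}" unfolding o by auto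
      then show ?thesis using 1 by (simp add: min_def max_def)
    next
      case 2
      then have "f ` {p<..<q} = {f q<..<f p}" unfolding o by auto
      then show ?thesis using 2 by (simp add: min_def max_def)
    qed
  qed auto
  then show "f ` {p..q} = {min (f p) (f q)..max (f p) (f q)}"
    and "f ` {p<..<q} = {min (f p) (f q)<..<max (f p) (f q)}" by blast+
qed

lemma emeasure_inj_continuous_image:
  fixes f :: "real \<Rightarrow> real"
  assumes "continuous_on {p..q} f" "inj_on f {p..q}" "p \<le> q"
  shows "emeasure lborel (f ` {p..q}) = ennreal \<bar>f q - f p\<bar>"
    and "emeasure lborel (f ` {p<..<q}) = ennreal \<bar>f q - f p\<bar>"
    and "f ` {p..q} \<in> sets borel" "f ` {p<..<q} \<in> sets borel"
proof -
  have mm: "min (f p) (f q) \<le> max (f p) (f q)" "max (f p) (f q) - min (f p) (f q) = \<bar>f q - f p\<bar>" by auto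
  show "emeasure lborel (f ` {p..q}) = ennreal \<bar>f q - f p\<bar>"
    unfolding inj_continuous_image_Icc_Ioo[OF assms] emeasure_lborel_Icc[OF mm(1)] mm(2) ..
  show "emeasure lborel (f ` {p<..<q}) = ennreal \<bar>f q - f p\<bar>"
    unfolding inj_continuous_image_Icc_Ioo[OF assms] emeasure_lborel_Ioo[OF mm(1)] mm(2) ..
  show "f ` {p..q} \<in> sets borel" "f ` {p<..<q} \<in> sets borel"
    unfolding inj_continuous_image_Icc_Ioo[OF assms] by simp_all
qed

text \<open>\<open>v i\<close> is the length of \<open>i\<close> in the linearizing coordinate. The
  preimages of a generic point under \<open>S\<close> lie in different monotone pieces of
  \<open>i\<close>, so the row sum is at most the total length of the images of the pieces, and each
  piece is stretched by at most the slope.\<close>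

lemma linearizable_supersolution:
  assumes sys: "mixing_system P S" and lin: "linearizable S"
  obtains v where "\<And>i. i \<in> P \<Longrightarrow> v i \<noteq> 0" "(\<integral>\<^sup>+i. v i \<partial>count_space P) \<le> 1"
    "\<And>i F. i \<in> P \<Longrightarrow> finite F \<Longrightarrow> F \<subseteq> P \<Longrightarrow>
      (\<Sum>\<alpha>\<in>F. of_nat (fiber_count S i \<alpha>) * v \<alpha>) \<le> ennreal (exp (real_of_ereal (h_top S))) * v i"
proof -
  interpret S: mixing_system P S by (rule sys)
  define s where "s = exp (real_of_ereal (h_top S))"
  obtain g where g: "continuous_on {0..1} g" "constant_slope g s" "topologically_conjugate S g"
    using lin unfolding linearizable_def s_def by blast
  obtain \<phi> \<psi> where hom: "homeomorphism {0..1} {0..1} \<phi> \<psi>" and conj: "\<And>x. x \<in> {0..1} \<Longrightarrow> \<phi> (S x) = g (\<phi> x)"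
    using g(3) unfolding topologically_conjugate_def by blast
  have phi: "continuous_on {0..1} \<phi>" "\<phi> ` {0..1} = {0..1}" "inj_on \<phi> {0..1}"
    using hom unfolding homeomorphism_def by (auto intro: inj_on_inverseI[of _ \<psi>])
  have len: "emeasure lborel (\<phi> ` {p..q}) = ennreal \<bar>\<phi> q - \<phi> p\<bar>"
    "emeasure lborel (\<phi> ` {p<..<q}) = ennreal \<bar>\<phi> q - \<phi> p\<bar>"
    "\<phi> ` {p..q} \<in> sets borel" "\<phi> ` {p<..<q} \<in> sets borel" if pq: "0 \<le> p" "p \<le> q" "q \<le> 1" for p q
  proof -
    have sub: "{p..q} \<subseteq> {0..1}" using pq by auto
    note c = continuous_on_subset[OF phi(1) sub] and i = inj_on_subset[OF phi(3) sub]
    show "emeasure lborel (\<phi> ` {p..q}) = ennreal \<bar>\<phi> q - \<phi> p\<bar>"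
      "emeasure lborel (\<phi> ` {p<..<q}) = ennreal \<bar>\<phi> q - \<phi> p\<bar>"
      "\<phi> ` {p..q} \<in> sets borel" "\<phi> ` {p<..<q} \<in> sets borel"
      using emeasure_inj_continuous_image[OF c i pq(2)] by blast+
  qed
  define v where "v i = emeasure lborel (\<phi> ` interior i)" for i
  have meas: "\<phi> ` interior i \<in> sets borel" if i: "i \<in> P" for i
  proof -
    obtain a b where ab: "0 \<le> a" "a < b" "b \<le> 1" "i = {a..b}" "interior i = {a<..<b}" using S.elementE[OF i] .
    then show ?thesis using len(4)[of a b] by simp
  qed
  show ?thesis
  proof (rule that[of v])
    show "v i \<noteq> 0" if i: "i \<in> P" for i
    proof -
      obtain a b where ab: "0 \<le> a" "a < b" "b \<le> 1" "i = {a..b}" "interior i = {a<..<b}" using S.elementE[OF i] .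
      have "\<phi> a \<noteq> \<phi> b" using inj_onD[OF phi(3), of a b] ab by auto
      then show ?thesis using len(2)[of a b] ab by (simp add: v_def ennreal_eq_0_iff)
    qed
    have "(\<integral>\<^sup>+i. v i \<partial>count_space P) = emeasure lborel (\<Union>i\<in>P. \<phi> ` interior i)"
      unfolding v_def
    proof (rule emeasure_UN_countable[symmetric])
      show "disjoint_family_on (\<lambda>i. \<phi> ` interior i) P"
        unfolding disjoint_family_on_def
      proof (intro ballI impI)
        fix i k assume ik: "i \<in> P" "k \<in> P" "i \<noteq> k"
        have "interior i \<subseteq> {0..1}" "interior k \<subseteq> {0..1}"
          using S.element_subset ik interior_subset by blast+
        then have "\<phi> ` interior i \<inter> \<phi> ` interior k = \<phi> ` (interior i \<inter> interior k)"
          by (rule inj_on_image_Int[OF phi(3), symmetric])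
        then show "\<phi> ` interior i \<inter> \<phi> ` interior k = {}" using S.disjoint_interiors[OF ik] by simp
      qed
    qed (use meas S.countable_family in auto)
    also have "\<dots> \<le> emeasure lborel {0..1::real}"
    proof (rule emeasure_mono)
      show "(\<Union>i\<in>P. \<phi> ` interior i) \<subseteq> {0..1}" using phi(2) S.element_subset interior_subset by blast
    qed simp
    finally show "(\<integral>\<^sup>+i. v i \<partial>count_space P) \<le> 1" by simp
    fix i F assume i: "i \<in> P" and F: "finite F" "F \<subseteq> P"
    obtain a b where ab: "0 \<le> a" "a < b" "b \<le> 1" "i = {a..b}" "interior i = {a<..<b}" using S.elementE[OF i] .
    obtain D where D: "D division_of i" "\<And>J. J \<in> D \<Longrightarrow> monotone_map_on J S"
      using S.piecewise_monotone[OF i] unfolding piecewise_monotone_on_def by blast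
    have finD: "finite D" using D(1) by (rule division_ofD)
    have J: "\<exists>u w. J = {u..w} \<and> 0 \<le> u \<and> u \<le> w \<and> w \<le> 1 \<and> interior J = {u<..<w} \<and> inj_on S {u..w}" if JD: "J \<in> D" for J
    proof -
      obtain u w where uw: "J = {u..w}" using division_ofD(4)[OF D(1) JD] by auto
      have "J \<noteq> {}" "J \<subseteq> {0..1}" using division_ofD(2,3)[OF D(1) JD] S.element_subset[OF i] by blast+
      then have "0 \<le> u" "u \<le> w" "w \<le> 1" using uw by auto
      moreover have "inj_on S J"
        using \<open>J \<subseteq> {0..1}\<close> D(2)[OF JD] uw
        by (intro mixing_monotone_imp_inj S.cont S.maps S.mixing) (auto simp: is_interval_cc)
      ultimately show ?thesis using uw by auto
    qed
    have Jlen: "emeasure lborel (\<phi> ` S ` J) \<le> ennreal s * emeasure lborel (\<phi> ` interior J)"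
      and Jmeas: "\<phi> ` S ` J \<in> sets borel" "\<phi> ` interior J \<in> sets borel" if JD: "J \<in> D" for J
    proof -
      obtain u w where uw: "J = {u..w}" "0 \<le> u" "u \<le> w" "w \<le> 1" "interior J = {u<..<w}" "inj_on S {u..w}"
        using J[OF JD] by blast
      have sub: "{u..w} \<subseteq> {0..1}" using uw by auto
      have im: "S ` J = {min (S u) (S w)..max (S u) (S w)}"
        unfolding uw(1) by (rule inj_continuous_image_Icc_Ioo[OF continuous_on_subset[OF S.cont sub] uw(6,3)])
      have S01: "S u \<in> {0..1}" "S w \<in> {0..1}" using S.maps_point uw by auto
      have mm: "0 \<le> min (S u) (S w)" "min (S u) (S w) \<le> max (S u) (S w)" "max (S u) (S w) \<le> 1"
        using S01 by auto
      show "\<phi> ` S ` J \<in> sets borel" unfolding im by (rule len(3)[OF mm])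
      show "\<phi> ` interior J \<in> sets borel" unfolding uw(5) by (rule len(4)[OF uw(2-4)])
      have "emeasure lborel (\<phi> ` S ` J) = ennreal \<bar>\<phi> (max (S u) (S w)) - \<phi> (min (S u) (S w))\<bar>"
        unfolding im by (rule len(1)[OF mm])
      also have "\<bar>\<phi> (max (S u) (S w)) - \<phi> (min (S u) (S w))\<bar> = \<bar>\<phi> (S w) - \<phi> (S u)\<bar>"
        by (auto simp: min_def max_def)
      also have "\<dots> = \<bar>g (\<phi> w) - g (\<phi> u)\<bar>" using conj uw by simp
      also have "ennreal \<dots> \<le> ennreal (s * \<bar>\<phi> w - \<phi> u\<bar>)"
      proof (rule ennreal_leI, rule constant_slope_lipschitz[OF g(1,2)])
        show "\<phi> u \<in> {0..1}" "\<phi> w \<in> {0..1}" using phi(2) uw by auto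
      qed
      also have "\<dots> = ennreal s * emeasure lborel (\<phi> ` interior J)"
        unfolding uw(5) len(2)[OF uw(2-4)] by (simp add: ennreal_mult s_def)
      finally show "emeasure lborel (\<phi> ` S ` J) \<le> ennreal s * emeasure lborel (\<phi> ` interior J)" .
    qed
    \<comment> \<open>At most one of the image interiors contains \<open>y\<close>, and choosing a
      piece for each of its preimages is injective because \<open>S\<close> is injective on
      pieces.\<close>
    have point: "(\<Sum>\<alpha>\<in>F. of_nat (fiber_count S i \<alpha>) * indicator (\<phi> ` interior \<alpha>) y) \<le>
        (\<Sum>J\<in>D. indicator (\<phi> ` S ` J) y :: ennreal)" for y
    proof (cases "\<exists>\<beta>\<in>F. y \<in> \<phi> ` interior \<beta>")
      case False
      then have "(\<Sum>\<alpha>\<in>F. of_nat (fiber_count S i \<alpha>) * indicator (\<phi> ` interior \<alpha>) y) = (0::ennreal)"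
        by (intro sum.neutral) (auto simp: indicator_def)
      then show ?thesis by simp
    next
      case True
      then obtain \<beta> y0 where \<beta>: "\<beta> \<in> F" "y0 \<in> interior \<beta>" "y = \<phi> y0" by blast
      have \<beta>P: "\<beta> \<in> P" using \<beta> F by blast
      have only: "y \<notin> \<phi> ` interior \<alpha>" if "\<alpha> \<in> F" "\<alpha> \<noteq> \<beta>" for \<alpha>
      proof
        assume "y \<in> \<phi> ` interior \<alpha>"
        then obtain y1 where "y1 \<in> interior \<alpha>" "y = \<phi> y1" by blast
        then have y1: "y1 \<in> interior \<alpha>" "\<phi> y0 = \<phi> y1" using \<beta>(3) by simp_all
        have "\<alpha> \<in> P" using that(1) F by blast
        then have "y0 \<in> {0..1}" "y1 \<in> {0..1}"
          using S.interior_unit[of \<beta> y0] S.interior_unit[of \<alpha> y1] \<beta>P \<beta> y1 by auto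
        then have "y0 = y1" using inj_onD[OF phi(3) y1(2)] by simp
        then have "y0 \<in> interior \<alpha>" using y1(1) by simp
        then show False using S.interior_disjoint_unique[OF \<open>\<alpha> \<in> P\<close> \<beta>P _ \<beta>(2)] that(2) by simp
      qed
      have "(\<Sum>\<alpha>\<in>F. of_nat (fiber_count S i \<alpha>) * indicator (\<phi> ` interior \<alpha>) y) =
          (\<Sum>\<alpha>\<in>F. if \<alpha> = \<beta> then of_nat (fiber_count S i \<beta>) else (0::ennreal))"
        by (rule sum.cong[OF refl]) (use only \<beta> in \<open>auto simp: indicator_def\<close>)
      also have "\<dots> = of_nat (fiber_count S i \<beta>)" using F(1) \<beta>(1) by simp
      also have "fiber_count S i \<beta> = card {x\<in>i. S x = y0}" using S.fiber_count_eq[OF i \<beta>P \<beta>(2)] by simp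
      also have "of_nat (card {x\<in>i. S x = y0}) \<le> (of_nat (card {J\<in>D. y0 \<in> S ` J}) :: ennreal)"
      proof -
        have "\<exists>J\<in>D. x \<in> J" if "x \<in> i" for x
          using that unfolding division_ofD(6)[OF D(1), symmetric] by (rule UnionE) (rule bexI)
        then obtain c where c: "\<And>x. x \<in> i \<Longrightarrow> c x \<in> D \<and> x \<in> c x" by metis
        have "inj_on c {x\<in>i. S x = y0}"
        proof (rule inj_onI)
          fix x x' assume x: "x \<in> {x\<in>i. S x = y0}" "x' \<in> {x\<in>i. S x = y0}" "c x = c x'"
          then have "x \<in> c x" "x' \<in> c x" "c x \<in> D" using c[of x] c[of x'] by simp_all
          moreover have "inj_on S (c x)" using J[OF \<open>c x \<in> D\<close>] by (elim exE conjE) simp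
          moreover have "S x = S x'" using x by simp
          ultimately show "x = x'" by (metis inj_onD)
        qed
        moreover have "c ` {x\<in>i. S x = y0} \<subseteq> {J\<in>D. y0 \<in> S ` J}" using c by blast
        moreover have "finite {J\<in>D. y0 \<in> S ` J}" using finD by simp
        ultimately show ?thesis by (simp add: card_inj_on_le)
      qed
      also have "\<dots> = (\<Sum>J\<in>{J\<in>D. y0 \<in> S ` J}. 1)" by simp
      also have "\<dots> \<le> (\<Sum>J\<in>{J\<in>D. y0 \<in> S ` J}. indicator (\<phi> ` S ` J) y)"
        by (rule sum_mono) (use \<beta> in \<open>auto simp: indicator_def\<close>)
      also have "\<dots> \<le> (\<Sum>J\<in>D. indicator (\<phi> ` S ` J) y)" by (rule sum_mono2) (use finD in auto)
      finally show ?thesis .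
    qed
    have "(\<Sum>\<alpha>\<in>F. of_nat (fiber_count S i \<alpha>) * v \<alpha>) =
        (\<Sum>\<alpha>\<in>F. \<integral>\<^sup>+y. of_nat (fiber_count S i \<alpha>) * indicator (\<phi> ` interior \<alpha>) y \<partial>lborel)"
      unfolding v_def using meas F by (intro sum.cong) (auto simp: nn_integral_cmult_indicator)
    also have "\<dots> = (\<integral>\<^sup>+y. (\<Sum>\<alpha>\<in>F. of_nat (fiber_count S i \<alpha>) * indicator (\<phi> ` interior \<alpha>) y) \<partial>lborel)"
      by (rule nn_integral_sum[symmetric]) (use meas F in auto)
    also have "\<dots> \<le> (\<integral>\<^sup>+y. (\<Sum>J\<in>D. indicator (\<phi> ` S ` J) y) \<partial>lborel)"
      by (intro nn_integral_mono point)
    also have "\<dots> = (\<Sum>J\<in>D. \<integral>\<^sup>+y. indicator (\<phi> ` S ` J) y \<partial>lborel)"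
      by (rule nn_integral_sum) (use Jmeas in auto)
    also have "\<dots> = (\<Sum>J\<in>D. emeasure lborel (\<phi> ` S ` J))"
      using Jmeas by (intro sum.cong) auto
    also have "\<dots> \<le> (\<Sum>J\<in>D. ennreal s * emeasure lborel (\<phi> ` interior J))"
      by (intro sum_mono Jlen)
    also have "\<dots> = ennreal s * (\<Sum>J\<in>D. emeasure lborel (\<phi> ` interior J))"
      by (rule sum_distrib_left[symmetric])
    also have "(\<Sum>J\<in>D. emeasure lborel (\<phi> ` interior J)) = emeasure lborel (\<Union>J\<in>D. \<phi> ` interior J)"
    proof (rule sum_emeasure)
      show "disjoint_family_on (\<lambda>J. \<phi> ` interior J) D"
        unfolding disjoint_family_on_def
      proof (intro ballI impI)
        fix J K assume JK: "J \<in> D" "K \<in> D" "J \<noteq> K"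
        have "J \<subseteq> {0..1}" "K \<subseteq> {0..1}"
          using division_ofD(2)[OF D(1)] JK S.element_subset[OF i] by blast+
        then have "interior J \<subseteq> {0..1}" "interior K \<subseteq> {0..1}" using interior_subset by blast+
        then have "\<phi> ` interior J \<inter> \<phi> ` interior K = \<phi> ` (interior J \<inter> interior K)"
          by (rule inj_on_image_Int[OF phi(3), symmetric])
        then show "\<phi> ` interior J \<inter> \<phi> ` interior K = {}" using division_ofD(5)[OF D(1) JK] by simp
      qed
    qed (use Jmeas finD in auto)
    also have "\<dots> \<le> v i"
      unfolding v_def
    proof (rule emeasure_mono)
      show "(\<Union>J\<in>D. \<phi> ` interior J) \<subseteq> \<phi> ` interior i"
        using division_ofD(2)[OF D(1)] interior_mono by blast
    qed (use meas i in auto)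
    then have "ennreal s * emeasure lborel (\<Union>J\<in>D. \<phi> ` interior J) \<le> ennreal s * v i"
      by (rule mult_left_mono) simp
    finally show "(\<Sum>\<alpha>\<in>F. of_nat (fiber_count S i \<alpha>) * v \<alpha>) \<le> ennreal (exp (real_of_ereal (h_top S))) * v i"
      by (simp add: s_def)
  qed
qed

section \<open>From eigenvectors to constant slope\<close>

text \<open>Tychonoff compactness takes the place of a convergent subsequence: the domain may be
  uncountable, and all its points must be handled along one filter.\<close>

lemma cluster_filter:
  fixes b :: "nat \<Rightarrow> 'a \<Rightarrow> real"
  assumes "\<And>n x. b n x \<in> {0..1}"
  shows "\<exists>G \<phi>. G \<noteq> bot \<and> G \<le> sequentially \<and> (\<forall>x. ((\<lambda>n. b n x) \<longlongrightarrow> \<phi> x) G)"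
proof -
  define K where "K = (PiE UNIV (\<lambda>_. {0..1}) :: ('a \<Rightarrow> real) set)"
  have "compactin (product_topology (\<lambda>_. euclidean) UNIV) K"
    unfolding K_def compactin_PiE by simp
  then have "compact K" by (simp add: euclidean_product_topology)
  moreover have "filtermap b sequentially \<noteq> bot" by (simp add: filtermap_bot_iff)
  moreover have "eventually (\<lambda>f. f \<in> K) (filtermap b sequentially)"
    unfolding eventually_filtermap using assms by (simp add: K_def PiE_def)
  ultimately obtain \<phi> where \<phi>: "inf (nhds \<phi>) (filtermap b sequentially) \<noteq> bot"
    unfolding compact_filter by blast
  \<comment> \<open>Pulling back the neighbourhoods of the cluster point gives a filter on indices
    that converges by construction; its infimum with \<open>sequentially\<close> is proper because
    \<open>\<phi>\<close> is a cluster point.\<close>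
  define G where "G = inf (filtercomap b (nhds \<phi>)) sequentially"
  have "G \<noteq> bot"
  proof
    assume "G = bot"
    then have "eventually (\<lambda>_. False) G" by simp
    then obtain P Q where PQ: "eventually P (filtercomap b (nhds \<phi>))" "eventually Q sequentially"
      "\<And>n. P n \<Longrightarrow> Q n \<Longrightarrow> False"
      unfolding G_def eventually_inf by blast
    then obtain P' where P': "eventually P' (nhds \<phi>)" "\<And>n. P' (b n) \<Longrightarrow> P n"
      unfolding eventually_filtercomap by blast
    have "eventually (\<lambda>n. \<not> P' (b n)) sequentially"
      using PQ(2) by (rule eventually_mono) (use PQ(3) P'(2) in blast)
    then have "eventually (\<lambda>f. \<not> P' f) (filtermap b sequentially)" by (simp add: eventually_filtermap)
    then have "eventually (\<lambda>_. False) (inf (nhds \<phi>) (filtermap b sequentially))"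
      using P'(1) unfolding eventually_inf by blast
    then show False using \<phi> by (simp add: trivial_limit_def)
  qed
  moreover have "G \<le> sequentially" by (simp add: G_def)
  moreover have "((\<lambda>n. b n x) \<longlongrightarrow> \<phi> x) G" for x
  proof -
    have "filterlim b (nhds \<phi>) (filtercomap b (nhds \<phi>))" by (rule filterlim_filtercomap)
    then have lim: "(b \<longlongrightarrow> \<phi>) G" by (rule filterlim_mono) (simp_all add: G_def)
    show ?thesis
    proof (rule topological_tendstoI)
      fix S :: "real set" assume S: "open S" "\<phi> x \<in> S"
      have "open ((\<lambda>f :: 'a \<Rightarrow> real. f x) -` S)"
        by (rule open_vimage[OF S(1) continuous_on_product_coordinates])
      then have "eventually (\<lambda>n. b n \<in> (\<lambda>f. f x) -` S) G"
        by (rule topological_tendstoD[OF lim]) (use S in simp)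
      then show "eventually (\<lambda>n. b n x \<in> S) G" by simp
    qed
  qed
  ultimately show ?thesis by blast
qed

text \<open>\<open>\<kappa>\<close> is the Perron value, later \<open>1 / R\<close>, and
  \<open>u\<close> is normalised. \<open>\<kappa> > 1\<close> makes the pullbacks contract, which is
  what gives a continuous conjugacy.\<close>

locale eigenmeasure = mixing_system P T for P T +
  fixes u :: "real set \<Rightarrow> real" and \<kappa> :: real
  assumes lambda: "\<kappa> > 1"
    and u_pos: "\<And>i. i \<in> P \<Longrightarrow> u i > 0"
    and u_total: "(\<integral>\<^sup>+i. ennreal (u i) \<partial>count_space P) = 1"
    and u_eigen: "\<And>i. i \<in> P \<Longrightarrow>
      (\<integral>\<^sup>+\<alpha>. of_nat (fiber_count T i \<alpha>) * ennreal (u \<alpha>) \<partial>count_space P) = ennreal (\<kappa> * u i)"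
begin

text \<open>The measures \<open>\<mu> n\<close> are the normalised pullbacks under \<open>T ^^ n\<close> of one atom of mass
  \<open>u i\<close> in the interior of each element \<open>i\<close>; the eigenvector equation says that all of them
  give mass \<open>u i\<close> to \<open>i\<close>.\<close>

definition base_point :: "real set \<Rightarrow> real" where
  "base_point i = (SOME y. y \<in> interior i)"

text \<open>The mass of the atom at \<open>z\<close>. The guard matters because \<open>T\<close> is
  arbitrary outside the unit interval.\<close>

primrec weight :: "nat \<Rightarrow> real \<Rightarrow> ennreal" where
  "weight 0 z = (\<integral>\<^sup>+i. ennreal (u i) * indicator {base_point i} z \<partial>count_space P)"
| "weight (Suc n) z = (if z \<in> {0..1} then ennreal (1 / \<kappa>) * weight n (T z) else 0)"

definition \<mu> :: "nat \<Rightarrow> real measure" where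
  "\<mu> n = density (count_space UNIV) (weight n)"

lemma sets_mu [simp]: "sets (\<mu> n) = UNIV" "space (\<mu> n) = UNIV"
  by (simp_all add: \<mu>_def)

lemma emeasure_mu: "emeasure (\<mu> n) A = (\<integral>\<^sup>+z. weight n z \<partial>count_space A)"
  unfolding \<mu>_def by (subst emeasure_density) (simp_all add: nn_integral_count_space_indicator)

lemma base_point_interior:
  assumes "i \<in> P"
  shows "base_point i \<in> interior i"
proof -
  obtain a b where ab: "a < b" "interior i = {a<..<b}" using elementE[OF assms] by metis
  obtain y where "a < y" "y < b" using dense[OF ab(1)] by blast
  then have "y \<in> interior i" using ab by simp
  then show ?thesis unfolding base_point_def by (rule someI)
qed

text \<open>Atoms are placed at generic points, and preimages of generic points in the unit interval
  are generic.\<close>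

lemma weight_boundary: "z \<in> B \<or> z \<notin> {0..1} \<Longrightarrow> weight n z = 0"
proof (induction n arbitrary: z)
  case 0
  have "ennreal (u i) * indicator {base_point i} z = 0" if i: "i \<in> P" for i
  proof -
    have "base_point i \<noteq> z"
      using base_point_interior[OF i] 0 interior_not_boundary[OF i] interior_unit[OF i] by fastforce
    then show ?thesis by simp
  qed
  then have "weight 0 z = (\<integral>\<^sup>+i. 0 \<partial>count_space P)"
    unfolding weight.simps by (intro nn_integral_cong) simp
  then show ?case by simp
next
  case (Suc n)
  show ?case
  proof (cases "z \<in> {0..1}")
    case True
    then have "T z \<in> B" using Suc.prems boundary_invariant by blast
    then have "weight n (T z) = 0" using Suc.IH by blast
    then show ?thesis by simp
  next
    case False
    then show ?thesis unfolding weight.simps by (rule if_not_P)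
  qed
qed

text \<open>Conformality on sets where \<open>T\<close> is injective, by the change of variables
  from \<open>z\<close> to \<open>T z\<close> in the counting integral.\<close>

lemma mu_Suc_image:
  assumes "inj_on T A" "A \<subseteq> {0..1}"
  shows "emeasure (\<mu> (Suc n)) A = ennreal (1 / \<kappa>) * emeasure (\<mu> n) (T ` A)"
proof -
  have "emeasure (\<mu> (Suc n)) A = (\<integral>\<^sup>+z. ennreal (1 / \<kappa>) * weight n (T z) \<partial>count_space A)"
    unfolding emeasure_mu by (rule nn_integral_cong) (use assms(2) in auto)
  also have "\<dots> = ennreal (1 / \<kappa>) * (\<integral>\<^sup>+z. weight n (T z) \<partial>count_space A)"
    by (rule nn_integral_cmult) simp
  also have "(\<integral>\<^sup>+z. weight n (T z) \<partial>count_space A) = (\<integral>\<^sup>+z. weight n z \<partial>count_space (T ` A))"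
    by (rule nn_integral_bij_count_space) (use assms(1) in \<open>simp add: bij_betw_def\<close>)
  finally show ?thesis by (simp add: emeasure_mu)
qed

lemma mu_zero_boundary: "A \<inter> (\<Union>i\<in>P. interior i) = {} \<Longrightarrow> emeasure (\<mu> n) A = 0"
proof -
  assume A: "A \<inter> (\<Union>i\<in>P. interior i) = {}"
  have "weight n z = 0" if "z \<in> A" for z
    using A that by (intro weight_boundary) (auto simp: boundary_set_def)
  then have "emeasure (\<mu> n) A = (\<integral>\<^sup>+z. 0 \<partial>count_space A)"
    unfolding emeasure_mu by (intro nn_integral_cong) simp
  then show ?thesis by simp
qed

lemma mu_sum: "emeasure (\<mu> n) A = (\<integral>\<^sup>+\<alpha>. emeasure (\<mu> n) (A \<inter> interior \<alpha>) \<partial>count_space P)"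
proof -
  have "A = (A - (\<Union>i\<in>P. interior i)) \<union> (\<Union>i\<in>P. A \<inter> interior i)" by blast
  then have "emeasure (\<mu> n) A = emeasure (\<mu> n) ((A - (\<Union>i\<in>P. interior i)) \<union> (\<Union>i\<in>P. A \<inter> interior i))" by simp
  also have "\<dots> = emeasure (\<mu> n) (A - (\<Union>i\<in>P. interior i)) + emeasure (\<mu> n) (\<Union>i\<in>P. A \<inter> interior i)"
    by (rule plus_emeasure[symmetric]) auto
  also have "emeasure (\<mu> n) (A - (\<Union>i\<in>P. interior i)) = 0" by (rule mu_zero_boundary) blast
  also have "emeasure (\<mu> n) (\<Union>i\<in>P. A \<inter> interior i) = (\<integral>\<^sup>+\<alpha>. emeasure (\<mu> n) (A \<inter> interior \<alpha>) \<partial>count_space P)"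
  proof (rule emeasure_UN_countable)
    show "disjoint_family_on (\<lambda>i. A \<inter> interior i) P"
      unfolding disjoint_family_on_def
    proof (intro ballI impI)
      fix i k assume "i \<in> P" "k \<in> P" "i \<noteq> k"
      then show "A \<inter> interior i \<inter> (A \<inter> interior k) = {}" using disjoint_interiors by blast
    qed
  qed (simp_all add: countable_family)
  finally show ?thesis by simp
qed

text \<open>The pullback to \<open>i\<close> collects the mass of \<open>\<alpha>\<close> once for
  each preimage in \<open>i\<close>, that is \<open>fiber_count T i \<alpha>\<close> times, so the
  eigenvector equation cancels the factor \<open>1 / \<kappa>\<close>.\<close>

lemma mu_interior: "i \<in> P \<Longrightarrow> emeasure (\<mu> n) (interior i) = ennreal (u i)"
proof (induction n arbitrary: i)
  case 0
  have w: "weight 0 z = (if z = base_point i then ennreal (u i) else 0)" if z: "z \<in> interior i" for z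
  proof -
    define F where "F k = ennreal (u k) * indicator {base_point k} z" for k
    have "weight 0 z = (\<Sum>k\<in>{i}. F k)"
      unfolding weight.simps F_def
    proof (rule nn_integral_count_space')
      fix k assume k: "k \<in> P" "k \<notin> {i}"
      have "z \<noteq> base_point k"
        using base_point_interior[OF k(1)] interior_disjoint_unique[OF 0 k(1) z] k(2) by auto
      then show "ennreal (u k) * indicator {base_point k} z = 0" by simp
    qed (use 0 in auto)
    then have "weight 0 z = F i" by simp
    then show ?thesis by (simp add: F_def del: weight.simps)
  qed
  have "emeasure (\<mu> 0) (interior i) = (\<Sum>z\<in>{base_point i}. weight 0 z)"
    unfolding emeasure_mu by (rule nn_integral_count_space') (use base_point_interior[OF 0] w in \<open>simp_all del: weight.simps\<close>)
  then show ?case using w[OF base_point_interior[OF 0]] by (simp del: weight.simps)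
next
  case (Suc n)
  note i = Suc.prems
  \<comment> \<open>The weight is spread over the graph of \<open>T\<close> on \<open>i\<close>:
    summing over \<open>y\<close> first gives the pulled-back mass, summing over \<open>z\<close>
    first counts the preimages of \<open>y\<close>.\<close>
  define h where "h z y = (weight n y * indicator {z\<in>interior i. T z = y} z :: ennreal)" for z y
  have h1: "(\<integral>\<^sup>+y. h z y \<partial>count_space UNIV) = weight n (T z) * indicator (interior i) z" for z
  proof -
    have "(\<integral>\<^sup>+y. h z y \<partial>count_space UNIV) = (\<Sum>y\<in>{T z}. h z y)"
      by (rule nn_integral_count_space') (auto simp: h_def)
    also have "\<dots> = weight n (T z) * indicator (interior i) z" by (simp add: h_def indicator_def)
    finally show ?thesis .
  qed
  have h2: "(\<integral>\<^sup>+z. h z y \<partial>count_space UNIV) =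
      (\<integral>\<^sup>+\<alpha>. of_nat (fiber_count T i \<alpha>) * (weight n y * indicator (interior \<alpha>) y) \<partial>count_space P)" for y
  proof (cases "y \<in> {0..1} \<and> y \<notin> B")
    case False
    then have "weight n y = 0" using weight_boundary by blast
    then show ?thesis by (simp add: h_def)
  next
    case True
    then obtain \<alpha> where \<alpha>: "\<alpha> \<in> P" "y \<in> interior \<alpha>" using not_boundaryE by blast
    have eq: "{z\<in>interior i. T z = y} = {z\<in>i. T z = y}"
      using fiber_interior[OF i \<alpha>(1)] \<alpha>(2) interior_subset by blast
    have fin: "finite {z\<in>interior i. T z = y}" unfolding eq by (rule finite_fiber[OF i \<alpha>])
    have "(\<integral>\<^sup>+z. h z y \<partial>count_space UNIV) = (\<Sum>z\<in>{z\<in>interior i. T z = y}. h z y)"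
      by (rule nn_integral_count_space'[OF fin]) (auto simp: h_def)
    also have "\<dots> = (\<Sum>z\<in>{z\<in>interior i. T z = y}. weight n y)"
      by (rule sum.cong[OF refl]) (simp add: h_def)
    also have "\<dots> = of_nat (fiber_count T i \<alpha>) * weight n y"
      using fiber_count_eq[OF i \<alpha>] by (simp add: eq)
    also have "\<dots> = (\<Sum>\<beta>\<in>{\<alpha>}. of_nat (fiber_count T i \<beta>) * (weight n y * indicator (interior \<beta>) y))"
      using \<alpha> by simp
    also have "\<dots> = (\<integral>\<^sup>+\<beta>. of_nat (fiber_count T i \<beta>) * (weight n y * indicator (interior \<beta>) y) \<partial>count_space P)"
    proof (rule nn_integral_count_space'[symmetric])
      fix \<beta> assume "\<beta> \<in> P" "\<beta> \<notin> {\<alpha>}"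
      then have "y \<notin> interior \<beta>" using interior_disjoint_unique[OF _ \<alpha>(1) _ \<alpha>(2)] by blast
      then show "of_nat (fiber_count T i \<beta>) * (weight n y * indicator (interior \<beta>) y) = 0" by simp
    qed (use \<alpha> in auto)
    finally show ?thesis .
  qed
  define k where "k y \<alpha> = of_nat (fiber_count T i \<alpha>) * (weight n y * indicator (interior \<alpha>) y) * indicator P \<alpha>" for y \<alpha>
  have sub: "interior i \<subseteq> {0..1}" using element_subset[OF i] interior_subset by blast
  have "emeasure (\<mu> (Suc n)) (interior i) = (\<integral>\<^sup>+z. ennreal (1 / \<kappa>) * weight n (T z) \<partial>count_space (interior i))"
    unfolding emeasure_mu by (rule nn_integral_cong) (use sub in auto)
  also have "\<dots> = ennreal (1 / \<kappa>) * (\<integral>\<^sup>+z. weight n (T z) \<partial>count_space (interior i))"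
    by (rule nn_integral_cmult) simp
  also have "(\<integral>\<^sup>+z. weight n (T z) \<partial>count_space (interior i)) = (\<integral>\<^sup>+z. weight n (T z) * indicator (interior i) z \<partial>count_space UNIV)"
    by (simp add: nn_integral_count_space_indicator)
  also have "\<dots> = (\<integral>\<^sup>+z. \<integral>\<^sup>+y. h z y \<partial>count_space UNIV \<partial>count_space UNIV)" by (simp only: h1)
  also have "\<dots> = (\<integral>\<^sup>+y. \<integral>\<^sup>+z. h z y \<partial>count_space UNIV \<partial>count_space UNIV)"
    using nn_integral_fst_count_space[of "case_prod h"] nn_integral_snd_count_space[of "case_prod h"] by simp
  also have "\<dots> = (\<integral>\<^sup>+y. \<integral>\<^sup>+\<alpha>. k y \<alpha> \<partial>count_space UNIV \<partial>count_space UNIV)"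
    unfolding h2 k_def by (simp add: nn_integral_count_space_indicator)
  also have "\<dots> = (\<integral>\<^sup>+\<alpha>. \<integral>\<^sup>+y. k y \<alpha> \<partial>count_space UNIV \<partial>count_space UNIV)"
    using nn_integral_fst_count_space[of "case_prod k"] nn_integral_snd_count_space[of "case_prod k"] by simp
  also have "\<dots> = (\<integral>\<^sup>+\<alpha>. (\<integral>\<^sup>+y. of_nat (fiber_count T i \<alpha>) * (weight n y * indicator (interior \<alpha>) y) \<partial>count_space UNIV) * indicator P \<alpha> \<partial>count_space UNIV)"
    unfolding k_def by (simp add: nn_integral_multc)
  also have "\<dots> = (\<integral>\<^sup>+\<alpha>. (\<integral>\<^sup>+y. of_nat (fiber_count T i \<alpha>) * (weight n y * indicator (interior \<alpha>) y) \<partial>count_space UNIV) \<partial>count_space P)"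
    by (simp add: nn_integral_count_space_indicator)
  also have "\<dots> = (\<integral>\<^sup>+\<alpha>. of_nat (fiber_count T i \<alpha>) * ennreal (u \<alpha>) \<partial>count_space P)"
  proof (rule nn_integral_cong)
    fix \<alpha> assume "\<alpha> \<in> space (count_space P)"
    then have "\<alpha> \<in> P" by simp
    have "(\<integral>\<^sup>+y. of_nat (fiber_count T i \<alpha>) * (weight n y * indicator (interior \<alpha>) y) \<partial>count_space UNIV) =
      of_nat (fiber_count T i \<alpha>) * (\<integral>\<^sup>+y. weight n y * indicator (interior \<alpha>) y \<partial>count_space UNIV)"
      by (rule nn_integral_cmult) simp
    also have "(\<integral>\<^sup>+y. weight n y * indicator (interior \<alpha>) y \<partial>count_space UNIV) = emeasure (\<mu> n) (interior \<alpha>)"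
      by (simp add: emeasure_mu nn_integral_count_space_indicator)
    also have "\<dots> = ennreal (u \<alpha>)" by (rule Suc.IH[OF \<open>\<alpha> \<in> P\<close>])
    finally show "(\<integral>\<^sup>+y. of_nat (fiber_count T i \<alpha>) * (weight n y * indicator (interior \<alpha>) y) \<partial>count_space UNIV) =
      of_nat (fiber_count T i \<alpha>) * ennreal (u \<alpha>)" .
  qed
  also have "\<dots> = ennreal (\<kappa> * u i)" by (rule u_eigen[OF i])
  also have "ennreal (1 / \<kappa>) * ennreal (\<kappa> * u i) = ennreal (u i)"
    using lambda u_pos[OF i] by (simp add: ennreal_mult[symmetric])
  finally show ?case .
qed

lemma mu_total: "emeasure (\<mu> n) UNIV = 1"
proof -
  have "emeasure (\<mu> n) UNIV = (\<integral>\<^sup>+\<alpha>. ennreal (u \<alpha>) \<partial>count_space P)"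
    by (subst mu_sum) (rule nn_integral_cong, simp add: mu_interior)
  then show ?thesis using u_total by simp
qed

section \<open>Distribution functions and their limit\<close>

sublocale mu: finite_measure "\<mu> n" for n
  by (rule finite_measureI) (simp add: mu_total)

text \<open>For boundary points \<open>s \<le> t\<close> this is the mass between them under every
  \<open>\<mu> n\<close>, see \<open>mu_between_boundary\<close>.\<close>

definition total :: "real \<Rightarrow> real \<Rightarrow> real" where
  "total s t = enn2real (\<integral>\<^sup>+i. ennreal (u i) * indicator {i. i \<subseteq> {s..t}} i \<partial>count_space P)"

lemma total_finite: "(\<integral>\<^sup>+i. ennreal (u i) * indicator X i \<partial>count_space P) < \<infinity>"
proof -
  have "(\<integral>\<^sup>+i. ennreal (u i) * indicator X i \<partial>count_space P) \<le> (\<integral>\<^sup>+i. ennreal (u i) \<partial>count_space P)"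
    by (rule nn_integral_mono) (auto simp: indicator_def)
  then show ?thesis using u_total by (metis ennreal_one_less_top infinity_ennreal_def order_le_less_trans)
qed

text \<open>A boundary point never cuts the interior of an element, so each element counts fully or
  not at all, whatever \<open>n\<close> is and whichever ends are included.\<close>

lemma mu_between_boundary:
  assumes st: "s \<in> B" "t \<in> B" "s \<le> t"
  shows "measure (\<mu> n) {s<..t} = total s t" "measure (\<mu> n) {s..<t} = total s t"
proof -
  have main: "measure (\<mu> n) A = total s t" if A: "{s<..<t} \<subseteq> A" "A \<subseteq> {s..t}" for A
  proof -
    have "emeasure (\<mu> n) (A \<inter> interior \<alpha>) = ennreal (u \<alpha>) * indicator {i. i \<subseteq> {s..t}} \<alpha>" if \<alpha>: "\<alpha> \<in> P" for \<alpha>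
    proof -
      obtain a b where ab: "a < b" "\<alpha> = {a..b}" "interior \<alpha> = {a<..<b}" using elementE[OF \<alpha>] by metis
      have s: "s \<notin> {a<..<b}" "t \<notin> {a<..<b}" using interior_not_boundary[OF \<alpha>] st ab by auto
      show ?thesis
      proof (cases "s \<le> a \<and> b \<le> t")
        case True
        then have "{a<..<b} \<subseteq> {s<..<t}" by auto
        then have "A \<inter> interior \<alpha> = interior \<alpha>" using A ab by auto
        then show ?thesis using True ab mu_interior[OF \<alpha>] by simp
      next
        case False
        then have "{a<..<b} \<inter> {s..t} = {}" using s ab(1) by (auto simp: not_le)
        then have "A \<inter> interior \<alpha> = {}" using A ab by auto
        then show ?thesis using False ab by simp
      qed
    qed
    then have "emeasure (\<mu> n) A = (\<integral>\<^sup>+i. ennreal (u i) * indicator {i. i \<subseteq> {s..t}} i \<partial>count_space P)"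
      by (subst mu_sum) (rule nn_integral_cong, simp)
    then show ?thesis by (simp add: measure_def total_def)
  qed
  show "measure (\<mu> n) {s<..t} = total s t" "measure (\<mu> n) {s..<t} = total s t"
    by (rule main; force)+
qed

lemma total_element:
  assumes "{l..r} \<in> P"
  shows "total l r = u {l..r}"
proof -
  obtain a b where "a < b" "{l..r} = {a..b}" using elementE[OF assms] by metis
  then have lr: "l < r" by auto
  have "(\<integral>\<^sup>+i. ennreal (u i) * indicator {i. i \<subseteq> {l..r}} i \<partial>count_space P) =
      (\<Sum>i\<in>{{l..r}}. ennreal (u i) * indicator {i. i \<subseteq> {l..r}} i)"
  proof (rule nn_integral_count_space')
    fix k assume k: "k \<in> P" "k \<notin> {{l..r}}"
    have "\<not> k \<subseteq> {l..r}"
    proof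
      assume "k \<subseteq> {l..r}"
      then have "interior k \<subseteq> interior {l..r}" by (rule interior_mono)
      then have "base_point k \<in> interior {l..r}" using base_point_interior[OF k(1)] by blast
      then show False using interior_disjoint_unique[OF k(1) assms base_point_interior[OF k(1)]] k(2) by blast
    qed
    then show "ennreal (u k) * indicator {i. i \<subseteq> {l..r}} k = 0" by simp
  qed (use assms in auto)
  then show ?thesis using u_pos[OF assms] by (simp add: total_def)
qed

lemma total_unit: "total 0 1 = 1"
proof -
  have "(\<integral>\<^sup>+i. ennreal (u i) * indicator {i. i \<subseteq> {0..1}} i \<partial>count_space P) = (\<integral>\<^sup>+i. ennreal (u i) \<partial>count_space P)"
    by (rule nn_integral_cong) (use element_subset in auto)
  then show ?thesis using u_total by (simp add: total_def)
qed

text \<open>Averaging the two distribution functions makes the scaling relation exact in spite of the atoms.\<close>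

definition dist_fun :: "nat \<Rightarrow> real \<Rightarrow> real" where
  "dist_fun n x = (measure (\<mu> n) {0..x} + measure (\<mu> n) {0..<x}) / 2"

lemma dist_fun_diff:
  assumes "0 \<le> x" "x \<le> x'"
  shows "dist_fun n x' - dist_fun n x = (measure (\<mu> n) {x<..x'} + measure (\<mu> n) {x..<x'}) / 2"
proof -
  have "measure (\<mu> n) {0..x'} = measure (\<mu> n) {0..x} + measure (\<mu> n) {x<..x'}"
    using assms by (subst mu.finite_measure_Union[symmetric]) (auto intro!: arg_cong[where f="measure (\<mu> n)"])
  moreover have "measure (\<mu> n) {0..<x'} = measure (\<mu> n) {0..<x} + measure (\<mu> n) {x..<x'}"
    using assms by (subst mu.finite_measure_Union[symmetric]) (auto intro!: arg_cong[where f="measure (\<mu> n)"])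
  ultimately show ?thesis by (simp add: dist_fun_def field_simps)
qed

lemma dist_fun_mono:
  assumes "0 \<le> x" "x \<le> x'"
  shows "dist_fun n x \<le> dist_fun n x'"
proof -
  have "0 \<le> dist_fun n x' - dist_fun n x" unfolding dist_fun_diff[OF assms] by simp
  then show ?thesis by simp
qed

lemma dist_fun_unit: "dist_fun n x \<in> {0..1}"
proof -
  have "measure (\<mu> n) A \<le> 1" for A
  proof -
    have "measure (\<mu> n) A \<le> measure (\<mu> n) UNIV" by (rule mu.finite_measure_mono) auto
    then show ?thesis by (simp add: measure_def mu_total)
  qed
  from this[of "{0..x}"] this[of "{0..<x}"] show ?thesis
    unfolding dist_fun_def using measure_nonneg[of "\<mu> n" "{0..x}"] measure_nonneg[of "\<mu> n" "{0..<x}"] by simp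
qed

lemma dist_fun_boundary:
  assumes "s \<in> B" "t \<in> B" "s \<le> t"
  shows "dist_fun n t - dist_fun n s = total s t"
proof -
  have "0 \<le> s" using assms(1) boundary_unit by auto
  then show ?thesis unfolding dist_fun_diff[OF \<open>0 \<le> s\<close> assms(3)] mu_between_boundary[OF assms] by simp
qed

lemma dist_fun_zero: "dist_fun n 0 = 0"
proof -
  have "emeasure (\<mu> n) {0} = 0" by (rule mu_zero_boundary) (use interior_unit in force)
  then show ?thesis by (simp add: dist_fun_def measure_def)
qed

text \<open>Where \<open>T\<close> decreases, the images of \<open>{x<..x'}\<close> and
  \<open>{x..<x'}\<close> are open at the opposite ends; the average of the two masses is symmetric,
  so one formula covers both orientations.\<close>

lemma dist_fun_scaling:
  assumes x: "0 \<le> x" "x < x'" "x' \<le> 1" and inj: "inj_on T {x..x'}"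
  shows "\<kappa> * (dist_fun (Suc n) x' - dist_fun (Suc n) x) = \<bar>dist_fun n (T x') - dist_fun n (T x)\<bar>"
proof -
  have sub: "{x..x'} \<subseteq> {0..1}" using x by auto
  have cont': "continuous_on {x..x'} T" by (rule continuous_on_subset[OF cont sub])
  have m: "measure (\<mu> (Suc n)) A = (1 / \<kappa>) * measure (\<mu> n) (T ` A)" if A: "A \<subseteq> {x..x'}" for A
  proof -
    have "A \<subseteq> {0..1}" using A sub by blast
    then have "emeasure (\<mu> (Suc n)) A = ennreal (1 / \<kappa>) * emeasure (\<mu> n) (T ` A)"
      by (rule mu_Suc_image[OF inj_on_subset[OF inj A]])
    then show ?thesis using lambda by (simp only: measure_def enn2real_mult) simp
  qed
  have d: "dist_fun (Suc n) x' - dist_fun (Suc n) x =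
      (1 / \<kappa>) * ((measure (\<mu> n) (T ` {x<..x'}) + measure (\<mu> n) (T ` {x..<x'})) / 2)"
  proof -
    have xx: "0 \<le> x" "x \<le> x'" using x by auto
    have m1: "measure (\<mu> (Suc n)) {x<..x'} = (1 / \<kappa>) * measure (\<mu> n) (T ` {x<..x'})" by (rule m) auto
    have m2: "measure (\<mu> (Suc n)) {x..<x'} = (1 / \<kappa>) * measure (\<mu> n) (T ` {x..<x'})" by (rule m) auto
    show ?thesis unfolding dist_fun_diff[OF xx] m1 m2 by (simp add: add_divide_distrib)
  qed
  have T01: "0 \<le> T x" "0 \<le> T x'" using maps_point[of x] maps_point[of x'] x by auto
  have "(measure (\<mu> n) (T ` {x<..x'}) + measure (\<mu> n) (T ` {x..<x'})) / 2 = \<bar>dist_fun n (T x') - dist_fun n (T x)\<bar>"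
    using inj_continuous_image_interval[OF cont' inj x(2)]
  proof
    assume a: "T x < T x' \<and> T ` {x..x'} = {T x..T x'} \<and> T ` {x<..x'} = {T x<..T x'} \<and> T ` {x..<x'} = {T x..<T x'}"
    then have "dist_fun n (T x') - dist_fun n (T x) = (measure (\<mu> n) (T ` {x<..x'}) + measure (\<mu> n) (T ` {x..<x'})) / 2"
      using dist_fun_diff[of "T x" "T x'" n] T01 by simp
    moreover have "dist_fun n (T x) \<le> dist_fun n (T x')" using dist_fun_mono a T01 by simp
    ultimately show ?thesis by simp
  next
    assume a: "T x' < T x \<and> T ` {x..x'} = {T x'..T x} \<and> T ` {x<..x'} = {T x'..<T x} \<and> T ` {x..<x'} = {T x'<..T x}"
    then have "dist_fun n (T x) - dist_fun n (T x') = (measure (\<mu> n) (T ` {x<..x'}) + measure (\<mu> n) (T ` {x..<x'})) / 2"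
      using dist_fun_diff[of "T x'" "T x" n] T01 by simp
    moreover have "dist_fun n (T x') \<le> dist_fun n (T x)" using dist_fun_mono a T01 by simp
    ultimately show ?thesis by simp
  qed
  then show ?thesis using d lambda by simp
qed

text \<open>The scaling relation links the levels \<open>n + 1\<close> and \<open>n\<close>. Cesaro
  means along a cluster filter merge the levels: shifting the index changes a mean by
  \<open>(e n - e 0) / n\<close>, which tends to 0.\<close>

lemma scaling_function_exists:
  obtains \<phi> where "\<And>x. \<phi> x \<in> {0..1}" "\<phi> 0 = 0" "\<phi> 1 = 1"
    "\<And>x x'. 0 \<le> x \<Longrightarrow> x \<le> x' \<Longrightarrow> \<phi> x \<le> \<phi> x'"
    "\<And>s t. s \<in> B \<Longrightarrow> t \<in> B \<Longrightarrow> s \<le> t \<Longrightarrow> \<phi> t - \<phi> s = total s t"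
    "\<And>x x'. 0 \<le> x \<Longrightarrow> x < x' \<Longrightarrow> x' \<le> 1 \<Longrightarrow> inj_on T {x..x'} \<Longrightarrow> \<kappa> * (\<phi> x' - \<phi> x) = \<bar>\<phi> (T x') - \<phi> (T x)\<bar>"
proof -
  define b where "b n x = (\<Sum>k<n. dist_fun k x) / real n" for n x
  have b01: "b n x \<in> {0..1}" for n x
  proof (cases "n = 0")
    case False
    have "0 \<le> (\<Sum>k<n. dist_fun k x)" using dist_fun_unit by (intro sum_nonneg) auto
    moreover have "(\<Sum>k<n. dist_fun k x) \<le> (\<Sum>k<n. 1)" using dist_fun_unit by (intro sum_mono) auto
    ultimately show ?thesis using False by (simp add: b_def divide_simps)
  qed (simp add: b_def)
  obtain G \<phi> where G\<phi>: "G \<noteq> bot \<and> G \<le> sequentially \<and> (\<forall>x. ((\<lambda>n. b n x) \<longlongrightarrow> \<phi> x) G)"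
    using cluster_filter[where b=b, OF b01] by blast
  then have G: "G \<noteq> bot" "G \<le> sequentially" and lim: "\<And>x. ((\<lambda>n. b n x) \<longlongrightarrow> \<phi> x) G"
    by simp_all
  have ev: "eventually Q G" if "\<And>n. n \<ge> 1 \<Longrightarrow> Q n" for Q
    by (rule filter_leD[OF G(2)]) (use that in \<open>auto simp: eventually_sequentially\<close>)
  have mono: "\<phi> x \<le> \<phi> x'" if "0 \<le> x" "x \<le> x'" for x x'
  proof (rule tendsto_le[OF G(1) lim lim])
    show "eventually (\<lambda>n. b n x \<le> b n x') G"
      by (rule ev) (use that in \<open>auto simp: b_def intro!: divide_right_mono sum_mono dist_fun_mono\<close>)
  qed
  have bd: "\<phi> t - \<phi> s = total s t" if "s \<in> B" "t \<in> B" "s \<le> t" for s t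
  proof -
    have "b n t - b n s = total s t" if "n \<ge> 1" for n
    proof -
      have "b n t - b n s = (\<Sum>k<n. dist_fun k t - dist_fun k s) / real n"
        by (simp add: b_def sum_subtractf diff_divide_distrib)
      also have "\<dots> = total s t" using dist_fun_boundary[OF \<open>s \<in> B\<close> \<open>t \<in> B\<close> \<open>s \<le> t\<close>] that by simp
      finally show ?thesis .
    qed
    then have "eventually (\<lambda>n. b n t - b n s = total s t) G" by (rule ev)
    then have "((\<lambda>n. b n t - b n s) \<longlongrightarrow> total s t) G" by (rule tendsto_eventually)
    then show ?thesis using tendsto_unique[OF G(1) tendsto_diff[OF lim lim]] by blast
  qed
  have z: "\<phi> 0 = 0"
  proof -
    have "((\<lambda>n. b n 0) \<longlongrightarrow> 0) G" by (simp add: b_def dist_fun_zero)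
    then show ?thesis using tendsto_unique[OF G(1) lim] by blast
  qed
  show ?thesis
  proof (rule that[of \<phi>])
    show "\<phi> x \<in> {0..1}" for x
    proof -
      have "0 \<le> \<phi> x" by (rule tendsto_lowerbound[OF lim _ G(1)]) (use b01 in simp)
      moreover have "\<phi> x \<le> 1" by (rule tendsto_upperbound[OF lim _ G(1)]) (use b01 in simp)
      ultimately show ?thesis by simp
    qed
    show "\<phi> 0 = 0" by (rule z)
    show "\<phi> 1 = 1" using bd[OF zero_one_boundary] total_unit z by simp
    show "\<phi> x \<le> \<phi> x'" if "0 \<le> x" "x \<le> x'" for x x' using mono that by blast
    show "\<phi> t - \<phi> s = total s t" if "s \<in> B" "t \<in> B" "s \<le> t" for s t using bd that by blast
    show "\<kappa> * (\<phi> x' - \<phi> x) = \<bar>\<phi> (T x') - \<phi> (T x)\<bar>" if x: "0 \<le> x" "x < x'" "x' \<le> 1" and inj: "inj_on T {x..x'}" for x x'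
    proof -
      \<comment> \<open>All distribution functions are increasing, so the absolute values open with
        one common sign \<open>\<sigma>\<close> and commute with the averages.\<close>
      define \<sigma> :: real where "\<sigma> = (if T x \<le> T x' then 1 else -1)"
      have T01: "0 \<le> T x" "0 \<le> T x'" using maps_point[of x] maps_point[of x'] x by auto
      have abs_d: "\<bar>dist_fun n (T x') - dist_fun n (T x)\<bar> = \<sigma> * (dist_fun n (T x') - dist_fun n (T x))" for n
        using dist_fun_mono[of "T x" "T x'" n] dist_fun_mono[of "T x'" "T x" n] T01 by (auto simp: \<sigma>_def)
      have abs_p: "\<bar>\<phi> (T x') - \<phi> (T x)\<bar> = \<sigma> * (\<phi> (T x') - \<phi> (T x))"
        using mono[of "T x" "T x'"] mono[of "T x'" "T x"] T01 by (auto simp: \<sigma>_def)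
      define e where "e n = dist_fun n x' - dist_fun n x" for n
      have e01: "\<bar>e n\<bar> \<le> 1" for n using dist_fun_unit[of n x] dist_fun_unit[of n x'] by (auto simp: e_def abs_le_iff)
      have step: "\<kappa> * e (Suc n) = \<sigma> * (dist_fun n (T x') - dist_fun n (T x))" for n
        using dist_fun_scaling[OF x inj, of n] abs_d by (simp add: e_def)
      have eq: "\<kappa> * (b n x' - b n x) + \<kappa> * ((e n - e 0) / real n) = \<sigma> * (b n (T x') - b n (T x))" if "n \<ge> 1" for n
      proof -
        have b_diff: "b n y' - b n y = (\<Sum>k<n. dist_fun k y' - dist_fun k y) / real n" for y y'
          by (simp add: b_def sum_subtractf diff_divide_distrib)
        have "(\<Sum>k<n. e (Suc k)) = (\<Sum>k<n. e k) + (e n - e 0)"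
          by (induction n) simp_all
        then have "\<kappa> * ((\<Sum>k<n. e k) + (e n - e 0)) = (\<Sum>k<n. \<kappa> * e (Suc k))"
          by (simp only: sum_distrib_left[symmetric])
        also have "\<dots> = \<sigma> * (\<Sum>k<n. dist_fun k (T x') - dist_fun k (T x))"
          unfolding step by (rule sum_distrib_left[symmetric])
        finally have "\<kappa> * ((\<Sum>k<n. e k) + (e n - e 0)) / real n = \<sigma> * (\<Sum>k<n. dist_fun k (T x') - dist_fun k (T x)) / real n" by simp
        then show ?thesis unfolding b_diff e_def[symmetric] by (simp add: add_divide_distrib distrib_left)
      qed
      have "((\<lambda>n. (e n - e 0) / real n) \<longlongrightarrow> 0) sequentially"
      proof (rule Lim_null_comparison)
        show "\<forall>\<^sub>F n in sequentially. norm ((e n - e 0) / real n) \<le> 2 / real n"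
        proof (rule always_eventually, rule allI)
          fix n
          have "\<bar>e n - e 0\<bar> \<le> 2" using e01[of n] e01[of 0] by linarith
          then show "norm ((e n - e 0) / real n) \<le> 2 / real n" by (simp add: divide_right_mono)
        qed
        show "(\<lambda>n. 2 / real n) \<longlonglongrightarrow> 0" by (rule lim_const_over_n)
      qed
      then have null: "((\<lambda>n. (e n - e 0) / real n) \<longlongrightarrow> 0) G" using G(2) by (rule tendsto_mono[rotated])
      have lhs: "((\<lambda>n. \<kappa> * (b n x' - b n x) + \<kappa> * ((e n - e 0) / real n)) \<longlongrightarrow> \<kappa> * (\<phi> x' - \<phi> x) + \<kappa> * 0) G"
        by (intro tendsto_intros lim null)
      have rhs: "((\<lambda>n. \<sigma> * (b n (T x') - b n (T x))) \<longlongrightarrow> \<sigma> * (\<phi> (T x') - \<phi> (T x))) G"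
        by (intro tendsto_intros lim)
      have "eventually (\<lambda>n. \<kappa> * (b n x' - b n x) + \<kappa> * ((e n - e 0) / real n) = \<sigma> * (b n (T x') - b n (T x))) G"
        by (rule ev) (rule eq)
      then have "((\<lambda>n. \<sigma> * (b n (T x') - b n (T x))) \<longlongrightarrow> \<kappa> * (\<phi> x' - \<phi> x) + \<kappa> * 0) G"
        by (rule Lim_transform_eventually[OF lhs])
      then have "\<kappa> * (\<phi> x' - \<phi> x) + \<kappa> * 0 = \<sigma> * (\<phi> (T x') - \<phi> (T x))"
        using rhs by (rule tendsto_unique[OF G(1)])
      then show ?thesis using abs_p by simp
    qed
  qed
qed

end

text \<open>On one side of \<open>x\<close> only one of finitely many monotone pieces matters.
  Injectivity across \<open>x\<close> cannot be expected, since \<open>x\<close> may be a turning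
  point.\<close>

lemma (in mixing_system) one_sided_injectivity:
  assumes "{l..r} \<in> P"
  shows "l \<le> x \<Longrightarrow> x < r \<Longrightarrow> \<exists>t>x. t \<le> r \<and> inj_on T {x..t}"
    and "l < x \<Longrightarrow> x \<le> r \<Longrightarrow> \<exists>t<x. l \<le> t \<and> inj_on T {t..x}"
proof -
  obtain D where D: "D division_of {l..r}" "\<And>J. J \<in> D \<Longrightarrow> monotone_map_on J T"
    using piecewise_monotone[OF assms] unfolding piecewise_monotone_on_def by blast
  have fin: "finite D" using D(1) by (rule division_ofD)
  have J: "\<exists>u w. J = {u..w} \<and> inj_on T {u..w}" if JD: "J \<in> D" for J
  proof -
    obtain u w where uw: "J = {u..w}" using division_ofD(4)[OF D(1) JD] by auto
    have "J \<subseteq> {0..1}" using division_ofD(2)[OF D(1) JD] element_subset[OF assms] by blast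
    then have "inj_on T J"
      using D(2)[OF JD] uw by (intro mixing_monotone_imp_inj cont maps mixing) (auto simp: is_interval_cc)
    then show ?thesis using uw by blast
  qed
  then obtain lo hi where LH: "\<And>J. J \<in> D \<Longrightarrow> J = {lo J..hi J} \<and> inj_on T {lo J..hi J}" by metis
  have cover: "\<exists>J\<in>D. t \<in> J" if "t \<in> {l..r}" for t
    using that unfolding division_ofD(6)[OF D(1), symmetric] by (rule UnionE) (rule bexI)
  show "\<exists>t>x. t \<le> r \<and> inj_on T {x..t}" if x: "l \<le> x" "x < r"
  proof -
    \<comment> \<open>Thanks to the midpoints, \<open>t\<close> comes before every piece that starts
      to the right of \<open>x\<close>, so a piece containing \<open>t\<close> starts at or before
      \<open>x\<close> and covers \<open>{x..t}\<close>.\<close>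
    define X where "X = insert r ((\<lambda>J. (x + lo J) / 2) ` {J\<in>D. x < lo J})"
    have X: "finite X" "X \<noteq> {}" using fin by (auto simp: X_def)
    define t where "t = Min X"
    have "x < t" unfolding t_def using X x by (subst Min_gr_iff) (auto simp: X_def)
    have "t \<le> r" unfolding t_def using X by (intro Min_le) (auto simp: X_def)
    obtain J where JD: "J \<in> D" "t \<in> J" using cover[of t] \<open>x < t\<close> \<open>t \<le> r\<close> x by auto
    have tJ: "lo J \<le> t" "t \<le> hi J" using LH[OF JD(1)] JD(2) by auto
    have "lo J \<le> x"
    proof (rule ccontr)
      assume "\<not> lo J \<le> x"
      then have "(x + lo J) / 2 \<in> X" using JD(1) by (auto simp: X_def)
      then have "t \<le> (x + lo J) / 2" unfolding t_def using X(1) by (rule Min_le[rotated])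
      then have "2 * t \<le> x + lo J" by simp
      then show False using tJ \<open>\<not> lo J \<le> x\<close> by linarith
    qed
    then have "{x..t} \<subseteq> {lo J..hi J}" using tJ by auto
    then have "inj_on T {x..t}" using LH[OF JD(1)] by (meson inj_on_subset)
    then show ?thesis using \<open>x < t\<close> \<open>t \<le> r\<close> by blast
  qed
  show "\<exists>t<x. l \<le> t \<and> inj_on T {t..x}" if x: "l < x" "x \<le> r"
  proof -
    define X where "X = insert l ((\<lambda>J. (x + hi J) / 2) ` {J\<in>D. hi J < x})"
    have X: "finite X" "X \<noteq> {}" using fin by (auto simp: X_def)
    define t where "t = Max X"
    have "t < x" unfolding t_def using X x by (subst Max_less_iff) (auto simp: X_def)
    have "l \<le> t" unfolding t_def using X by (intro Max_ge) (auto simp: X_def)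
    obtain J where JD: "J \<in> D" "t \<in> J" using cover[of t] \<open>t < x\<close> \<open>l \<le> t\<close> x by auto
    have tJ: "lo J \<le> t" "t \<le> hi J" using LH[OF JD(1)] JD(2) by auto
    have "x \<le> hi J"
    proof (rule ccontr)
      assume "\<not> x \<le> hi J"
      then have "(x + hi J) / 2 \<in> X" using JD(1) by (auto simp: X_def)
      then have "(x + hi J) / 2 \<le> t" unfolding t_def using X(1) by (rule Max_ge[rotated])
      then have "x + hi J \<le> 2 * t" by simp
      then show False using tJ \<open>\<not> x \<le> hi J\<close> by linarith
    qed
    then have "{t..x} \<subseteq> {lo J..hi J}" using tJ by auto
    then have "inj_on T {t..x}" using LH[OF JD(1)] by (meson inj_on_subset)
    then show ?thesis using \<open>t < x\<close> \<open>l \<le> t\<close> by blast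
  qed
qed

text \<open>The source of the exceptional set of the derivative. \<open>T\<close> is injective on
  each of the countably many monotone pieces, so the countable set \<open>B\<close> has a countable
  preimage.\<close>

lemma (in mixing_system) countable_boundary_preimage: "countable {x\<in>{0..1}. T x \<in> B}"
proof -
  have el: "countable {x\<in>i. T x \<in> B}" if i: "i \<in> P" for i
  proof -
    obtain D where D: "D division_of i" "\<And>J. J \<in> D \<Longrightarrow> monotone_map_on J T"
      using piecewise_monotone[OF i] unfolding piecewise_monotone_on_def by blast
    have J: "countable {x\<in>J. T x \<in> B}" if JD: "J \<in> D" for J
    proof -
      obtain u w where uw: "J = {u..w}" using division_ofD(4)[OF D(1) JD] by auto
      have "J \<subseteq> {0..1}" using division_ofD(2)[OF D(1) JD] element_subset[OF i] by blast
      then have "inj_on T J"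
        using D(2)[OF JD] uw by (intro mixing_monotone_imp_inj cont maps mixing) (auto simp: is_interval_cc)
      then have "inj_on T {x\<in>J. T x \<in> B}" by (rule inj_on_subset) blast
      moreover have "countable (T ` {x\<in>J. T x \<in> B})"
        by (rule countable_subset[OF _ countable_boundary]) blast
      ultimately show ?thesis using countable_image_inj_on by blast
    qed
    have "{x\<in>i. T x \<in> B} = (\<Union>J\<in>D. {x\<in>J. T x \<in> B})"
      using division_ofD(6)[OF D(1)] by blast
    then show ?thesis using J division_ofD(1)[OF D(1)] by (simp add: countable_finite)
  qed
  have "{x\<in>{0..1}. T x \<in> B} \<subseteq> ({0..1} - \<Union>P) \<union> (\<Union>i\<in>P. {x\<in>i. T x \<in> B})" by blast
  then show ?thesis
    by (rule countable_subset) (use el countable_rest countable_family in simp)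
qed

section \<open>The limit function is a conjugacy\<close>

context eigenmeasure
begin

text \<open>By summability finitely many elements carry mass more than
  \<open>1 - \<epsilon>\<close>; an interval containing none of them has only the rest to
  offer.\<close>

lemma total_tail:
  assumes "\<epsilon> > 0"
  obtains F where "finite F" "F \<subseteq> P"
    "\<And>s t. (\<And>i. i \<in> F \<Longrightarrow> \<not> i \<subseteq> {s..t}) \<Longrightarrow> total s t < \<epsilon>"
proof -
  have sup: "(\<integral>\<^sup>+i. ennreal (u i) \<partial>count_space P) = (SUP F\<in>{F. finite F \<and> F \<subseteq> P}. (\<Sum>i\<in>F. ennreal (u i)))"
    unfolding infsum_ennreal_eq_nn_integral[OF countable_family, symmetric]
    by (rule nonneg_infsum_complete) simp
  define e where "e = min \<epsilon> 1 / 2"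
  have e: "0 < e" "e < 1" "e < \<epsilon>" using assms by (auto simp: e_def)
  have "ennreal (1 - e) < (SUP F\<in>{F. finite F \<and> F \<subseteq> P}. (\<Sum>i\<in>F. ennreal (u i)))"
    using sup u_total e by (simp add: ennreal_less_one_iff)
  then obtain F where F: "finite F" "F \<subseteq> P" "ennreal (1 - e) < (\<Sum>i\<in>F. ennreal (u i))"
    unfolding less_SUP_iff by blast
  show ?thesis
  proof (rule that[OF F(1,2)])
    fix s t assume no: "\<And>i. i \<in> F \<Longrightarrow> \<not> i \<subseteq> {s..t}"
    let ?I = "\<integral>\<^sup>+i. ennreal (u i) * indicator {i. i \<subseteq> {s..t}} i \<partial>count_space P"
    have "(\<Sum>i\<in>F. ennreal (u i)) = (\<integral>\<^sup>+i. ennreal (u i) * indicator F i \<partial>count_space P)"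
      using F by (subst nn_integral_count_space'[of F]) auto
    then have "?I + (\<Sum>i\<in>F. ennreal (u i)) =
        (\<integral>\<^sup>+i. ennreal (u i) * indicator {i. i \<subseteq> {s..t}} i + ennreal (u i) * indicator F i \<partial>count_space P)"
      by (simp add: nn_integral_add)
    also have "\<dots> \<le> (\<integral>\<^sup>+i. ennreal (u i) \<partial>count_space P)"
      by (rule nn_integral_mono) (use no in \<open>auto simp: indicator_def\<close>)
    finally have le: "?I + (\<Sum>i\<in>F. ennreal (u i)) \<le> 1" using u_total by simp
    have "?I + ennreal (1 - e) \<le> ?I + (\<Sum>i\<in>F. ennreal (u i))"
      using F(3) by (intro add_left_mono) simp
    then have le2: "?I + ennreal (1 - e) \<le> 1" using le by (rule order_trans)
    have "?I \<noteq> top" using total_finite[of "{i. i \<subseteq> {s..t}}"] by simp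
    then have I: "?I = ennreal (total s t)" by (simp add: total_def less_top)
    have t0: "0 \<le> total s t" by (simp add: total_def)
    have "ennreal (total s t + (1 - e)) \<le> ennreal 1"
      using le2 t0 e unfolding I by (simp add: ennreal_plus)
    then have "total s t + (1 - e) \<le> 1" by (subst (asm) ennreal_le_iff) auto
    then show "total s t < \<epsilon>" using e by linarith
  qed
qed

text \<open>Heavy elements to the right of \<open>x\<close> start at a positive distance, and the
  short elements accumulating at \<open>x\<close> supply a boundary point before any of
  them.\<close>

lemma small_total_right:
  assumes x: "0 \<le> x" "x < 1" and no: "\<And>l r. {l..r} \<in> P \<Longrightarrow> l \<le> x \<Longrightarrow> x < r \<Longrightarrow> False" and e: "\<epsilon> > 0"
  shows "\<exists>b\<in>B. x < b \<and> total x b < \<epsilon>"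
proof -
  obtain F where F: "finite F" "F \<subseteq> P" "\<And>s t. (\<And>i. i \<in> F \<Longrightarrow> \<not> i \<subseteq> {s..t}) \<Longrightarrow> total s t < \<epsilon>"
    using total_tail[OF e] by blast
  define X where "X = insert 1 ((\<lambda>i. Inf i - x) ` {i\<in>F. x < Inf i})"
  have X: "finite X" "X \<noteq> {}" using F(1) by (auto simp: X_def)
  have pos: "Min X > 0" using X by (subst Min_gr_iff) (auto simp: X_def)
  obtain l r where lr: "{l..r} \<in> P" "x < l" "l < r" "r < x + Min X"
  proof (rule element_right[OF x _ pos])
    show False if "{l..r} \<in> P" "l \<le> x" "x < r" for l r using no[OF that] .
  qed auto
  have "\<not> i \<subseteq> {x..l}" if i: "i \<in> F" for i
  proof
    assume sub: "i \<subseteq> {x..l}"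
    obtain a b where ab: "a < b" "i = {a..b}" using elementE[of i] F(2) i by blast
    have "x \<le> a" "b \<le> l" using sub ab by auto
    have "x \<noteq> a" using no[of a b] F(2) i ab by auto
    then have "i \<in> {i\<in>F. x < Inf i}" using ab i \<open>x \<le> a\<close> by simp
    then have "(\<lambda>i. Inf i - x) i \<in> (\<lambda>i. Inf i - x) ` {i\<in>F. x < Inf i}" by (rule imageI)
    then have "Inf i - x \<in> X" unfolding X_def by (rule insertI2)
    then have "Min X \<le> a - x" using X(1) ab by (metis Min_le cInf_atLeastAtMost order_less_imp_le)
    then show False using lr ab \<open>b \<le> l\<close> by linarith
  qed
  then have "total x l < \<epsilon>" by (rule F(3))
  then show ?thesis using endpoints_boundary(1)[OF lr(1)] lr(2) by blast
qed

lemma small_total_left: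
  assumes x: "0 < x" "x \<le> 1" and no: "\<And>l r. {l..r} \<in> P \<Longrightarrow> l < x \<Longrightarrow> x \<le> r \<Longrightarrow> False" and e: "\<epsilon> > 0"
  shows "\<exists>b\<in>B. b < x \<and> total b x < \<epsilon>"
proof -
  obtain F where F: "finite F" "F \<subseteq> P" "\<And>s t. (\<And>i. i \<in> F \<Longrightarrow> \<not> i \<subseteq> {s..t}) \<Longrightarrow> total s t < \<epsilon>"
    using total_tail[OF e] by blast
  define X where "X = insert 1 ((\<lambda>i. x - Sup i) ` {i\<in>F. Sup i < x})"
  have X: "finite X" "X \<noteq> {}" using F(1) by (auto simp: X_def)
  have pos: "Min X > 0" using X by (subst Min_gr_iff) (auto simp: X_def)
  obtain l r where lr: "{l..r} \<in> P" "x - Min X < l" "l < r" "r < x"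
  proof (rule element_left[OF x _ pos])
    show False if "{l..r} \<in> P" "l < x" "x \<le> r" for l r using no[OF that] .
  qed auto
  have "\<not> i \<subseteq> {r..x}" if i: "i \<in> F" for i
  proof
    assume sub: "i \<subseteq> {r..x}"
    obtain a b where ab: "a < b" "i = {a..b}" using elementE[of i] F(2) i by blast
    have "b \<le> x" "r \<le> a" using sub ab by auto
    have "x \<noteq> b" using no[of a b] F(2) i ab by auto
    then have "i \<in> {i\<in>F. Sup i < x}" using ab i \<open>b \<le> x\<close> by simp
    then have "(\<lambda>i. x - Sup i) i \<in> (\<lambda>i. x - Sup i) ` {i\<in>F. Sup i < x}" by (rule imageI)
    then have "x - Sup i \<in> X" unfolding X_def by (rule insertI2)
    then have "Min X \<le> x - b" using X(1) ab by (metis Min_le cSup_atLeastAtMost order_less_imp_le)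
    then show False using lr ab \<open>r \<le> a\<close> by linarith
  qed
  then have "total r x < \<epsilon>" by (rule F(3))
  then show ?thesis using endpoints_boundary(2)[OF lr(1)] lr(4) by blast
qed

text \<open>The limit function is continuous by contraction and strictly increasing by mixing, hence
  a homeomorphism; the scaling relation then makes the conjugated map affine with slope
  \<open>\<kappa>\<close> or \<open>- \<kappa>\<close> near every point outside a countable
  set.\<close>

theorem constant_slope_conjugacy:
  obtains g where "continuous_on {0..1} g" "g ` {0..1} \<subseteq> {0..1}" "constant_slope g \<kappa>" "topologically_conjugate T g"
proof -
  obtain \<phi> where \<phi>: "\<And>x. \<phi> x \<in> {0..1}" "\<phi> 0 = 0" "\<phi> 1 = 1"
    and mono: "\<And>x x'. 0 \<le> x \<Longrightarrow> x \<le> x' \<Longrightarrow> \<phi> x \<le> \<phi> x'"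
    and bd: "\<And>s t. s \<in> B \<Longrightarrow> t \<in> B \<Longrightarrow> s \<le> t \<Longrightarrow> \<phi> t - \<phi> s = total s t"
    and scale: "\<And>x x'. 0 \<le> x \<Longrightarrow> x < x' \<Longrightarrow> x' \<le> 1 \<Longrightarrow> inj_on T {x..x'} \<Longrightarrow> \<kappa> * (\<phi> x' - \<phi> x) = \<bar>\<phi> (T x') - \<phi> (T x)\<bar>"
    using scaling_function_exists by blast
  have k0: "\<kappa> > 0" using lambda by simp
  have not_in: "x \<in> B" if x: "x \<in> {0..1}" and no: "\<And>l r. {l..r} \<in> P \<Longrightarrow> l < x \<Longrightarrow> x < r \<Longrightarrow> False" for x
  proof (rule ccontr)
    assume "x \<notin> B"
    then obtain i where i: "i \<in> P" "x \<in> interior i" using not_boundaryE[OF x] by blast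
    obtain a b where "i = {a..b}" "interior i = {a<..<b}" using elementE[OF i(1)] by metis
    then show False using no[of a b] i by simp
  qed
  \<comment> \<open>Induction on \<open>n\<close>, one side at a time: where an element adjoins
    \<open>x\<close>, \<open>T\<close> is injective on that side and the scaling relation divides
    the oscillation at \<open>T x\<close> by \<open>\<kappa>\<close>; where none adjoins, the totals
    themselves are small.\<close>
  have osc: "\<exists>d>0. \<forall>t\<in>{0..1}. \<bar>t - x\<bar> < d \<longrightarrow> \<bar>\<phi> t - \<phi> x\<bar> \<le> (1 / \<kappa>) ^ n" if "x \<in> {0..1}" for x n
    using that
  proof (induction n arbitrary: x)
    case 0
    have "\<bar>\<phi> t - \<phi> x\<bar> \<le> 1" for t using \<phi>(1)[of t] \<phi>(1)[of x] by (auto simp: abs_le_iff)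
    then show ?case by (intro exI[of _ 1]) simp
  next
    case (Suc n)
    define e where "e = (1 / \<kappa>) ^ Suc n"
    have e0: "e > 0" using k0 by (simp add: e_def)
    have Tx: "T x \<in> {0..1}" using maps_point Suc.prems by blast
    obtain d1 where d1: "d1 > 0" "\<And>t. t \<in> {0..1} \<Longrightarrow> \<bar>t - T x\<bar> < d1 \<Longrightarrow> \<bar>\<phi> t - \<phi> (T x)\<bar> \<le> (1 / \<kappa>) ^ n"
      using Suc.IH[OF Tx] by blast
    obtain d2 where d2: "d2 > 0" "\<And>t. t \<in> {0..1} \<Longrightarrow> \<bar>t - x\<bar> < d2 \<Longrightarrow> \<bar>T t - T x\<bar> < d1"
      using cont Suc.prems d1(1) unfolding continuous_on_iff dist_real_def by metis
    have near: "\<kappa> * s \<le> (1 / \<kappa>) ^ n \<Longrightarrow> s \<le> e" for s using k0 by (simp add: e_def field_simps)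
    have right: "\<exists>d>0. \<forall>t\<in>{0..1}. x \<le> t \<and> t < x + d \<longrightarrow> \<phi> t - \<phi> x \<le> e"
    proof (cases "x < 1")
      case False
      then have "\<forall>t\<in>{0..1}. x \<le> t \<and> t < x + 1 \<longrightarrow> \<phi> t - \<phi> x \<le> e" using Suc.prems e0 by force
      then show ?thesis by (intro exI[of _ 1]) simp
    next
      case x1: True
      show ?thesis
      proof (cases "\<exists>l r. {l..r} \<in> P \<and> l \<le> x \<and> x < r")
        case True
        then obtain l r where lr: "{l..r} \<in> P" "l \<le> x" "x < r" by blast
        obtain t0 where t0: "t0 > x" "t0 \<le> r" "inj_on T {x..t0}" using one_sided_injectivity(1)[OF lr] by blast
        define d where "d = min d2 (t0 - x)"
        have "\<phi> t - \<phi> x \<le> e" if t: "t \<in> {0..1}" "x \<le> t" "t < x + d" for t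
        proof (cases "t = x")
          case False
          have inj: "inj_on T {x..t}" by (rule inj_on_subset[OF t0(3)]) (use t in \<open>auto simp: d_def\<close>)
          have "\<kappa> * (\<phi> t - \<phi> x) = \<bar>\<phi> (T t) - \<phi> (T x)\<bar>"
            by (rule scale[OF _ _ _ inj]) (use t False Suc.prems in auto)
          also have "\<dots> \<le> (1 / \<kappa>) ^ n"
            by (rule d1(2)) (use d2(2)[of t] maps_point[of t] t in \<open>auto simp: d_def\<close>)
          finally show ?thesis by (rule near)
        qed (use e0 in simp)
        moreover have "d > 0" using d2 t0 by (simp add: d_def)
        ultimately show ?thesis by blast
      next
        case False
        then have no: "\<And>l r. {l..r} \<in> P \<Longrightarrow> l \<le> x \<Longrightarrow> x < r \<Longrightarrow> False" by blast
        have xB: "x \<in> B" by (rule not_in[OF Suc.prems]) (use no in \<open>auto intro: order_less_imp_le\<close>)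
        have "0 \<le> x" using Suc.prems by simp
        have "\<exists>b\<in>B. x < b \<and> total x b < e"
        proof (rule small_total_right[OF \<open>0 \<le> x\<close> x1 _ e0])
          show False if "{l..r} \<in> P" "l \<le> x" "x < r" for l r using no[OF that] .
        qed
        then obtain b where b: "b \<in> B" "x < b" "total x b < e" by blast
        have "\<phi> t - \<phi> x \<le> e" if t: "t \<in> {0..1}" "x \<le> t" "t < x + (b - x)" for t
        proof -
          have "\<phi> t \<le> \<phi> b" by (rule mono) (use t in auto)
          then show ?thesis using bd[OF xB b(1)] b by simp
        qed
        then show ?thesis using b by (intro exI[of _ "b - x"]) auto
      qed
    qed
    have left: "\<exists>d>0. \<forall>t\<in>{0..1}. t \<le> x \<and> x - d < t \<longrightarrow> \<phi> x - \<phi> t \<le> e"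
    proof (cases "0 < x")
      case False
      then have "\<forall>t\<in>{0..1}. t \<le> x \<and> x - 1 < t \<longrightarrow> \<phi> x - \<phi> t \<le> e" using Suc.prems e0 by force
      then show ?thesis by (intro exI[of _ 1]) simp
    next
      case x1: True
      show ?thesis
      proof (cases "\<exists>l r. {l..r} \<in> P \<and> l < x \<and> x \<le> r")
        case True
        then obtain l r where lr: "{l..r} \<in> P" "l < x" "x \<le> r" by blast
        obtain t0 where t0: "t0 < x" "l \<le> t0" "inj_on T {t0..x}" using one_sided_injectivity(2)[OF lr] by blast
        define d where "d = min d2 (x - t0)"
        have "\<phi> x - \<phi> t \<le> e" if t: "t \<in> {0..1}" "t \<le> x" "x - d < t" for t
        proof (cases "t = x")
          case False
          have inj: "inj_on T {t..x}" by (rule inj_on_subset[OF t0(3)]) (use t in \<open>auto simp: d_def\<close>)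
          have "\<kappa> * (\<phi> x - \<phi> t) = \<bar>\<phi> (T x) - \<phi> (T t)\<bar>"
            by (rule scale[OF _ _ _ inj]) (use t False Suc.prems in auto)
          also have "\<dots> = \<bar>\<phi> (T t) - \<phi> (T x)\<bar>" by (rule abs_minus_commute)
          also have "\<dots> \<le> (1 / \<kappa>) ^ n"
            by (rule d1(2)) (use d2(2)[of t] maps_point[of t] t in \<open>auto simp: d_def\<close>)
          finally show ?thesis by (rule near)
        qed (use e0 in simp)
        moreover have "d > 0" using d2 t0 by (simp add: d_def)
        ultimately show ?thesis by blast
      next
        case False
        then have no: "\<And>l r. {l..r} \<in> P \<Longrightarrow> l < x \<Longrightarrow> x \<le> r \<Longrightarrow> False" by blast
        have xB: "x \<in> B" by (rule not_in[OF Suc.prems]) (use no in \<open>auto intro: order_less_imp_le\<close>)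
        have "x \<le> 1" using Suc.prems by simp
        have "\<exists>b\<in>B. b < x \<and> total b x < e"
        proof (rule small_total_left[OF x1 \<open>x \<le> 1\<close> _ e0])
          show False if "{l..r} \<in> P" "l < x" "x \<le> r" for l r using no[OF that] .
        qed
        then obtain b where b: "b \<in> B" "b < x" "total b x < e" by blast
        have "\<phi> x - \<phi> t \<le> e" if t: "t \<in> {0..1}" "t \<le> x" "x - (x - b) < t" for t
        proof -
          have "0 \<le> b" using b(1) boundary_unit by auto
          then have "\<phi> b \<le> \<phi> t" by (rule mono) (use t in auto)
          then show ?thesis using bd[OF b(1) xB] b by simp
        qed
        then show ?thesis using b by (intro exI[of _ "x - b"]) auto
      qed
    qed
    obtain da where da: "da > 0" "\<And>t. t \<in> {0..1} \<Longrightarrow> x \<le> t \<Longrightarrow> t < x + da \<Longrightarrow> \<phi> t - \<phi> x \<le> e" using right by blast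
    obtain db where db: "db > 0" "\<And>t. t \<in> {0..1} \<Longrightarrow> t \<le> x \<Longrightarrow> x - db < t \<Longrightarrow> \<phi> x - \<phi> t \<le> e" using left by blast
    have "\<bar>\<phi> t - \<phi> x\<bar> \<le> e" if t: "t \<in> {0..1}" "\<bar>t - x\<bar> < min da db" for t
    proof (cases "x \<le> t")
      case True
      have "\<phi> x \<le> \<phi> t" by (rule mono) (use True Suc.prems in auto)
      moreover have "\<phi> t - \<phi> x \<le> e" by (rule da(2)) (use t True in auto)
      ultimately show ?thesis by linarith
    next
      case False
      have "\<phi> t \<le> \<phi> x" by (rule mono) (use False t in auto)
      moreover have "\<phi> x - \<phi> t \<le> e" by (rule db(2)) (use t False in auto)
      ultimately show ?thesis by linarith
    qed
    then show ?case using da(1) db(1) unfolding e_def by (intro exI[of _ "min da db"]) auto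
  qed
  have contphi: "continuous_on {0..1} \<phi>"
    unfolding continuous_on_iff
  proof (intro ballI allI impI)
    fix x e :: real assume x: "x \<in> {0..1}" and e: "e > 0"
    have "1 / \<kappa> < 1" using lambda by simp
    then obtain n where n: "(1 / \<kappa>) ^ n < e" using real_arch_pow_inv[OF e] by blast
    obtain d where d: "d > 0" "\<forall>t\<in>{0..1}. \<bar>t - x\<bar> < d \<longrightarrow> \<bar>\<phi> t - \<phi> x\<bar> \<le> (1 / \<kappa>) ^ n"
      using osc[OF x] by blast
    have "dist (\<phi> t) (\<phi> x) < e" if "t \<in> {0..1}" "dist t x < d" for t
      using d(2) that n by (force simp: dist_real_def)
    then show "\<exists>d>0. \<forall>t\<in>{0..1}. dist t x < d \<longrightarrow> dist (\<phi> t) (\<phi> x) < e" using d(1) by blast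
  qed
  have scale_n: "\<kappa> ^ n * (\<phi> q - \<phi> p) = \<bar>\<phi> ((T ^^ n) q) - \<phi> ((T ^^ n) p)\<bar>"
    if "0 \<le> p" "p < q" "q \<le> 1" "inj_on (T ^^ n) {p..q}" for n p q
    using that
  proof (induction n arbitrary: p q)
    case 0
    have "\<phi> p \<le> \<phi> q" by (rule mono) (use 0 in auto)
    then show ?case by simp
  next
    case (Suc n)
    have step: "T ^^ Suc n = T ^^ n \<circ> T" by (rule funpow_Suc_right)
    have injT: "inj_on T {p..q}" using Suc.prems(4) unfolding step by (rule inj_on_imageI2)
    have inj': "inj_on (T ^^ n) (T ` {p..q})" using Suc.prems(4) unfolding step by (rule inj_on_imageI)
    have contT: "continuous_on {p..q} T" by (rule continuous_on_subset[OF cont]) (use Suc.prems in auto)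
    have T01: "T p \<in> {0..1}" "T q \<in> {0..1}" using maps_point[of p] maps_point[of q] Suc.prems by auto
    have "\<kappa> ^ n * \<bar>\<phi> (T q) - \<phi> (T p)\<bar> = \<bar>\<phi> ((T ^^ n) (T q)) - \<phi> ((T ^^ n) (T p))\<bar>"
      using inj_continuous_image_interval[OF contT injT Suc.prems(2)]
    proof
      assume a: "T p < T q \<and> T ` {p..q} = {T p..T q} \<and> T ` {p<..q} = {T p<..T q} \<and> T ` {p..<q} = {T p..<T q}"
      then have i: "inj_on (T ^^ n) {T p..T q}" using inj' by simp
      have "\<phi> (T p) \<le> \<phi> (T q)" by (rule mono) (use a T01 in auto)
      moreover have "\<kappa> ^ n * (\<phi> (T q) - \<phi> (T p)) = \<bar>\<phi> ((T ^^ n) (T q)) - \<phi> ((T ^^ n) (T p))\<bar>"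
        by (rule Suc.IH[OF _ _ _ i]) (use a T01 in auto)
      ultimately show ?thesis by simp
    next
      assume a: "T q < T p \<and> T ` {p..q} = {T q..T p} \<and> T ` {p<..q} = {T q..<T p} \<and> T ` {p..<q} = {T q<..T p}"
      then have i: "inj_on (T ^^ n) {T q..T p}" using inj' by simp
      have "\<phi> (T q) \<le> \<phi> (T p)" by (rule mono) (use a T01 in auto)
      moreover have "\<kappa> ^ n * (\<phi> (T p) - \<phi> (T q)) = \<bar>\<phi> ((T ^^ n) (T p)) - \<phi> ((T ^^ n) (T q))\<bar>"
        by (rule Suc.IH[OF _ _ _ i]) (use a T01 in auto)
      ultimately show ?thesis by (simp add: abs_minus_commute)
    qed
    moreover have "\<kappa> * (\<phi> q - \<phi> p) = \<bar>\<phi> (T q) - \<phi> (T p)\<bar>" by (rule scale[OF Suc.prems(1-3) injT])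
    moreover have "\<kappa> ^ Suc n * (\<phi> q - \<phi> p) = \<kappa> ^ n * (\<kappa> * (\<phi> q - \<phi> p))" by (simp only: power_Suc mult_ac)
    ultimately show ?case unfolding step comp_apply by simp
  qed
  \<comment> \<open>Every interval contains a full branch of some \<open>T ^^ n\<close> over an
    element \<open>k\<close>, on which the increase is
    \<open>u k / \<kappa> ^ n > 0\<close>.\<close>
  have strict: "\<phi> x < \<phi> x'" if x: "0 \<le> x" "x < x'" "x' \<le> 1" for x x'
  proof -
    obtain k where k: "k \<in> P" using nonempty_family by blast
    obtain n p q where pq: "x < p" "p < q" "q < x'" "inj_on (T ^^ n) {p..q}" "(T ^^ n) ` {p..q} = k"
      using inner_branch[OF x k] by blast
    obtain c d where cd: "c < d" "k = {c..d}" using elementE[OF k] by metis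
    have pq01: "0 \<le> p" "q \<le> 1" using pq x by auto
    have cpq: "continuous_on {p..q} (T ^^ n)" by (rule continuous_on_subset[OF iterate_cont]) (use pq01 in auto)
    have "{(T ^^ n) p, (T ^^ n) q} = {c, d}"
      using inj_continuous_image_interval[OF cpq pq(4,2)] unfolding pq(5) cd(2) using cd(1) by (auto simp: Icc_eq_Icc)
    moreover have "\<phi> d - \<phi> c = u k"
      using bd[of c d] endpoints_boundary[of c d] total_element[of c d] k cd by simp
    then have "\<bar>\<phi> d - \<phi> c\<bar> > 0" "\<bar>\<phi> c - \<phi> d\<bar> > 0" using u_pos[OF k] by auto
    ultimately have "\<bar>\<phi> ((T ^^ n) q) - \<phi> ((T ^^ n) p)\<bar> > 0"
      by (auto simp: doubleton_eq_iff)
    then have "\<kappa> ^ n * (\<phi> q - \<phi> p) > 0" using scale_n[OF pq01(1) pq(2) pq01(2) pq(4)] by simp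
    then have "\<phi> p < \<phi> q" using k0 by (simp add: zero_less_mult_iff)
    moreover have "\<phi> x \<le> \<phi> p" "\<phi> q \<le> \<phi> x'" by (rule mono; use x pq in simp)+
    ultimately show ?thesis by linarith
  qed
  have injphi: "inj_on \<phi> {0..1}"
  proof (rule inj_onI)
    fix x y :: real assume "x \<in> {0..1}" "y \<in> {0..1}" "\<phi> x = \<phi> y"
    then show "x = y" using strict[of x y] strict[of y x] by (cases x y rule: linorder_cases) auto
  qed
  have surj: "\<phi> ` {0..1} = {0..1}"
  proof
    show "\<phi> ` {0..1} \<subseteq> {0..1}" using \<phi>(1) by blast
    show "{0..1} \<subseteq> \<phi> ` {0..1}"
    proof
      fix y :: real assume "y \<in> {0..1}"
      then obtain x where "0 \<le> x" "x \<le> 1" "\<phi> x = y" using IVT'[of \<phi> 0 y 1] \<phi> contphi by auto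
      then show "y \<in> \<phi> ` {0..1}" by auto
    qed
  qed
  obtain \<psi> where hom: "homeomorphism {0..1} {0..1} \<phi> \<psi>"
    using homeomorphism_compact[OF compact_Icc contphi surj injphi] by blast
  have \<psi>: "continuous_on {0..1} \<psi>" "\<psi> ` {0..1} = {0..1}" "\<And>x. x \<in> {0..1} \<Longrightarrow> \<psi> (\<phi> x) = x" "\<And>y. y \<in> {0..1} \<Longrightarrow> \<phi> (\<psi> y) = y"
    using hom by (auto simp: homeomorphism_def)
  define g where "g = \<phi> \<circ> T \<circ> \<psi>"
  show ?thesis
  proof (rule that[of g])
    show "continuous_on {0..1} g"
      unfolding g_def
    proof (intro continuous_on_compose \<psi>(1))
      show "continuous_on (\<psi> ` {0..1}) T" using cont \<psi>(2) by simp
      show "continuous_on (T ` \<psi> ` {0..1}) \<phi>" by (rule continuous_on_subset[OF contphi]) (use \<psi>(2) maps in simp)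
    qed
    show "g ` {0..1} \<subseteq> {0..1}" unfolding g_def using \<phi>(1) by auto
    have conj: "\<phi> (T x) = g (\<phi> x)" if "x \<in> {0..1}" for x using \<psi>(3)[OF that] by (simp add: g_def)
    show "topologically_conjugate T g" unfolding topologically_conjugate_def using hom conj by blast
    show "constant_slope g \<kappa>"
      unfolding constant_slope_def
    proof (intro exI[of _ "\<phi> ` {x\<in>{0..1}. T x \<in> B}"] conjI ballI)
      show "countable (\<phi> ` {x\<in>{0..1}. T x \<in> B})" using countable_boundary_preimage by simp
      fix z assume z: "z \<in> {0..1} - \<phi> ` {x\<in>{0..1}. T x \<in> B}"
      define x where "x = \<psi> z"
      have x: "x \<in> {0..1}" "\<phi> x = z" using z \<psi> by (auto simp: x_def)
      then have TxB: "T x \<notin> B" using z by blast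
      obtain e where e: "e > 0" "inj_on T ({0..1} \<inter> ball x e)" using locally_injective[OF x(1) TxB] by blast
      have "x \<notin> B" using TxB boundary_invariant by blast
      then have "x \<noteq> 0" "x \<noteq> 1" using zero_one_boundary by auto
      then have x01: "0 < x" "x < 1" using x(1) by auto
      define d where "d = min (e / 2) (min x (1 - x))"
      have d: "d > 0" "d < e" "0 \<le> x - d" "x + d \<le> 1" using e x01 by (auto simp: d_def min_def)
      have "{x - d..x + d} \<subseteq> {0..1} \<inter> ball x e" using d by (auto simp: dist_real_def)
      then have inj: "inj_on T {x - d..x + d}" by (rule inj_on_subset[OF e(2)])
      have contd: "continuous_on {x - d..x + d} T" by (rule continuous_on_subset[OF cont]) (use d in auto)
      obtain \<sigma> :: real where \<sigma>: "\<bar>\<sigma>\<bar> = 1" "\<And>s t. x - d \<le> s \<Longrightarrow> s < t \<Longrightarrow> t \<le> x + d \<Longrightarrow> \<bar>\<phi> (T t) - \<phi> (T s)\<bar> = \<sigma> * (\<phi> (T t) - \<phi> (T s))"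
        using inj_continuous_interval_mono[OF contd inj]
      proof
        assume m: "strict_mono_on {x - d..x + d} T"
        show thesis
        proof (rule that[of 1])
          fix s t assume st: "x - d \<le> s" "s < t" "t \<le> x + d"
          have "T s \<le> T t" using m st by (auto simp: strict_mono_on_def order_less_imp_le)
          then have "\<phi> (T s) \<le> \<phi> (T t)" by (rule mono[rotated]) (use maps_point[of s] st d in auto)
          then show "\<bar>\<phi> (T t) - \<phi> (T s)\<bar> = 1 * (\<phi> (T t) - \<phi> (T s))" by simp
        qed simp
      next
        assume m: "strict_antimono_on {x - d..x + d} T"
        show thesis
        proof (rule that[of "-1"])
          fix s t assume st: "x - d \<le> s" "s < t" "t \<le> x + d"
          have "T t \<le> T s" using m st by (auto simp: monotone_on_def order_less_imp_le)
          then have "\<phi> (T t) \<le> \<phi> (T s)" by (rule mono[rotated]) (use maps_point[of t] st d in auto)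
          then show "\<bar>\<phi> (T t) - \<phi> (T s)\<bar> = - 1 * (\<phi> (T t) - \<phi> (T s))" by simp
        qed simp
      qed
      have sq: "\<sigma> * \<sigma> = 1" using \<sigma>(1) by (simp add: abs_if split: if_splits)
      have slope: "\<phi> (T t) - \<phi> (T s) = \<sigma> * \<kappa> * (\<phi> t - \<phi> s)" if st: "x - d \<le> s" "s < t" "t \<le> x + d" for s t
      proof -
        have "inj_on T {s..t}" by (rule inj_on_subset[OF inj]) (use st in auto)
        then have "\<kappa> * (\<phi> t - \<phi> s) = \<bar>\<phi> (T t) - \<phi> (T s)\<bar>" by (intro scale) (use st d in auto)
        also have "\<dots> = \<sigma> * (\<phi> (T t) - \<phi> (T s))" by (rule \<sigma>(2)[OF st])
        finally have "\<sigma> * (\<kappa> * (\<phi> t - \<phi> s)) = (\<sigma> * \<sigma>) * (\<phi> (T t) - \<phi> (T s))" by (simp add: mult.assoc)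
        then show ?thesis using sq by (simp add: mult.assoc)
      qed
      \<comment> \<open>Within \<open>r\<close> of \<open>z\<close> the inverse stays in
        \<open>{x - d..x + d}\<close>, where \<open>T\<close> is injective, so \<open>g\<close>
        agrees there with an affine map.\<close>
      define r where "r = min (\<phi> (x + d) - \<phi> x) (\<phi> x - \<phi> (x - d))"
      have "r > 0" using strict[of x "x + d"] strict[of "x - d" x] d x01 by (simp add: r_def)
      have "((\<lambda>y. g z + \<sigma> * \<kappa> * (y - z)) has_real_derivative \<sigma> * \<kappa>) (at z within {0..1})"
        by (auto intro!: derivative_eq_intros)
      then have "(g has_real_derivative \<sigma> * \<kappa>) (at z within {0..1})"
      proof (rule has_field_derivative_transform_within[OF _ \<open>r > 0\<close>])
        show "z \<in> {0..1}" using z by blast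
        fix y assume y: "y \<in> {0..1}" "dist y z < r"
        define t where "t = \<psi> y"
        have t: "t \<in> {0..1}" "\<phi> t = y" using y(1) \<psi> by (auto simp: t_def)
        have yy: "\<phi> t < \<phi> (x + d)" "\<phi> (x - d) < \<phi> t" using y(2) x t by (auto simp: r_def dist_real_def)
        have "t \<le> x + d"
        proof (rule ccontr)
          assume "\<not> t \<le> x + d"
          then have "\<phi> (x + d) \<le> \<phi> t" by (intro mono) (use d x01 in auto)
          then show False using yy by simp
        qed
        moreover have "x - d \<le> t"
        proof (rule ccontr)
          assume "\<not> x - d \<le> t"
          then have "\<phi> t \<le> \<phi> (x - d)" by (intro mono) (use t in auto)
          then show False using yy by simp
        qed
        ultimately have td: "x - d \<le> t" "t \<le> x + d" by auto
        have gy: "g y = \<phi> (T t)" "g z = \<phi> (T x)" using conj[OF t(1)] conj[OF x(1)] t x by auto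
        show "g z + \<sigma> * \<kappa> * (y - z) = g y"
        proof (cases x t rule: linorder_cases)
          case less
          then show ?thesis using slope[of x t] td d gy t x by simp
        next
          case equal
          then show ?thesis using gy t x by simp
        next
          case greater
          then have "\<phi> (T x) - \<phi> (T t) = \<sigma> * \<kappa> * (\<phi> x - \<phi> t)" using slope[of t x] td d by simp
          then show ?thesis using gy t x by (simp add: algebra_simps)
        qed
      qed
      moreover have "\<bar>\<sigma> * \<kappa>\<bar> = \<kappa>" using \<sigma>(1) k0 by (simp add: abs_mult)
      ultimately show "\<exists>D. (g has_real_derivative D) (at z within {0..1}) \<and> \<bar>D\<bar> = \<kappa>" by blast
    qed
  qed
qed

end

text \<open>Points more than \<open>d\<close> apart lie in different cells of length
  \<open>d\<close>.\<close>

lemma card_spaced_le: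
  fixes E :: "real set"
  assumes "finite E" "E \<subseteq> {0..1}" "d > 0" and sp: "\<And>x y. x \<in> E \<Longrightarrow> y \<in> E \<Longrightarrow> x \<noteq> y \<Longrightarrow> \<bar>x - y\<bar> > d"
  shows "real (card E) \<le> 1 / d + 1"
proof -
  have "inj_on (\<lambda>x. nat \<lfloor>x / d\<rfloor>) E"
  proof (rule inj_onI, rule ccontr)
    fix x y assume xy: "x \<in> E" "y \<in> E" "nat \<lfloor>x / d\<rfloor> = nat \<lfloor>y / d\<rfloor>" "x \<noteq> y"
    have "0 \<le> x" "0 \<le> y" using xy assms(2) by auto
    then have "0 \<le> x / d" "0 \<le> y / d" using assms(3) by simp_all
    then have "\<lfloor>x / d\<rfloor> = \<lfloor>y / d\<rfloor>" using xy(3) by (simp add: nat_eq_iff2 split: if_splits)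
    then have "\<bar>x / d - y / d\<bar> < 1" by linarith
    then have "\<bar>x - y\<bar> < d" using assms(3) by (simp add: diff_divide_distrib[symmetric] abs_divide)
    then show False using sp[OF xy(1,2,4)] by simp
  qed
  moreover have "(\<lambda>x. nat \<lfloor>x / d\<rfloor>) ` E \<subseteq> {..nat \<lfloor>1 / d\<rfloor>}"
  proof
    fix m assume "m \<in> (\<lambda>x. nat \<lfloor>x / d\<rfloor>) ` E"
    then obtain x where x: "x \<in> E" "m = nat \<lfloor>x / d\<rfloor>" by blast
    have "x / d \<le> 1 / d" using x assms by (intro divide_right_mono) auto
    then show "m \<in> {..nat \<lfloor>1 / d\<rfloor>}" using x by (simp add: nat_mono floor_mono)
  qed
  ultimately have "card E \<le> card {..nat \<lfloor>1 / d\<rfloor>}" by (rule card_inj_on_le) simp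
  then have "real (card E) \<le> real (Suc (nat \<lfloor>1 / d\<rfloor>))" by simp
  also have "\<dots> \<le> 1 / d + 1" using assms(3) by simp
  finally show ?thesis .
qed

text \<open>In the linearized coordinate distances grow at most by the factor \<open>s\<close> per
  step, so orbits separated within \<open>n\<close> steps start more than \<open>e / s ^ n\<close>
  apart. Uniform continuity of the inverse conjugacy turns \<open>\<epsilon>\<close> into
  \<open>e\<close>.\<close>

lemma constant_slope_entropy_le:
  assumes T: "T ` {0..1} \<subseteq> {0..1}" and g: "continuous_on {0..1} g" "constant_slope g s"
    and conj: "topologically_conjugate T g" and s: "s \<ge> 1"
  shows "h_top T \<le> ereal (ln s)"
proof (rule h_top_le[OF s])
  fix \<epsilon> :: real assume eps: "\<epsilon> > 0"
  obtain \<phi> \<psi> where hom: "homeomorphism {0..1} {0..1} \<phi> \<psi>" and conj: "\<And>x. x \<in> {0..1} \<Longrightarrow> \<phi> (T x) = g (\<phi> x)"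
    using conj unfolding topologically_conjugate_def by blast
  have phi: "\<phi> ` {0..1} = {0..1}" "continuous_on {0..1} \<psi>" "\<And>x. x \<in> {0..1} \<Longrightarrow> \<psi> (\<phi> x) = x"
    using hom by (auto simp: homeomorphism_def)
  have "uniformly_continuous_on {0..1} \<psi>" by (intro compact_uniformly_continuous phi(2) compact_Icc)
  then obtain d where d: "d > 0" "\<And>x y. x \<in> {0..1} \<Longrightarrow> y \<in> {0..1} \<Longrightarrow> dist x y < d \<Longrightarrow> dist (\<psi> x) (\<psi> y) < \<epsilon>"
    unfolding uniformly_continuous_on_def using eps by metis
  define e where "e = d / 2"
  have e: "e > 0" "e < d" using d(1) by (simp_all add: e_def)
  have iter: "(T ^^ k) x \<in> {0..1}" if "x \<in> {0..1}" for k x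
    using that by (induction k) (use T in \<open>auto simp: image_subset_iff\<close>)
  have lip: "\<bar>\<phi> ((T ^^ k) y) - \<phi> ((T ^^ k) x)\<bar> \<le> s ^ k * \<bar>\<phi> y - \<phi> x\<bar>" if xy: "x \<in> {0..1}" "y \<in> {0..1}" for k x y
  proof (induction k)
    case (Suc k)
    let ?a = "\<phi> ((T ^^ k) x)" and ?b = "\<phi> ((T ^^ k) y)"
    have in01: "?a \<in> {0..1}" "?b \<in> {0..1}" using iter xy phi(1) by blast+
    have "\<bar>\<phi> ((T ^^ Suc k) y) - \<phi> ((T ^^ Suc k) x)\<bar> = \<bar>g ?b - g ?a\<bar>" using conj iter xy by simp
    also have "\<dots> \<le> s * \<bar>?b - ?a\<bar>" by (rule constant_slope_lipschitz[OF g in01])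
    also have "\<dots> \<le> s * (s ^ k * \<bar>\<phi> y - \<phi> x\<bar>)" using Suc s by (intro mult_left_mono) auto
    finally show ?case by (simp add: mult.assoc)
  qed simp
  show "\<exists>K. \<forall>n\<ge>1. \<forall>E. separated_set T n \<epsilon> E \<longrightarrow> real (card E) \<le> K * (real n)\<^sup>2 * s ^ n"
  proof (intro exI[of _ "1 / e + 1"] allI impI)
    fix n :: nat and E assume n: "n \<ge> 1" and sE: "separated_set T n \<epsilon> E"
    have E: "finite E" "E \<subseteq> {0..1}" "\<And>x x'. x \<in> E \<Longrightarrow> x' \<in> E \<Longrightarrow> x \<noteq> x' \<Longrightarrow> \<exists>k<n. dist ((T ^^ k) x) ((T ^^ k) x') > \<epsilon>"
      using sE by (auto simp: separated_set_def)
    have sn: "1 \<le> s ^ n" using s by (rule one_le_power)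
    have inj: "inj_on \<phi> E" by (rule inj_on_inverseI[of _ \<psi>]) (use phi(3) E(2) in blast)
    have sp: "\<bar>\<phi> x - \<phi> x'\<bar> > e / s ^ n" if xx: "x \<in> E" "x' \<in> E" "x \<noteq> x'" for x x'
    proof (rule ccontr)
      assume "\<not> \<bar>\<phi> x - \<phi> x'\<bar> > e / s ^ n"
      then have "\<bar>\<phi> x - \<phi> x'\<bar> \<le> e / s ^ n" by simp
      then have small: "s ^ n * \<bar>\<phi> x - \<phi> x'\<bar> \<le> e" using sn by (simp add: field_simps)
      obtain k where k: "k < n" "dist ((T ^^ k) x) ((T ^^ k) x') > \<epsilon>" using E(3)[OF xx] by blast
      have x01: "x \<in> {0..1}" "x' \<in> {0..1}" using xx E(2) by auto
      have "\<bar>\<phi> ((T ^^ k) x) - \<phi> ((T ^^ k) x')\<bar> \<le> s ^ k * \<bar>\<phi> x - \<phi> x'\<bar>" by (rule lip) (use x01 in auto)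
      also have "\<dots> \<le> s ^ n * \<bar>\<phi> x - \<phi> x'\<bar>" using k(1) s by (intro mult_right_mono power_increasing) auto
      finally have "dist (\<phi> ((T ^^ k) x)) (\<phi> ((T ^^ k) x')) < d" using small e by (simp add: dist_real_def)
      moreover have "\<phi> ((T ^^ k) x) \<in> {0..1}" "\<phi> ((T ^^ k) x') \<in> {0..1}" using iter x01 phi(1) by blast+
      ultimately have "dist (\<psi> (\<phi> ((T ^^ k) x))) (\<psi> (\<phi> ((T ^^ k) x'))) < \<epsilon>" by (intro d(2))
      then show False using k(2) phi(3)[OF iter[OF x01(1)]] phi(3)[OF iter[OF x01(2)]] by simp
    qed
    have "real (card (\<phi> ` E)) \<le> 1 / (e / s ^ n) + 1"
    proof (rule card_spaced_le)
      show "finite (\<phi> ` E)" using E(1) by simp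
      show "\<phi> ` E \<subseteq> {0..1}" using E(2) phi(1) by blast
      show "0 < e / s ^ n" using e sn by simp
      show "\<bar>a - b\<bar> > e / s ^ n" if "a \<in> \<phi> ` E" "b \<in> \<phi> ` E" "a \<noteq> b" for a b using that sp by blast
    qed
    then have "real (card E) \<le> s ^ n / e + 1" using card_image[OF inj] by simp
    also have "\<dots> \<le> s ^ n / e + s ^ n" using sn by simp
    also have "\<dots> = (1 / e + 1) * 1 * s ^ n" by (simp add: field_simps)
    also have "\<dots> \<le> (1 / e + 1) * (real n)\<^sup>2 * s ^ n"
    proof (intro mult_right_mono mult_left_mono)
      show "1 \<le> (real n)\<^sup>2" using n by (simp add: one_le_power)
    qed (use e sn in auto)
    finally show "real (card E) \<le> (1 / e + 1) * (real n)\<^sup>2 * s ^ n" .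
  qed
qed

section \<open>Perturbations\<close>

text \<open>The entrywise order of nonnegative matrices passes to powers by the product formula
  \<open>fiber_count_Suc\<close>.\<close>

lemma fiber_count_iterate_mono:
  assumes "mixing_system P S" "mixing_system P T"
    and le: "\<And>i j. i \<in> P \<Longrightarrow> j \<in> P \<Longrightarrow> fiber_count S i j \<le> fiber_count T i j"
    and "i \<in> P" "j \<in> P"
  shows "fiber_count (S ^^ n) i j \<le> fiber_count (T ^^ n) i j"
  using assms(4,5)
proof (induction n arbitrary: i)
  case (Suc n)
  have "(of_nat (fiber_count (S ^^ Suc n) i j) :: ennreal) =
      (\<integral>\<^sup>+\<alpha>. of_nat (fiber_count S i \<alpha>) * of_nat (fiber_count (S ^^ n) \<alpha> j) \<partial>count_space P)"
    by (rule mixing_system.fiber_count_Suc[OF assms(1) Suc.prems, symmetric])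
  also have "\<dots> \<le> (\<integral>\<^sup>+\<alpha>. of_nat (fiber_count T i \<alpha>) * of_nat (fiber_count (T ^^ n) \<alpha> j) \<partial>count_space P)"
  proof (rule nn_integral_mono)
    fix \<alpha> assume "\<alpha> \<in> space (count_space P)"
    then have "\<alpha> \<in> P" by simp
    have "fiber_count S i \<alpha> * fiber_count (S ^^ n) \<alpha> j \<le> fiber_count T i \<alpha> * fiber_count (T ^^ n) \<alpha> j"
      by (rule mult_le_mono[OF le[OF Suc.prems(1) \<open>\<alpha> \<in> P\<close>] Suc.IH[OF \<open>\<alpha> \<in> P\<close> Suc.prems(2)]])
    then have "(of_nat (fiber_count S i \<alpha> * fiber_count (S ^^ n) \<alpha> j) :: ennreal) \<le>
        of_nat (fiber_count T i \<alpha> * fiber_count (T ^^ n) \<alpha> j)"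
      by (subst of_nat_le_iff)
    then show "of_nat (fiber_count S i \<alpha>) * of_nat (fiber_count (S ^^ n) \<alpha> j) \<le>
        (of_nat (fiber_count T i \<alpha>) * of_nat (fiber_count (T ^^ n) \<alpha> j) :: ennreal)"
      by (simp only: of_nat_mult)
  qed
  also have "\<dots> = of_nat (fiber_count (T ^^ Suc n) i j)"
    by (rule mixing_system.fiber_count_Suc[OF assms(2) Suc.prems])
  finally show ?case by (subst (asm) of_nat_le_iff)
qed (simp add: fiber_count_def)

text \<open>\<open>x \<ge> 1\<close> also covers \<open>h = - \<infinity>\<close>, which
  \<open>real_of_ereal\<close> maps to 0.\<close>

lemma real_of_ereal_le_ln:
  assumes "h \<le> ereal (ln x)" "x \<ge> 1"
  shows "exp (real_of_ereal h) \<le> x"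
proof -
  have "real_of_ereal h \<le> ln x" using assms by (cases h) auto
  then have "exp (real_of_ereal h) \<le> exp (ln x)" by simp
  then show ?thesis using assms(2) by simp
qed

text \<open>If the counts stayed below \<open>\<nu> ^ n\<close> for large \<open>n\<close> with
  \<open>\<nu> < 1 / R\<close>, the series would be dominated by a convergent geometric one. So they
  reach \<open>\<nu> ^ n\<close> infinitely often, and horseshoes apply.\<close>

lemma entropy_eq_of_series:
  assumes sys: "mixing_system P T" and j: "j \<in> P" and R: "0 < R" "R < 1"
    and div: "(\<Sum>n. of_nat (fiber_count (T ^^ n) j j) * ennreal R ^ n) = \<infinity>"
  shows "h_top T \<ge> ereal (ln (1 / R))"
proof (rule ccontr)
  assume "\<not> h_top T \<ge> ereal (ln (1 / R))"
  then have "h_top T < ereal (ln (1 / R))" by simp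
  moreover have "(0::ereal) < ereal (ln (1 / R))" using R by simp
  \<comment> \<open>The maximum with 0 yields \<open>\<nu> > 1\<close>, as
    \<open>entropy_lower_bound\<close> requires.\<close>
  ultimately have "max (h_top T) 0 < ereal (ln (1 / R))" by simp
  then obtain x where x: "max (h_top T) 0 < ereal x" "ereal x < ereal (ln (1 / R))"
    using ereal_dense2 by blast
  define \<nu> where "\<nu> = exp x"
  have "x > 0" using x(1) by simp
  then have nu: "\<nu> > 1" by (simp add: \<nu>_def)
  have "\<nu> < exp (ln (1 / R))" using x(2) unfolding \<nu>_def by simp
  then have nuR: "\<nu> * R < 1" using R by (simp add: field_simps)
  have "h_top T \<ge> ereal (ln \<nu>)"
  proof (rule mixing_system.entropy_lower_bound[OF sys j nu], rule ccontr)
    fix N assume "\<not> (\<exists>n\<ge>N. real (fiber_count (T ^^ n) j j) \<ge> \<nu> ^ n)"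
    then have lt: "\<And>n. n \<ge> N \<Longrightarrow> real (fiber_count (T ^^ n) j j) < \<nu> ^ n" by force
    have "summable (\<lambda>n. real (fiber_count (T ^^ n) j j) * R ^ n)"
    proof (rule summable_comparison_test)
      show "summable (\<lambda>n. (\<nu> * R) ^ n)" using nu R nuR by (intro summable_geometric) simp
      show "\<exists>N. \<forall>n\<ge>N. norm (real (fiber_count (T ^^ n) j j) * R ^ n) \<le> (\<nu> * R) ^ n"
      proof (intro exI[of _ N] allI impI)
        fix n assume "n \<ge> N"
        then have "real (fiber_count (T ^^ n) j j) * R ^ n \<le> \<nu> ^ n * R ^ n"
          using lt[of n] R by (intro mult_right_mono) auto
        then show "norm (real (fiber_count (T ^^ n) j j) * R ^ n) \<le> (\<nu> * R) ^ n"
          using R by (simp add: power_mult_distrib abs_mult)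
      qed
    qed
    then have "(\<Sum>n. ennreal (real (fiber_count (T ^^ n) j j) * R ^ n)) \<noteq> top"
      by (rule ennreal_suminf_neq_top) (use R in simp)
    moreover have "ennreal (real (fiber_count (T ^^ n) j j) * R ^ n) = of_nat (fiber_count (T ^^ n) j j) * ennreal R ^ n" for n
      using R by (simp add: ennreal_mult ennreal_power ennreal_of_nat_eq_real_of_nat)
    ultimately show False using div by simp
  qed
  then have "ereal x \<le> h_top T" by (simp add: \<nu>_def)
  moreover have "h_top T < ereal x" using x(1) by simp
  ultimately show False by (meson not_le)
qed

text \<open>Stated for any nonempty \<open>P'\<close> outside which the rows agree, not only for a
  set of windows: when there are no windows, a singleton takes their place and hosts the target
  \<open>j\<close>.\<close>

lemma linearizable_of_dominated_rows:
  assumes T: "T \<in> cpmm" "recurrent_map T" and sysS: "mixing_system P S" and sysT: "mixing_system P T"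
    and lin: "linearizable S" and P': "P' \<subseteq> P" and j: "j \<in> P'"
    and rows: "\<And>i \<alpha>. i \<in> P - P' \<Longrightarrow> fiber_count T i \<alpha> = fiber_count S i \<alpha>"
    and le: "\<And>i \<alpha>. i \<in> P \<Longrightarrow> \<alpha> \<in> P \<Longrightarrow> fiber_count S i \<alpha> \<le> fiber_count T i \<alpha>"
    and fin: "finite {k \<in> P'. \<exists>i \<in> P - P'. k \<subseteq> S ` i}"
    and k: "k \<in> P" and reach: "\<And>i. i \<in> P' \<Longrightarrow> fiber_count (T ^^ m) k i > 0"
  shows "linearizable T"
proof -
  interpret S: mixing_system P S by fact
  interpret T: mixing_system P T by fact
  have jP: "j \<in> P" using j P' by blast
  obtain R where R: "R > 0" and div: "(\<Sum>n. of_nat (fiber_count (T ^^ n) j j) * ennreal R ^ n) = \<infinity>"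
    and conv: "\<And>z. 0 < z \<Longrightarrow> z < R \<Longrightarrow> (\<Sum>n. of_nat (fiber_count (T ^^ n) j j) * ennreal z ^ n) \<noteq> \<infinity>"
    using recurrent_map_series[OF T sysT jP] by blast
  define M where "M i \<alpha> = (of_nat (fiber_count T i \<alpha>) :: ennreal)" for i \<alpha>
  interpret M: countable_matrix P M by unfold_locales (rule S.countable_family)
  have mp: "mat_pow P M n i \<alpha> = of_nat (fiber_count (T ^^ n) i \<alpha>)" if "i \<in> P" "\<alpha> \<in> P" for n i \<alpha>
    by (rule T.mat_pow_fiber_count[OF _ that]) (simp add: M_def)
  have green: "M.green j z = (\<Sum>n. of_nat (fiber_count (T ^^ n) j j) * z ^ n)" for z
    unfolding M.green_def by (simp add: mp[OF jP jP])
  have one: "M.entrance j j (ennreal R) = 1"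
  proof (rule M.recurrent_entrance[OF jP _ R])
    show "mat_pow P M n j j \<noteq> \<infinity>" for n using mp[OF jP jP] by simp
    show "M.green j (ennreal R) = \<infinity>" using div green by simp
    show "M.green j (ennreal z) \<noteq> \<infinity>" if "0 < z" "z < R" for z using conv[OF that] green by simp
  qed
  define u where "u i = M.entrance i j (ennreal R)" for i
  have uj: "u j = 1" using one by (simp add: u_def)
  have eig: "ennreal R * (\<integral>\<^sup>+\<alpha>. M i \<alpha> * u \<alpha> \<partial>count_space P) = u i" for i
    unfolding u_def by (rule M.entrance_eigenvector[OF jP one])
  have iter: "ennreal R ^ n * (\<Sum>\<alpha>\<in>F. of_nat (fiber_count (T ^^ n) i \<alpha>) * u \<alpha>) \<le> u i"
    if "finite F" "F \<subseteq> P" "i \<in> P" for n F i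
  proof -
    have "ennreal R ^ n * (\<Sum>\<alpha>\<in>F. mat_pow P M n i \<alpha> * u \<alpha>) \<le> u i"
      by (rule M.iterated_supersolution[OF _ that]) (simp add: eig)
    moreover have "(\<Sum>\<alpha>\<in>F. mat_pow P M n i \<alpha> * u \<alpha>) = (\<Sum>\<alpha>\<in>F. of_nat (fiber_count (T ^^ n) i \<alpha>) * u \<alpha>)"
      by (rule sum.cong[OF refl]) (use mp that in auto)
    ultimately show ?thesis by simp
  qed
  have iter1: "ennreal R ^ n * (of_nat (fiber_count (T ^^ n) i \<alpha>) * u \<alpha>) \<le> u i" if "i \<in> P" "\<alpha> \<in> P" for n i \<alpha>
    using iter[of "{\<alpha>}" i n] that by simp
  have R0: "ennreal R \<noteq> 0" using R by simp
  \<comment> \<open>\<open>j\<close> leads to \<open>i\<close> with positive weight and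
    \<open>u j = 1\<close>, so the iterated inequality bounds \<open>u i\<close>; in
    \<open>u_pos\<close> the path runs from \<open>i\<close> to \<open>j\<close>.\<close>
  have u_fin: "u i \<noteq> \<infinity>" if i: "i \<in> P" for i
  proof
    assume inf: "u i = \<infinity>"
    obtain n where n: "fiber_count (T ^^ n) j i > 0" using T.irreducible[OF jP i] by blast
    have "ennreal R ^ n * (of_nat (fiber_count (T ^^ n) j i) * u i) \<le> 1"
      using iter1[OF jP i, of n] uj by simp
    moreover have "of_nat (fiber_count (T ^^ n) j i) \<noteq> (0::ennreal)" using n by simp
    ultimately show False using R0 inf by (simp add: ennreal_mult_top top_unique)
  qed
  have u_pos: "u i \<noteq> 0" if i: "i \<in> P" for i
  proof
    assume zero: "u i = 0"
    obtain n where n: "fiber_count (T ^^ n) i j > 0" using T.irreducible[OF i jP] by blast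
    have "ennreal R ^ n * of_nat (fiber_count (T ^^ n) i j) = 0"
      using iter1[OF i jP, of n] uj zero by simp
    then show False using n R0 by simp
  qed
  \<comment> \<open>At a time \<open>n\<close> with two returns to \<open>j\<close> the iterated
    inequality implies \<open>2 * R ^ n \<le> 1\<close>.\<close>
  have R1: "R < 1"
  proof (rule ccontr)
    assume "\<not> R < 1"
    then have "R \<ge> 1" by simp
    obtain n where n: "fiber_count (T ^^ n) j j \<ge> 2" using T.fiber_count_growth[OF jP] by blast
    have "ennreal R ^ n * of_nat (fiber_count (T ^^ n) j j) \<le> 1" using iter1[OF jP jP, of n] uj by simp
    then have "ennreal (R ^ n * real (fiber_count (T ^^ n) j j)) \<le> ennreal 1"
      using R by (simp add: ennreal_mult ennreal_power ennreal_of_nat_eq_real_of_nat)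
    then have "R ^ n * real (fiber_count (T ^^ n) j j) \<le> 1" by (subst (asm) ennreal_le_iff) auto
    moreover have "1 * 2 \<le> R ^ n * real (fiber_count (T ^^ n) j j)"
      using n \<open>R \<ge> 1\<close> by (intro mult_mono one_le_power) auto
    ultimately show False by simp
  qed
  define s where "s = exp (real_of_ereal (h_top S))"
  \<comment> \<open>For \<open>\<nu> > 1 / R\<close> the return series converges at
    \<open>1 / \<nu>\<close>, so its terms are bounded; this bounds the counts of \<open>T\<close>,
    hence the smaller counts of \<open>S\<close>, by \<open>C * \<nu> ^ n\<close>.\<close>
  have s_le: "s \<le> 1 / R"
  proof (rule dense_ge)
    fix \<nu> assume nu: "1 / R < \<nu>"
    have "1 < 1 / R" using R R1 by simp
    then have nu1: "\<nu> > 1" using nu by simp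
    define z where "z = 1 / \<nu>"
    have z: "0 < z" "z < R" using nu nu1 R by (simp_all add: z_def field_simps)
    define C where "C = enn2real (\<Sum>n. of_nat (fiber_count (T ^^ n) j j) * ennreal z ^ n)"
    have Cz: "(\<Sum>n. of_nat (fiber_count (T ^^ n) j j) * ennreal z ^ n) = ennreal C"
      using conv[OF z] by (simp add: C_def less_top)
    have "real (fiber_count (S ^^ n) j j) \<le> C * \<nu> ^ n" for n
    proof -
      have "(\<Sum>n\<in>{n}. of_nat (fiber_count (T ^^ n) j j) * ennreal z ^ n) \<le>
          (\<Sum>n. of_nat (fiber_count (T ^^ n) j j) * ennreal z ^ n)"
        by (rule sum_le_suminf) auto
      then have "of_nat (fiber_count (T ^^ n) j j) * ennreal z ^ n \<le> ennreal C" using Cz by simp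
      then have "ennreal (real (fiber_count (T ^^ n) j j) * z ^ n) \<le> ennreal C"
        using z by (simp add: ennreal_mult ennreal_power ennreal_of_nat_eq_real_of_nat)
      then have "real (fiber_count (T ^^ n) j j) * z ^ n \<le> C"
        by (subst (asm) ennreal_le_iff) (auto simp: C_def)
      then have "real (fiber_count (T ^^ n) j j) \<le> C * \<nu> ^ n"
        using nu1 by (simp add: z_def power_one_over field_simps)
      moreover have "fiber_count (S ^^ n) j j \<le> fiber_count (T ^^ n) j j"
        by (rule fiber_count_iterate_mono[OF sysS sysT le jP jP])
      ultimately show ?thesis by linarith
    qed
    then have "h_top S \<le> ereal (ln \<nu>)" using nu1 by (intro S.entropy_upper_bound[OF jP]) auto
    then show "s \<le> \<nu>" unfolding s_def by (rule real_of_ereal_le_ln) (use nu1 in simp)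
  qed
  obtain v where v0: "\<And>i. i \<in> P \<Longrightarrow> v i \<noteq> 0" and v1: "(\<integral>\<^sup>+i. v i \<partial>count_space P) \<le> 1"
    and v_super: "\<And>i F. i \<in> P \<Longrightarrow> finite F \<Longrightarrow> F \<subseteq> P \<Longrightarrow>
      (\<Sum>\<alpha>\<in>F. of_nat (fiber_count S i \<alpha>) * v \<alpha>) \<le> ennreal s * v i"
    unfolding s_def by (rule linearizable_supersolution[OF sysS lin]) blast
  have v_sum: "sum v F \<le> 1" if "finite F" "F \<subseteq> P" for F
  proof -
    have "sum v F = (\<integral>\<^sup>+i. v i * indicator F i \<partial>count_space P)"
      using that by (subst nn_integral_count_space'[of F]) auto
    also have "\<dots> \<le> (\<integral>\<^sup>+i. v i \<partial>count_space P)" by (rule nn_integral_mono) (auto simp: indicator_def)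
    finally show ?thesis using v1 by simp
  qed
  have v_fin: "v i \<noteq> \<infinity>" if "i \<in> P" for i
    using v_sum[of "{i}"] that by (auto simp: top_unique)
  \<comment> \<open>The finitely many elements of \<open>P'\<close> entered from outside;
    \<open>C\<close> dominates \<open>u / v\<close> on them, which is the entry condition for the
    comparison.\<close>
  define K where "K = {k \<in> P'. \<exists>i \<in> P - P'. k \<subseteq> S ` i}"
  define C where "C = (\<Sum>k\<in>K. u k / v k)"
  have KP: "K \<subseteq> P" using P' by (auto simp: K_def)
  have C_fin: "C \<noteq> \<infinity>"
    unfolding C_def using fin u_fin v0 KP by (auto simp: K_def[symmetric] ennreal_divide_eq_top_iff)
  have bound: "u i \<le> C * v i" if i: "i \<in> P - P'" for i
    unfolding u_def
  proof (rule M.entrance_le_supersolution[OF j P' one _ _ i])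
    fix i assume i: "i \<in> P - P'"
    have "(\<integral>\<^sup>+\<alpha>. M i \<alpha> * v \<alpha> \<partial>count_space P) \<le> ennreal s * v i"
    proof (rule nn_integral_count_space_least[OF S.countable_family])
      fix F assume F: "finite F" "F \<subseteq> P"
      have "(\<Sum>\<alpha>\<in>F. M i \<alpha> * v \<alpha>) = (\<Sum>\<alpha>\<in>F. of_nat (fiber_count S i \<alpha>) * v \<alpha>)"
        by (simp add: M_def rows[OF i])
      also have "\<dots> \<le> ennreal s * v i" by (rule v_super) (use i F in auto)
      finally show "(\<Sum>\<alpha>\<in>F. M i \<alpha> * v \<alpha>) \<le> ennreal s * v i" .
    qed
    then have "ennreal R * (\<integral>\<^sup>+\<alpha>. M i \<alpha> * v \<alpha> \<partial>count_space P) \<le> ennreal R * (ennreal s * v i)"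
      by (rule mult_left_mono) simp
    also have "\<dots> = ennreal (R * s) * v i" using R by (simp add: ennreal_mult s_def mult.assoc)
    also have "\<dots> \<le> 1 * v i"
    proof (rule mult_right_mono)
      have "R * s \<le> 1" using s_le R by (simp add: field_simps)
      then show "ennreal (R * s) \<le> 1" by (simp add: ennreal_le_1)
    qed simp
    finally show "ennreal R * (\<integral>\<^sup>+\<alpha>. M i \<alpha> * v \<alpha> \<partial>count_space P) \<le> v i" by simp
  next
    fix i \<alpha> assume i: "i \<in> P - P'" and \<alpha>: "\<alpha> \<in> P'" and ne: "M i \<alpha> \<noteq> 0"
    have \<alpha>P: "\<alpha> \<in> P" using \<alpha> P' by blast
    have "fiber_count S i \<alpha> > 0" using ne rows[OF i] by (simp add: M_def)
    then have "\<alpha> \<subseteq> S ` i" using S.fiber_count_pos_covers[of i \<alpha>] i \<alpha>P by blast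
    then have \<alpha>K: "\<alpha> \<in> K" using i \<alpha> by (auto simp: K_def)
    have "u \<alpha> = v \<alpha> * u \<alpha> / v \<alpha>"
      using mult_divide_eq_ennreal[of "v \<alpha>" "u \<alpha>"] v0[OF \<alpha>P] v_fin[OF \<alpha>P] by (simp add: mult.commute)
    also have "\<dots> = (u \<alpha> / v \<alpha>) * v \<alpha>" by (simp add: ennreal_times_divide mult.commute)
    also have "\<dots> \<le> C * v \<alpha>"
    proof (rule mult_right_mono)
      show "u \<alpha> / v \<alpha> \<le> C"
        unfolding C_def by (rule member_le_sum[OF \<alpha>K]) (use fin in \<open>simp_all add: K_def\<close>)
    qed simp
    finally show "M.entrance \<alpha> j (ennreal R) \<le> C * v \<alpha>" by (simp add: u_def)
  qed
  define W where "W = (\<integral>\<^sup>+i. u i \<partial>count_space P)"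
  \<comment> \<open>The first summand bounds the mass on \<open>P'\<close> through the single row
    \<open>k\<close> of the \<open>m\<close>-th power, the second the mass off \<open>P'\<close>,
    where \<open>v\<close> has sum at most 1.\<close>
  define L where "L = ennreal ((1 / R) ^ m) * u k + C"
  have "W \<le> L"
    unfolding W_def
  proof (rule nn_integral_count_space_least[OF S.countable_family])
    fix F assume F: "finite F" "F \<subseteq> P"
    have "ennreal R ^ m * sum u (F \<inter> P') \<le> ennreal R ^ m * (\<Sum>\<alpha>\<in>F \<inter> P'. of_nat (fiber_count (T ^^ m) k \<alpha>) * u \<alpha>)"
    proof (intro mult_left_mono sum_mono)
      fix \<alpha> assume "\<alpha> \<in> F \<inter> P'"
      then have "fiber_count (T ^^ m) k \<alpha> \<ge> 1" using reach[of \<alpha>] by simp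
      then have "(1::ennreal) \<le> of_nat (fiber_count (T ^^ m) k \<alpha>)" by simp
      then have "1 * u \<alpha> \<le> of_nat (fiber_count (T ^^ m) k \<alpha>) * u \<alpha>" by (rule mult_right_mono) simp
      then show "u \<alpha> \<le> of_nat (fiber_count (T ^^ m) k \<alpha>) * u \<alpha>" by simp
    qed simp
    also have "\<dots> \<le> u k" by (rule iter) (use F k in auto)
    finally have "ennreal ((1 / R) ^ m) * (ennreal R ^ m * sum u (F \<inter> P')) \<le> ennreal ((1 / R) ^ m) * u k"
      by (rule mult_left_mono) simp
    moreover have "ennreal ((1 / R) ^ m) * ennreal R ^ m = 1"
    proof -
      have "ennreal ((1 / R) ^ m) * ennreal R ^ m = ennreal ((1 / R) ^ m * R ^ m)"
        using R by (simp add: ennreal_mult ennreal_power)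
      also have "(1 / R) ^ m * R ^ m = 1" using R by (simp add: power_mult_distrib[symmetric])
      finally show ?thesis by simp
    qed
    ultimately have inP: "sum u (F \<inter> P') \<le> ennreal ((1 / R) ^ m) * u k"
      by (simp add: mult.assoc[symmetric])
    have "sum u (F - P') \<le> (\<Sum>i\<in>F - P'. C * v i)" by (rule sum_mono) (use bound F in auto)
    also have "\<dots> = C * sum v (F - P')" by (rule sum_distrib_left[symmetric])
    also have "\<dots> \<le> C * 1" by (rule mult_left_mono) (use v_sum[of "F - P'"] F in auto)
    finally have outP: "sum u (F - P') \<le> C" by simp
    have "sum u F = sum u (F \<inter> P') + sum u (F - P')" by (rule sum.Int_Diff[OF F(1)])
    also have "\<dots> \<le> L" unfolding L_def by (rule add_mono[OF inP outP])
    finally show "sum u F \<le> L" .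
  qed
  moreover have "L \<noteq> \<infinity>" using C_fin u_fin[OF k] by (simp add: L_def ennreal_mult_eq_top_iff)
  ultimately have W_fin: "W \<noteq> \<infinity>" by (metis infinity_ennreal_def neq_top_trans)
  have "u j \<le> W"
  proof -
    have "u j = (\<integral>\<^sup>+i. u i * indicator {j} i \<partial>count_space P)"
      using jP by (subst nn_integral_count_space'[of "{j}"]) auto
    also have "\<dots> \<le> W" unfolding W_def by (rule nn_integral_mono) (auto simp: indicator_def)
    finally show ?thesis .
  qed
  then have W_ge: "1 \<le> W" using uj by simp
  define w where "w = enn2real W"
  have w: "W = ennreal w" using W_fin by (simp add: w_def less_top)
  have "w \<ge> 1" using W_ge unfolding w by (simp add: ennreal_ge_1)
  then have w0: "w > 0" by simp
  define u' where "u' i = enn2real (u i) / w" for i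
  have u'_eq: "ennreal (u' i) = ennreal (1 / w) * u i" if "i \<in> P" for i
  proof -
    have "u i = ennreal (enn2real (u i))" using u_fin[OF that] by (simp add: less_top)
    then have "ennreal (1 / w) * u i = ennreal (1 / w * enn2real (u i))"
      using w0 by (metis divide_nonneg_pos enn2real_nonneg ennreal_mult zero_le_one)
    then show ?thesis by (simp add: u'_def)
  qed
  have eigm: "eigenmeasure P T u' (1 / R)"
  proof (unfold_locales)
    show "1 / R > 1" using R R1 by simp
    show "u' i > 0" if "i \<in> P" for i
      using u_pos[OF that] u_fin[OF that] w0 by (simp add: u'_def enn2real_positive_iff less_top zero_less_iff_neq_zero)
    have "(\<integral>\<^sup>+i. ennreal (u' i) \<partial>count_space P) = (\<integral>\<^sup>+i. ennreal (1 / w) * u i \<partial>count_space P)"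
      by (rule nn_integral_cong) (use u'_eq in simp)
    also have "\<dots> = ennreal (1 / w) * W" unfolding W_def by (rule nn_integral_cmult) simp
    also have "\<dots> = 1" using w w0 by (simp add: ennreal_mult[symmetric])
    finally show "(\<integral>\<^sup>+i. ennreal (u' i) \<partial>count_space P) = 1" .
    fix i assume i: "i \<in> P"
    have "(\<integral>\<^sup>+\<alpha>. of_nat (fiber_count T i \<alpha>) * ennreal (u' \<alpha>) \<partial>count_space P) =
        (\<integral>\<^sup>+\<alpha>. ennreal (1 / w) * (M i \<alpha> * u \<alpha>) \<partial>count_space P)"
      by (rule nn_integral_cong) (use u'_eq in \<open>simp add: M_def mult.left_commute\<close>)
    also have "\<dots> = ennreal (1 / w) * (\<integral>\<^sup>+\<alpha>. M i \<alpha> * u \<alpha> \<partial>count_space P)" by (rule nn_integral_cmult) simp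
    also have "(\<integral>\<^sup>+\<alpha>. M i \<alpha> * u \<alpha> \<partial>count_space P) = ennreal (1 / R) * (ennreal R * (\<integral>\<^sup>+\<alpha>. M i \<alpha> * u \<alpha> \<partial>count_space P))"
    proof -
      have "ennreal (1 / R) * ennreal R = 1" using R by (simp add: ennreal_mult[symmetric])
      then show ?thesis by (simp add: mult.assoc[symmetric])
    qed
    also have "\<dots> = ennreal (1 / R) * u i" by (simp only: eig)
    also have "ennreal (1 / w) * (ennreal (1 / R) * u i) = ennreal (1 / R) * (ennreal (1 / w) * u i)"
      by (rule mult.left_commute)
    also have "\<dots> = ennreal (1 / R) * ennreal (u' i)" by (simp only: u'_eq[OF i])
    also have "\<dots> = ennreal (1 / R * u' i)"
      by (rule ennreal_mult[symmetric]) (use R w0 in \<open>simp_all add: u'_def\<close>)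
    finally show "(\<integral>\<^sup>+\<alpha>. of_nat (fiber_count T i \<alpha>) * ennreal (u' \<alpha>) \<partial>count_space P) = ennreal (1 / R * u' i)" .
  qed
  obtain g where g: "continuous_on {0..1} g" "g ` {0..1} \<subseteq> {0..1}" "constant_slope g (1 / R)" "topologically_conjugate T g"
    using eigenmeasure.constant_slope_conjugacy[OF eigm] by blast
  have "h_top T \<le> ereal (ln (1 / R))"
    by (rule constant_slope_entropy_le[OF T.maps g(1,3,4)]) (use R R1 in simp)
  moreover have "h_top T \<ge> ereal (ln (1 / R))" by (rule entropy_eq_of_series[OF sysT jP R R1 div])
  ultimately have "h_top T = ereal (ln (1 / R))" by (rule antisym)
  then have "exp (real_of_ereal (h_top T)) = 1 / R" using R by simp
  then show ?thesis unfolding linearizable_def using g by metis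
qed

theorem theorem10:
  fixes S T :: "real \<Rightarrow> real" and P P' :: "real set set"
  assumes "S \<in> cpmm" and "markov_partition S P"
    and "recurrent_map S" and "linearizable S"
    and "window_perturbation S P P' T" and "centralized P P'"
    and "recurrent_map T"
    and "finite {k \<in> P'. \<exists>i \<in> P - P'. k \<subseteq> S ` i}"
  shows "linearizable T"
proof -
  have sysS: "mixing_system P S"
    using assms(1,2) by (intro markov_partition_imp_mixing_system) (simp_all add: cpmm_def)
  note pert = window_perturbation_system[OF assms(5) sysS]
  have Tc: "T \<in> cpmm" and P': "P' \<subseteq> P" using assms(5) by (simp_all add: window_perturbation_def)
  interpret T: mixing_system P T by (rule pert(1))
  show ?thesis
  proof (cases "P' = {}")
    \<comment> \<open>There is no window to host the target \<open>j\<close>; the singleton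
      \<open>{j}\<close> takes the role of \<open>P'\<close>, with all rows equal and an entry set
      that is trivially finite.\<close>
    case True
    obtain j where j: "j \<in> P" using T.nonempty_family by blast
    obtain m where m: "fiber_count (T ^^ m) j j > 0" using T.irreducible[OF j j] by blast
    show ?thesis
    proof (rule linearizable_of_dominated_rows[OF Tc assms(7) sysS pert(1) assms(4), of "{j}" j j m])
      show "fiber_count T i \<alpha> = fiber_count S i \<alpha>" if "i \<in> P - {j}" for i \<alpha>
        using pert(2) that True by simp
      show "fiber_count S i \<alpha> \<le> fiber_count T i \<alpha>" if "i \<in> P" "\<alpha> \<in> P" for i \<alpha> by (rule pert(3)[OF that])
      show "finite {k \<in> {j}. \<exists>i \<in> P - {j}. k \<subseteq> S ` i}" by simp
    qed (use j m in auto)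
  next
    case False
    then obtain j where j: "j \<in> P'" by blast
    have jP: "j \<in> P" using j P' by blast
    \<comment> \<open>Centralization keeps \<open>\<Union>P'\<close> away from 0 and 1, so a single
      iterate of a single element covers it even if \<open>P'\<close> is infinite.\<close>
    obtain a b where ab: "0 < a" "b < 1" "\<Union>P' \<subseteq> {a..b}"
      using assms(6) False unfolding centralized_def by auto
    obtain s t where st: "0 \<le> s" "s < t" "t \<le> 1" "j = {s..t}" using T.elementE[OF jP] by metis
    obtain m where m: "{a..b} \<subseteq> (T ^^ m) ` j" using T.image_covers[OF st(1-3) ab(1,2)] st(4) by blast
    show ?thesis
    proof (rule linearizable_of_dominated_rows[OF Tc assms(7) sysS pert(1) assms(4) P' j _ _ assms(8) jP, of m])
      show "fiber_count T i \<alpha> = fiber_count S i \<alpha>" if "i \<in> P - P'" for i \<alpha> by (rule pert(2)[OF that])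
      show "fiber_count S i \<alpha> \<le> fiber_count T i \<alpha>" if "i \<in> P" "\<alpha> \<in> P" for i \<alpha> by (rule pert(3)[OF that])
      show "fiber_count (T ^^ m) j i > 0" if i: "i \<in> P'" for i
      proof -
        have iP: "i \<in> P" using i P' by blast
        obtain c d where cd: "c < d" "i = {c..d}" "interior i = {c<..<d}" using T.elementE[OF iP] by metis
        obtain y where "c < y" "y < d" using dense[OF cd(1)] by blast
        then have y: "y \<in> interior i" using cd by simp
        then have "y \<in> (T ^^ m) ` j" using m ab(3) i interior_subset by blast
        then obtain x where "x \<in> j" "(T ^^ m) x \<in> interior i" using y by blast
        then show ?thesis using boundary_map.fiber_count_pos_iff[OF T.iterate jP iP] by blast
      qed
    qed
  qed
qed

end
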